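(* Let $\Omega\subset\mathbb{R}^d$ ($d\ge 1$) be a bounded open domain. Let $a\in L^\infty(\Omega)$ satisfy $a\ge \underline{a}$ almost everywhere in $\Omega$ for some constant $\underline{a}>0$, and assume that there exist $q\in[1,+\infty]$, $\alpha\in(0,1]$ and $g\in L^q(\Omega)$ such that $$|a(x)-a(y)|\le g(x)\,|x-y|^\alpha\qquad\text{for a.e. }(x,y)\in\Omega^2 .$$ Let $u\in H^1(\Omega)$ be a weak solution of $-\operatorname{div}(a\nabla u)=\operatorname{div}F$ in $\Omega$. Let $\Omega'\Subset\Omega$, let $\lambda\in(0,d)$ with $\lambda\le 2\alpha q$, and let $q'\in[1,+\infty]$ with $q'\le 2\alpha q/\lambda$. Then $$F\in L^{2,\lambda,q'}(\Omega)\quad\Longrightarrow\quad \nabla u\in L^{2,\lambda,q'}(\Omega'),$$ and there exists a positive constant $C=C(d,\alpha,\lambda,q,q',\underline{a},\Omega,\Omega')$ such that $$\|\nabla u\|_{L^{2,\lambda,q'}(\Omega')}\le C\left(\left(1+\|g\|_{L^q(\Omega)}^{\lambda/(2\alpha)}\right)\|\nabla u\|_{L^2(\Omega)}+\|F\|_{L^{2,\lambda,q'}(\Omega)}\right).$$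
   Context: $\Omega'\Subset\Omega$ means that $\Omega'\subset\Omega$ is an open subdomain with $\operatorname{dist}(\Omega',\partial\Omega)>0$. Weak solution: $F$ is a square-integrable vector field on $\Omega$ and $\int_\Omega a\nabla u\cdot\nabla\varphi=-\int_\Omega F\cdot\nabla\varphi$ for all $\varphi\in C_c^\infty(\Omega)$. For a bounded open set $D\subset\mathbb{R}^d$, $x\in D$, $r>0$, put $B_D(x,r):=B(x,r)\cap D$. Generalized Morrey space: for $p\in[1,+\infty)$, $\lambda\ge0$, $v\in L^p(D)$ (scalar or vector valued, with $|\cdot|$ the Euclidean norm), the $(p,\lambda)$-concentration function is $$E_D^{p,\lambda}[v](x):=\sup_{r>0}r^{-\lambda/p}\|v\|_{L^p(B_D(x,r))},\quad x\in D,$$ and for $s\in[1,+\infty]$, $L^{p,\lambda,s}(D):=\{v\in L^p(D): E_D^{p,\lambda}[v]\in L^s(D)\}$ with norm $\|v\|_{L^{p,\lambda,s}(D)}:=\|E_D^{p,\lambda}[v]\|_{L^s(D)}$. If $q=+\infty$, then $2\alpha q$ and $2\alpha q/\lambda$ are understood as $+\infty$. *)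

theory Defs
  imports "HOL-Analysis.Analysis" "HOL-Probability.Essential_Supremum"
begin

section \<open>Lebesgue spaces on a subset of Euclidean space\<close>

text \<open>
  Elements of \<open>L\<^sup>p(D)\<close> are represented by functions on the whole space of which only the
  restriction to \<open>D\<close> matters. Norms take values in \<open>[0,\<infinity>]\<close>, exponents in \<open>[1,\<infinity>]\<close> have type
  \<^typ>\<open>ennreal\<close>.
\<close>

text \<open>Only used for exponents \<open>t > 0\<close>, where \<open>\<infinity>\<close> to the power \<open>t\<close> is \<open>\<infinity>\<close>.\<close>

definition epowr :: "ennreal \<Rightarrow> real \<Rightarrow> ennreal" (infixr "epowr" 80) where
  "x epowr t = (if x = \<infinity> then \<infinity> else ennreal (enn2real x powr t))"

definition eLp_norm :: "'a::euclidean_space set \<Rightarrow> ennreal \<Rightarrow> ('a \<Rightarrow> ennreal) \<Rightarrow> ennreal" where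
  "eLp_norm D p f =
     (if p = \<infinity> then esssup (lebesgue_on D) f
      else (\<integral>\<^sup>+x. f x epowr enn2real p \<partial>lebesgue_on D) epowr (1 / enn2real p))"

definition Lp_norm ::
  "'a::euclidean_space set \<Rightarrow> ennreal \<Rightarrow> ('a \<Rightarrow> 'b::real_normed_vector) \<Rightarrow> ennreal" where
  "Lp_norm D p v = eLp_norm D p (\<lambda>x. ennreal (norm (v x)))"

definition Lp :: "'a::euclidean_space set \<Rightarrow> ennreal \<Rightarrow> ('a \<Rightarrow> 'b::real_normed_vector) set" where
  "Lp D p = {v. v \<in> borel_measurable (lebesgue_on D) \<and> Lp_norm D p v < \<infinity>}"


section \<open>Generalized Morrey spaces\<close>

definition concentration ::
  "'a::euclidean_space set \<Rightarrow> real \<Rightarrow> real \<Rightarrow> ('a \<Rightarrow> 'b::real_normed_vector) \<Rightarrow> 'a \<Rightarrow> ennreal" where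
  "concentration D p l v x =
     (SUP r\<in>{0<..}. ennreal (r powr (- l / p)) * Lp_norm (ball x r \<inter> D) (ennreal p) v)"

definition Morrey_norm ::
  "'a::euclidean_space set \<Rightarrow> real \<Rightarrow> real \<Rightarrow> ennreal \<Rightarrow> ('a \<Rightarrow> 'b::real_normed_vector) \<Rightarrow> ennreal" where
  "Morrey_norm D p l s v = eLp_norm D s (concentration D p l v)"

definition Morrey ::
  "'a::euclidean_space set \<Rightarrow> real \<Rightarrow> real \<Rightarrow> ennreal \<Rightarrow> ('a \<Rightarrow> 'b::real_normed_vector) set" where
  "Morrey D p l s =
     {v \<in> Lp D (ennreal p). concentration D p l v \<in> borel_measurable (lebesgue_on D)
        \<and> Morrey_norm D p l s v < \<infinity>}"


section \<open>Test functions\<close>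

primrec iter_partial ::
  "'a::euclidean_space list \<Rightarrow> ('a \<Rightarrow> real) \<Rightarrow> 'a \<Rightarrow> real" where
  "iter_partial [] f = f"
| "iter_partial (b # bs) f = (\<lambda>x. frechet_derivative (iter_partial bs f) (at x) b)"

text \<open>Total differentiability of every iterated partial derivative in particular makes all of
  them continuous, so this is exactly the class \<open>C\<^sup>\<infinity>\<close>.\<close>

definition smooth :: "('a::euclidean_space \<Rightarrow> real) \<Rightarrow> bool" where
  "smooth f \<longleftrightarrow> (\<forall>bs. set bs \<subseteq> Basis \<longrightarrow> iter_partial bs f differentiable_on UNIV)"

text \<open>Test functions on \<open>\<Omega>\<close> are extended by zero to the whole space.\<close>

definition test_functions :: "'a::euclidean_space set \<Rightarrow> ('a \<Rightarrow> real) set" where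
  "test_functions \<Omega> =
     {\<phi>. smooth \<phi> \<and> compact (closure {x. \<phi> x \<noteq> 0}) \<and> closure {x. \<phi> x \<noteq> 0} \<subseteq> \<Omega>}"

definition grad :: "('a::euclidean_space \<Rightarrow> real) \<Rightarrow> 'a \<Rightarrow> 'a" where
  "grad \<phi> x = (\<Sum>b\<in>Basis. frechet_derivative \<phi> (at x) b *\<^sub>R b)"


section \<open>Weak gradients and weak solutions\<close>

definition weak_gradient ::
  "'a::euclidean_space set \<Rightarrow> ('a \<Rightarrow> real) \<Rightarrow> ('a \<Rightarrow> 'a) \<Rightarrow> bool" where
  "weak_gradient \<Omega> u Du \<longleftrightarrow>
     (\<forall>\<phi>\<in>test_functions \<Omega>. \<forall>b\<in>Basis.
        (\<integral>x. u x * (grad \<phi> x \<bullet> b) \<partial>lebesgue_on \<Omega>) =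
        - (\<integral>x. (Du x \<bullet> b) * \<phi> x \<partial>lebesgue_on \<Omega>))"

text \<open>\<open>H1_gradient \<Omega> u Du\<close>: \<open>u \<in> H\<^sup>1(\<Omega>)\<close> and \<open>Du\<close> is a representative of \<open>\<nabla>u\<close>, which is
  unique up to null sets.\<close>

definition H1_gradient ::
  "'a::euclidean_space set \<Rightarrow> ('a \<Rightarrow> real) \<Rightarrow> ('a \<Rightarrow> 'a) \<Rightarrow> bool" where
  "H1_gradient \<Omega> u Du \<longleftrightarrow> u \<in> Lp \<Omega> 2 \<and> Du \<in> Lp \<Omega> 2 \<and> weak_gradient \<Omega> u Du"

text \<open>\<open>u \<in> H\<^sup>1(\<Omega>)\<close> with gradient \<open>Du\<close> solves \<open>- div (a \<nabla>u) = div F\<close> weakly in \<open>\<Omega>\<close>.\<close>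

definition weak_solution ::
  "'a::euclidean_space set \<Rightarrow> ('a \<Rightarrow> real) \<Rightarrow> ('a \<Rightarrow> 'a) \<Rightarrow> ('a \<Rightarrow> real) \<Rightarrow> ('a \<Rightarrow> 'a) \<Rightarrow> bool" where
  "weak_solution \<Omega> a F u Du \<longleftrightarrow>
     H1_gradient \<Omega> u Du \<and> F \<in> Lp \<Omega> 2 \<and>
     (\<forall>\<phi>\<in>test_functions \<Omega>.
        (\<integral>x. a x * (Du x \<bullet> grad \<phi> x) \<partial>lebesgue_on \<Omega>) =
        - (\<integral>x. F x \<bullet> grad \<phi> x \<partial>lebesgue_on \<Omega>))"

definition compactly_inside :: "'a::euclidean_space set \<Rightarrow> 'a set \<Rightarrow> bool" (infix "\<Subset>" 50) where
  "\<Omega>' \<Subset> \<Omega> \<longleftrightarrow> open \<Omega>' \<and> \<Omega>' \<subseteq> \<Omega> \<and> setdist \<Omega>' (frontier \<Omega>) > 0"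

end

theory Submission
  imports Defs
begin

text \<open>
  The theorem follows from a pointwise estimate: with the concentration function \<open>E\<close>,
  for almost every \<open>x \<in> \<Omega>'\<close>,
  \<open>E[\<nabla>u](x) \<le> C ((1 + |g(x)|\<^sup>\<beta>) \<parallel>\<nabla>u\<parallel> + E[F](x))\<close> where \<open>\<beta> = \<lambda> / (2\<alpha>)\<close>
  (\<open>pointwise_morrey_bound\<close>). Taking \<open>L\<close> norms with exponent \<open>q'\<close> gives the claim, since
  \<open>q' \<beta> \<le> q\<close> makes \<open>|g|\<^sup>\<beta>\<close> an element of that space on the bounded set \<open>\<Omega>\<close>
  (\<open>weight_norm_bound\<close>).

  For the pointwise estimate the coefficient is frozen at the centre \<open>x\<close>. On a ball of radius
  \<open>R\<close> the field \<open>v = \<nabla>u\<close> satisfies \<open>div v = div G\<close> with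
  \<open>G = (- F + (a(x) - a) \<nabla>u) / a(x)\<close>, and the deviation \<open>|a(x) - a|\<close> is at most
  \<open>|g(x)| R\<^sup>\<alpha>\<close> there. A gradient \<open>v\<close> with \<open>div v = div G\<close> satisfies, for \<open>r \<le> R / 2\<close>,
  \<open>\<integral>\<^bsub>B(r)\<^esub> |v|\<^sup>2 \<le> C (r / R)\<^sup>d \<integral>\<^bsub>B(R)\<^esub> |v|\<^sup>2 + 8 \<integral>\<^bsub>B(R)\<^esub> |G|\<^sup>2\<close>
  (\<open>constant_coefficient_decay\<close>). Because \<open>\<lambda> < d\<close>, this can be iterated over geometrically
  shrinking balls (\<open>geometric_iteration\<close>), starting from the largest radius at which
  \<open>|g(x)| R\<^sup>\<alpha>\<close> is small, that is from a fraction of \<open>min \<delta> (|g(x)| powr (- 1 / \<alpha>))\<close>. The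
  negative power of this starting radius is the source of the weight \<open>1 + |g(x)|\<^sup>\<beta>\<close>.

  The decay estimate is usually obtained by comparison with a harmonic function. Here it comes
  from convolutions alone. Let \<open>\<eta>\<^sub>s\<close> be a radial mollifier at scale \<open>s\<close>. There is a smooth radial
  \<open>\<psi>\<close> supported in the ball of radius \<open>s\<close> with \<open>\<Delta>\<psi> = \<eta>\<^sub>s - \<eta>\<^sub>t\<close> (\<open>hess_pot_trace\<close>). Testing the
  equation with derivatives of translates of \<open>\<psi>\<close> yields
  \<open>v * \<eta>\<^sub>s - v * \<eta>\<^sub>t = D\<^sup>2\<psi> * G\<close> (\<open>mollifier_difference_identity\<close>). For \<open>s = R / 2\<close> the first term is
  bounded pointwise by a multiple of \<open>\<parallel>v\<parallel> R powr (- d / 2)\<close>, which produces the factor \<open>(r / R)\<^sup>d\<close>. The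
  operator \<open>G \<mapsto> D\<^sup>2\<psi> * G\<close> is bounded on square integrable fields uniformly in \<open>s\<close> and \<open>t\<close>
  (\<open>energy_estimate\<close>): integrating by parts twice,
  \<open>\<parallel>D\<^sup>2\<psi> * G\<parallel>\<^sup>2 = \<langle>D\<^sup>2\<psi> * G, \<Delta>\<psi> * G\<rangle>\<close>, and \<open>\<Delta>\<psi>\<close> is a difference of two kernels of fixed mass. Letting
  \<open>t\<close> tend to \<open>0\<close> recovers \<open>v\<close> itself (\<open>mollify_Fatou\<close>).
\<close>

section \<open>A smooth cut-off profile on the line\<close>

text \<open>The germs \<open>P (1 / t) exp (- 1 / t)\<close>, extended by zero to \<open>t \<le> 0\<close>, form a family that is closed under
  differentiation; \<open>germ_deriv\<close> is the derivation that this induces on \<open>P\<close>.\<close>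

definition exp_germ :: "real poly \<Rightarrow> real \<Rightarrow> real" where
  "exp_germ P t = (if t > 0 then poly P (1 / t) * exp (- (1 / t)) else 0)"

definition germ_deriv :: "real poly \<Rightarrow> real poly" where
  "germ_deriv P = [:0, 0, 1:] * (P - pderiv P)"

lemma poly_times_exp_tendsto_0: "((\<lambda>x. poly P x * exp (- x)) \<longlongrightarrow> 0) at_top" for P :: "real poly"
proof -
  have *: "((\<lambda>x::real. x ^ n * exp (- x)) \<longlongrightarrow> 0) at_top" for n
    using tendsto_power_div_exp_0[of n] by (simp add: exp_minus divide_inverse)
  have "((\<lambda>x. \<Sum>i\<le>degree P. coeff P i * (x ^ i * exp (- x))) \<longlongrightarrow> (\<Sum>i\<le>degree P. coeff P i * 0)) at_top"
    by (intro tendsto_sum tendsto_mult tendsto_const *)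
  then show ?thesis
    by (simp only: poly_altdef sum_distrib_right) (simp add: mult.assoc)
qed

text \<open>Away from the origin this is the chain rule; at the origin the difference quotient is again a germ of
  this kind, with \<open>P\<close> multiplied by the variable, and tends to zero.\<close>

lemma exp_germ_deriv: "(exp_germ P has_real_derivative exp_germ (germ_deriv P) t) (at t)"
proof -
  consider "t > 0" | "t = 0" | "t < 0" by linarith
  then show ?thesis
  proof cases
    case 1
    have "((\<lambda>t. poly P (1 / t) * exp (- (1 / t))) has_real_derivative exp_germ (germ_deriv P) t) (at t)"
      using 1
      by (auto intro!: derivative_eq_intros poly_DERIV[THEN DERIV_chain2] simp: exp_germ_def germ_deriv_def field_simps power2_eq_square)
    then show ?thesis
      by (rule DERIV_cong_ev[THEN iffD1, rotated 3])
        (use 1 in \<open>auto simp: exp_germ_def intro!: eventually_mono[OF eventually_nhds_in_open[of "{0<..}"]]\<close>)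
  next
    case 2
    have "((\<lambda>h. exp_germ ([:0, 1:] * P) h) \<longlongrightarrow> 0) (at_right 0)"
    proof -
      have "((\<lambda>h. poly ([:0, 1:] * P) (inverse h) * exp (- inverse h)) \<longlongrightarrow> 0) (at_right 0)"
        by (rule filterlim_compose[OF poly_times_exp_tendsto_0 filterlim_inverse_at_top_right])
      then show ?thesis
        by (rule Lim_transform_eventually) (auto simp: exp_germ_def eventually_at_right_field divide_inverse intro!: exI[of _ 1])
    qed
    moreover have "((\<lambda>h. exp_germ ([:0, 1:] * P) h) \<longlongrightarrow> 0) (at_left 0)"
      by (rule tendsto_eventually) (auto simp: exp_germ_def eventually_at_left_field intro!: exI[of _ "-1"])
    ultimately have "((\<lambda>h. exp_germ ([:0, 1:] * P) h) \<longlongrightarrow> 0) (at 0)"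
      by (simp add: filterlim_at_split)
    moreover have "exp_germ ([:0, 1:] * P) h = (exp_germ P h - exp_germ P 0) / (h - 0)" for h
      by (simp add: exp_germ_def)
    ultimately show ?thesis
      using 2 by (simp add: has_field_derivative_iff exp_germ_def)
  next
    case 3
    have "((\<lambda>t. 0) has_real_derivative exp_germ (germ_deriv P) t) (at t)"
      using 3 by (auto simp: exp_germ_def)
    then show ?thesis
      by (rule DERIV_cong_ev[THEN iffD1, rotated 3])
        (use 3 in \<open>auto simp: exp_germ_def intro!: eventually_mono[OF eventually_nhds_in_open[of "{..<0}"]]\<close>)
  qed
qed

text \<open>The iterated derivatives of \<open>exp (- 1 / (1 - \<tau>))\<close>, extended by zero to \<open>\<tau> \<ge> 1\<close>, to be evaluated at \<open>\<tau> = |x|\<^sup>2\<close>.\<close>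

definition cutoff :: "nat \<Rightarrow> real \<Rightarrow> real" where
  "cutoff k \<tau> = exp_germ (((\<lambda>P. - germ_deriv P) ^^ k) 1) (1 - \<tau>)"

lemma exp_germ_uminus: "exp_germ (- P) t = - exp_germ P t"
  by (simp add: exp_germ_def)

lemma cutoff_deriv: "(cutoff k has_real_derivative cutoff (Suc k) \<tau>) (at \<tau>)"
proof -
  have "((\<lambda>\<tau>. cutoff k \<tau>) has_real_derivative
      exp_germ (germ_deriv (((\<lambda>P. - germ_deriv P) ^^ k) 1)) (1 - \<tau>) * (- 1)) (at \<tau>)"
    unfolding cutoff_def[abs_def]
    by (rule DERIV_chain2[OF exp_germ_deriv]) (auto intro!: derivative_eq_intros)
  then show ?thesis
    by (simp add: cutoff_def[abs_def] exp_germ_uminus)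
qed

lemma cutoff_continuous [continuous_intros]:
  "continuous_on A f \<Longrightarrow> continuous_on A (\<lambda>x. cutoff k (f x))"
  by (rule continuous_on_compose2[of UNIV "cutoff k"])
     (auto intro!: DERIV_continuous_on cutoff_deriv)

lemma cutoff_eq_0: "\<tau> \<ge> 1 \<Longrightarrow> cutoff k \<tau> = 0"
  by (simp add: cutoff_def exp_germ_def)

lemma cutoff0_nonneg: "cutoff 0 \<tau> \<ge> 0"
  by (simp add: cutoff_def exp_germ_def)

lemma cutoff0_le_1: "cutoff 0 \<tau> \<le> 1"
  by (simp add: cutoff_def exp_germ_def)

lemma cutoff0_pos: "\<tau> < 1 \<Longrightarrow> cutoff 0 \<tau> > 0"
  by (simp add: cutoff_def exp_germ_def)

section \<open>A radial potential whose Laplacian is a difference of two mollifiers\<close>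

definition mollifier :: "real \<Rightarrow> 'a::euclidean_space \<Rightarrow> real" where
  "mollifier s w = inverse s ^ DIM('a) * cutoff 0 (w \<bullet> w * inverse s ^ 2)"

text \<open>Differentiating \<open>\<eta>\<^sub>\<sigma>(x) = \<sigma> powr (- d) e(|x|\<^sup>2 / \<sigma>\<^sup>2)\<close>, with \<open>e\<close> the profile \<open>cutoff 0\<close>, in \<open>\<sigma>\<close> gives
  \<open>- div (x \<sigma> powr (- d - 1) e(|x|\<^sup>2 / \<sigma>\<^sup>2))\<close>, the divergence of a radial field and hence a
  Laplacian. Integration over \<open>\<sigma> \<in> [t, s]\<close> shows that \<open>\<eta>\<^sub>s - \<eta>\<^sub>t\<close> is the Laplacian of \<open>\<psi>(x) = p(|x|\<^sup>2)\<close>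
  where \<open>p' = pot d t s 0\<close>; then \<open>pot d t s k\<close> is the derivative of order \<open>k + 1\<close> of \<open>p\<close>. Only
  derivatives of \<open>\<psi>\<close> occur below, and this construction is the same in every dimension, unlike one that
  starts from the fundamental solution.\<close>

definition pot :: "nat \<Rightarrow> real \<Rightarrow> real \<Rightarrow> nat \<Rightarrow> real \<Rightarrow> real" where
  "pot d t s k \<tau> =
     - (1 / 2) * integral (cbox t s) (\<lambda>\<sigma>. inverse \<sigma> ^ (d + 1 + 2 * k) * cutoff k (\<tau> * inverse \<sigma> ^ 2))"

lemma pot_deriv:
  assumes "0 < t"
  shows "(pot d t s k has_real_derivative pot d t s (Suc k) \<tau>) (at \<tau>)"
proof -
  have "((\<lambda>\<tau>. integral (cbox t s) (\<lambda>\<sigma>. inverse \<sigma> ^ (d + 1 + 2 * k) * cutoff k (\<tau> * inverse \<sigma> ^ 2)))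
     has_real_derivative integral (cbox t s) (\<lambda>\<sigma>. inverse \<sigma> ^ (d + 1 + 2 * Suc k) * cutoff (Suc k) (\<tau> * inverse \<sigma> ^ 2)))
     (at \<tau> within UNIV)"
  proof (rule leibniz_rule_field_derivative)
    fix x \<sigma> :: real
    have "((\<lambda>x. inverse \<sigma> ^ (d + 1 + 2 * k) * cutoff k (x * inverse \<sigma> ^ 2)) has_real_derivative
       inverse \<sigma> ^ (d + 1 + 2 * k) * (cutoff (Suc k) (x * inverse \<sigma> ^ 2) * inverse \<sigma> ^ 2)) (at x)"
      by (intro DERIV_cmult DERIV_chain2[OF cutoff_deriv])
         (auto intro!: derivative_eq_intros)
    then show "((\<lambda>x. inverse \<sigma> ^ (d + 1 + 2 * k) * cutoff k (x * inverse \<sigma> ^ 2)) has_real_derivative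
       inverse \<sigma> ^ (d + 1 + 2 * Suc k) * cutoff (Suc k) (x * inverse \<sigma> ^ 2)) (at x within UNIV)"
      by (simp add: power_add power2_eq_square mult_ac)
  next
    show "(\<lambda>\<sigma>. inverse \<sigma> ^ (d + 1 + 2 * k) * cutoff k (x * inverse \<sigma> ^ 2)) integrable_on cbox t s" for x
      using assms by (intro integrable_continuous continuous_intros) auto
  next
    show "continuous_on (UNIV \<times> cbox t s)
       (\<lambda>(x, \<sigma>). inverse \<sigma> ^ (d + 1 + 2 * Suc k) * cutoff (Suc k) (x * inverse \<sigma> ^ 2))"
      unfolding case_prod_beta
      using assms by (intro continuous_intros) auto
  qed auto
  then show ?thesis
    unfolding pot_def[abs_def] by (intro DERIV_cmult) auto
qed

lemma pot_continuous:
  assumes "0 < t" "continuous_on A f"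
  shows "continuous_on A (\<lambda>x. pot d t s k (f x))"
  by (rule continuous_on_compose2[of UNIV "pot d t s k"])
     (auto intro!: DERIV_continuous_on pot_deriv assms)

lemma pot_eq_0:
  assumes "0 < t" "\<tau> \<ge> s\<^sup>2"
  shows "pot d t s k \<tau> = 0"
proof -
  have "inverse \<sigma> ^ (d + 1 + 2 * k) * cutoff k (\<tau> * inverse \<sigma> ^ 2) = 0" if "\<sigma> \<in> cbox t s" for \<sigma>
  proof -
    have "0 < \<sigma>" "\<sigma>\<^sup>2 \<le> s\<^sup>2" using that assms by (auto intro!: power_mono)
    then have "1 \<le> \<tau> * inverse \<sigma> ^ 2" using assms by (simp add: power_inverse field_simps)
    then show ?thesis by (simp add: cutoff_eq_0)
  qed
  then have "integral (cbox t s) (\<lambda>\<sigma>. inverse \<sigma> ^ (d + 1 + 2 * k) * cutoff k (\<tau> * inverse \<sigma> ^ 2)) =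
     integral (cbox t s) (\<lambda>\<sigma>. 0)"
    by (intro integral_cong) auto
  then show ?thesis by (simp add: pot_def)
qed

text \<open>The left-hand side is the Laplacian of \<open>p(|x|\<^sup>2)\<close> at \<open>|x|\<^sup>2 = \<tau>\<close>. The integrand in the definition of
  \<open>pot\<close> is such that it equals the integral of a derivative in \<open>\<sigma>\<close>.\<close>

lemma pot_laplace:
  assumes "0 < t" "t \<le> s"
  shows "4 * \<tau> * pot d t s 1 \<tau> + 2 * real d * pot d t s 0 \<tau> =
     inverse s ^ d * cutoff 0 (\<tau> * inverse s ^ 2) - inverse t ^ d * cutoff 0 (\<tau> * inverse t ^ 2)"
proof -
  define f0 where "f0 = (\<lambda>\<sigma>. inverse \<sigma> ^ (d + 1) * cutoff 0 (\<tau> * inverse \<sigma> ^ 2))"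
  define f1 where "f1 = (\<lambda>\<sigma>. inverse \<sigma> ^ (d + 3) * cutoff 1 (\<tau> * inverse \<sigma> ^ 2))"
  have i0: "f0 integrable_on {t..s}" and i1: "f1 integrable_on {t..s}"
    unfolding f0_def f1_def using assms
    by (auto intro!: integrable_continuous_interval continuous_intros)
  have "((\<lambda>\<sigma>. - (real d * f0 \<sigma> + 2 * \<tau> * f1 \<sigma>)) has_integral
      inverse s ^ d * cutoff 0 (\<tau> * inverse s ^ 2) - inverse t ^ d * cutoff 0 (\<tau> * inverse t ^ 2)) {t..s}"
  proof (rule fundamental_theorem_of_calculus[OF assms(2)])
    fix \<sigma> assume "\<sigma> \<in> {t..s}"
    then have \<sigma>: "\<sigma> > 0" using assms by auto
    have d1: "((\<lambda>\<sigma>. inverse \<sigma> ^ n) has_real_derivative - real n * inverse \<sigma> ^ (n + 1)) (at \<sigma>)" for n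
    proof (cases n)
      case (Suc m)
      have "(inverse has_real_derivative - (inverse \<sigma> * 1 * inverse \<sigma>)) (at \<sigma>)"
        using \<sigma> by (intro DERIV_inverse' DERIV_ident) auto
      from DERIV_power_Suc[OF this, of m] show ?thesis
        by (simp add: Suc algebra_simps)
    qed auto
    have "((\<lambda>\<sigma>. inverse \<sigma> ^ d * cutoff 0 (\<tau> * inverse \<sigma> ^ 2)) has_real_derivative
        (- real d * inverse \<sigma> ^ (d + 1)) * cutoff 0 (\<tau> * inverse \<sigma> ^ 2) +
        (cutoff (Suc 0) (\<tau> * inverse \<sigma> ^ 2) * (\<tau> * (- real 2 * inverse \<sigma> ^ (2 + 1)))) * inverse \<sigma> ^ d) (at \<sigma>)"
      by (intro DERIV_mult d1 DERIV_chain2[OF cutoff_deriv] DERIV_cmult)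
    also have "(- real d * inverse \<sigma> ^ (d + 1)) * cutoff 0 (\<tau> * inverse \<sigma> ^ 2) +
        (cutoff (Suc 0) (\<tau> * inverse \<sigma> ^ 2) * (\<tau> * (- real 2 * inverse \<sigma> ^ (2 + 1)))) * inverse \<sigma> ^ d
        = - (real d * f0 \<sigma> + 2 * \<tau> * f1 \<sigma>)"
      by (simp add: f0_def f1_def power_add power3_eq_cube algebra_simps)
    finally show "((\<lambda>\<sigma>. inverse \<sigma> ^ d * cutoff 0 (\<tau> * inverse \<sigma> ^ 2)) has_vector_derivative
        - (real d * f0 \<sigma> + 2 * \<tau> * f1 \<sigma>)) (at \<sigma> within {t..s})"
      by (simp add: has_real_derivative_iff_has_vector_derivative has_vector_derivative_at_within)
  qed
  moreover have "((\<lambda>\<sigma>. - (real d * f0 \<sigma> + 2 * \<tau> * f1 \<sigma>)) has_integral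
      - (real d * integral {t..s} f0 + 2 * \<tau> * integral {t..s} f1)) {t..s}"
    using i0 i1 by (intro has_integral_neg has_integral_add has_integral_mult_right) (auto simp: has_integral_integral)
  ultimately have "- (real d * integral {t..s} f0 + 2 * \<tau> * integral {t..s} f1) =
     inverse s ^ d * cutoff 0 (\<tau> * inverse s ^ 2) - inverse t ^ d * cutoff 0 (\<tau> * inverse t ^ 2)"
    using has_integral_unique by blast
  moreover have "pot d t s 0 \<tau> = - (1 / 2) * integral {t..s} f0" "pot d t s 1 \<tau> = - (1 / 2) * integral {t..s} f1"
    by (simp_all add: pot_def f0_def f1_def numeral_3_eq_3)
  ultimately show ?thesis by simp
qed

section \<open>Smoothness of radial test functions\<close>

text \<open>The algebra generated by the coordinates and by all derivatives of a radial profile is closed under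
  partial derivatives; being differentiable, its members are therefore smooth.\<close>

inductive radial_alg :: "(nat \<Rightarrow> real \<Rightarrow> real) \<Rightarrow> 'a::euclidean_space \<Rightarrow> ('a \<Rightarrow> real) \<Rightarrow> bool"
  for p y where
  const: "radial_alg p y (\<lambda>x. c)"
| coord: "radial_alg p y (\<lambda>x. (x - y) \<bullet> b)"
| profile: "radial_alg p y (\<lambda>x. p k ((x - y) \<bullet> (x - y)))"
| add: "radial_alg p y f \<Longrightarrow> radial_alg p y g \<Longrightarrow> radial_alg p y (\<lambda>x. f x + g x)"
| mult: "radial_alg p y f \<Longrightarrow> radial_alg p y g \<Longrightarrow> radial_alg p y (\<lambda>x. f x * g x)"

lemma has_derivative_radial:
  fixes y :: "'a::euclidean_space"
  assumes "\<And>k \<tau>. (p k has_real_derivative p (Suc k) \<tau>) (at \<tau>)"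
  shows "((\<lambda>x. p k ((x - y) \<bullet> (x - y))) has_derivative
     (\<lambda>h. p (Suc k) ((x - y) \<bullet> (x - y)) * (2 * ((x - y) \<bullet> h)))) (at x)"
  by (rule has_derivative_compose[OF _ assms[THEN has_field_derivative_imp_has_derivative], THEN has_derivative_eq_rhs])
     (auto intro!: derivative_eq_intros simp: fun_eq_iff inner_commute)

lemma radial_alg_deriv:
  assumes p: "\<And>k \<tau>. (p k has_real_derivative p (Suc k) \<tau>) (at \<tau>)"
  assumes "radial_alg p y f"
  shows "f differentiable_on UNIV \<and> radial_alg p y (\<lambda>x. frechet_derivative f (at x) b)"
  using assms(2)
proof induction
  case (const c)
  then show ?case by (auto simp: frechet_derivative_const intro: radial_alg.const)
next
  case (coord c)
  have *: "((\<lambda>x. (x - y) \<bullet> c) has_derivative (\<lambda>h. h \<bullet> c)) (at x)" for x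
    by (auto intro!: derivative_eq_intros)
  then show ?case
    by (auto simp: frechet_derivative_at[OF *, symmetric] differentiable_on_def differentiable_def
        intro: radial_alg.const has_derivative_at_withinI)
next
  case (profile k)
  note * = has_derivative_radial[of p k y, OF p]
  have "radial_alg p y (\<lambda>x. p (Suc k) ((x - y) \<bullet> (x - y)) * (2 * ((x - y) \<bullet> b)))"
    by (intro radial_alg.intros)
  then show ?case
    using * by (auto simp: frechet_derivative_at[OF *, symmetric] differentiable_on_def differentiable_def
        intro: has_derivative_at_withinI)
next
  case (add f g)
  then have d: "(f has_derivative frechet_derivative f (at x)) (at x)"
    "(g has_derivative frechet_derivative g (at x)) (at x)" for x
    by (auto simp: differentiable_on_def frechet_derivative_works)
  note * = has_derivative_add[OF d]
  show ?case
    using add.IH * by (auto simp: frechet_derivative_at[OF *, symmetric] differentiable_on_def differentiable_def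
        intro: radial_alg.add has_derivative_at_withinI)
next
  case (mult f g)
  then have d: "(f has_derivative frechet_derivative f (at x)) (at x)"
    "(g has_derivative frechet_derivative g (at x)) (at x)" for x
    by (auto simp: differentiable_on_def frechet_derivative_works)
  note * = has_derivative_mult[OF d]
  show ?case
    using mult * by (auto simp: frechet_derivative_at[OF *, symmetric] differentiable_on_def differentiable_def
        intro!: radial_alg.add radial_alg.mult intro: has_derivative_at_withinI)
qed

lemma radial_alg_smooth:
  assumes p: "\<And>k \<tau>. (p k has_real_derivative p (Suc k) \<tau>) (at \<tau>)" and f: "radial_alg p y f"
  shows "smooth f"
proof -
  have "radial_alg p y (iter_partial bs f)" for bs
  proof (induction bs)
    case (Cons b bs)
    then show ?case using radial_alg_deriv[of p y "iter_partial bs f" b] p by simp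
  qed (simp add: f)
  then show ?thesis
    unfolding smooth_def using radial_alg_deriv[of p y] p by blast
qed

lemma test_functionsI:
  assumes "smooth f" "\<And>x. f x \<noteq> 0 \<Longrightarrow> x \<in> cball y s" "cball y s \<subseteq> \<Omega>"
  shows "f \<in> test_functions \<Omega>"
proof -
  have "closure {x. f x \<noteq> 0} \<subseteq> cball y s"
    by (rule closure_minimal) (use assms in auto)
  then show ?thesis
    using assms(1,3) unfolding test_functions_def
    by (auto intro!: bounded_closed_imp_seq_compact intro: bounded_subset simp: compact_eq_bounded_closed)
qed

section \<open>Derivatives of the radial potential\<close>

text \<open>The first, second and third derivatives of \<open>\<psi>(w) = p(|w|\<^sup>2)\<close> in the directions \<open>i\<close>, \<open>b\<close>, \<open>c\<close>.\<close>

definition grad_pot :: "real \<Rightarrow> real \<Rightarrow> 'a::euclidean_space \<Rightarrow> 'a \<Rightarrow> real" where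
  "grad_pot t s i w = 2 * pot DIM('a) t s 0 (w \<bullet> w) * (w \<bullet> i)"

definition hess_pot :: "real \<Rightarrow> real \<Rightarrow> 'a::euclidean_space \<Rightarrow> 'a \<Rightarrow> 'a \<Rightarrow> real" where
  "hess_pot t s i b w = 4 * pot DIM('a) t s 1 (w \<bullet> w) * (w \<bullet> i) * (w \<bullet> b)
     + 2 * pot DIM('a) t s 0 (w \<bullet> w) * (i \<bullet> b)"

definition third_pot :: "real \<Rightarrow> real \<Rightarrow> 'a::euclidean_space \<Rightarrow> 'a \<Rightarrow> 'a \<Rightarrow> 'a \<Rightarrow> real" where
  "third_pot t s i b c w = 8 * pot DIM('a) t s 2 (w \<bullet> w) * (w \<bullet> i) * (w \<bullet> b) * (w \<bullet> c)
     + 4 * pot DIM('a) t s 1 (w \<bullet> w) * ((w \<bullet> i) * (b \<bullet> c) + (w \<bullet> b) * (i \<bullet> c) + (w \<bullet> c) * (i \<bullet> b))"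

lemma has_derivative_pot:
  fixes w :: "'a::euclidean_space"
  assumes "0 < t"
  shows "((\<lambda>w. pot d t s k (w \<bullet> w)) has_derivative (\<lambda>h. pot d t s (Suc k) (w \<bullet> w) * (2 * (w \<bullet> h)))) (at w)"
  using has_derivative_radial[of "pot d t s" k 0 w, OF pot_deriv[OF assms]] by simp

lemma grad_pot_deriv:
  assumes "0 < t"
  shows "(grad_pot t s i has_derivative (\<lambda>h. hess_pot t s i h w)) (at w)"
  unfolding grad_pot_def[abs_def]
  by (rule has_derivative_eq_rhs)
     (rule derivative_eq_intros has_derivative_pot[OF assms] refl
       | simp add: hess_pot_def fun_eq_iff algebra_simps inner_commute)+

lemma hess_pot_deriv:
  assumes "0 < t"
  shows "(hess_pot t s i b has_derivative (\<lambda>h. third_pot t s i b h w)) (at w)"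
  unfolding hess_pot_def[abs_def]
  by (rule has_derivative_eq_rhs)
     (rule derivative_eq_intros has_derivative_pot[OF assms] refl
       | simp add: third_pot_def fun_eq_iff algebra_simps inner_commute numeral_2_eq_2)+

lemma hess_pot_sym: "hess_pot t s i b w = hess_pot t s b i w"
  by (simp add: hess_pot_def inner_commute mult_ac)

lemma third_pot_sym: "third_pot t s i b c w = third_pot t s c b i w" "third_pot t s i b c w = third_pot t s b i c w"
  by (simp_all add: third_pot_def inner_commute algebra_simps)

text \<open>The trace of the Hessian is the Laplacian of the potential.\<close>

lemma hess_pot_trace:
  fixes w :: "'a::euclidean_space"
  assumes "0 < t" "t \<le> s"
  shows "(\<Sum>i\<in>Basis. hess_pot t s i i w) = mollifier s w - mollifier t w"
proof -
  have "(\<Sum>i\<in>Basis. hess_pot t s i i w) =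
      4 * pot DIM('a) t s 1 (w \<bullet> w) * (\<Sum>i\<in>Basis. (w \<bullet> i) * (w \<bullet> i)) + 2 * pot DIM('a) t s 0 (w \<bullet> w) * real DIM('a)"
    by (simp add: hess_pot_def sum.distrib sum_distrib_left sum_distrib_right mult_ac)
  also have "(\<Sum>i\<in>Basis. (w \<bullet> i) * (w \<bullet> i)) = w \<bullet> w"
    by (simp add: euclidean_inner[of w w])
  finally show ?thesis
    using pot_laplace[OF assms, of "w \<bullet> w" "DIM('a)"] by (simp add: mollifier_def mult_ac)
qed

text \<open>The convolution kernels below are continuous and supported in a ball about the origin.\<close>

definition ckernel :: "real \<Rightarrow> ('a::euclidean_space \<Rightarrow> real) \<Rightarrow> bool" where
  "ckernel s K \<longleftrightarrow> continuous_on UNIV K \<and> (\<forall>w. norm w \<ge> s \<longrightarrow> K w = 0)"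

lemma pot_eq_0_norm: "0 < t \<Longrightarrow> 0 \<le> s \<Longrightarrow> norm w \<ge> s \<Longrightarrow> pot d t s k (w \<bullet> w) = 0"
  by (rule pot_eq_0) (auto simp flip: power2_norm_eq_inner intro!: power_mono)

lemma ckernel_grad_pot: "0 < t \<Longrightarrow> 0 \<le> s \<Longrightarrow> ckernel s (grad_pot t s i)"
  unfolding ckernel_def grad_pot_def[abs_def]
  by (auto simp: pot_eq_0_norm intro!: continuous_intros pot_continuous)

lemma ckernel_hess_pot: "0 < t \<Longrightarrow> 0 \<le> s \<Longrightarrow> ckernel s (hess_pot t s i b)"
  unfolding ckernel_def hess_pot_def[abs_def]
  by (auto simp: pot_eq_0_norm intro!: continuous_intros pot_continuous)

lemma ckernel_third_pot: "0 < t \<Longrightarrow> 0 \<le> s \<Longrightarrow> ckernel s (third_pot t s i b c)"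
  unfolding ckernel_def third_pot_def[abs_def]
  by (auto simp: pot_eq_0_norm intro!: continuous_intros pot_continuous)

lemma ckernel_mollifier: "0 < s \<Longrightarrow> ckernel s (mollifier s)"
  unfolding ckernel_def mollifier_def[abs_def]
proof (intro conjI allI impI)
  fix w :: 'a assume "0 < s" "s \<le> norm w"
  then have "s\<^sup>2 \<le> w \<bullet> w" by (simp flip: power2_norm_eq_inner add: power_mono)
  then have "1 \<le> w \<bullet> w * inverse s ^ 2" using \<open>0 < s\<close> by (simp add: power_inverse field_simps)
  then show "inverse s ^ DIM('a) * cutoff 0 (w \<bullet> w * inverse s ^ 2) = 0" by (simp add: cutoff_eq_0)
qed (intro continuous_intros)

lemma ckernel_bounded:
  assumes "ckernel s K"
  obtains B where "0 \<le> B" "\<And>w. \<bar>K w\<bar> \<le> B"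
proof -
  have "compact (K ` cball 0 s)"
    using assms by (intro compact_continuous_image) (auto simp: ckernel_def intro: continuous_on_subset)
  then obtain B where B: "\<And>w. w \<in> cball 0 s \<Longrightarrow> \<bar>K w\<bar> \<le> B"
    by (force dest!: compact_imp_bounded simp: bounded_iff)
  show ?thesis
  proof (rule that[of "max 0 B"])
    show "\<bar>K w\<bar> \<le> max 0 B" for w
      using B[of w] assms by (cases "norm w \<le> s") (auto simp: ckernel_def)
  qed auto
qed

lemma ckernel_borel: "ckernel s K \<Longrightarrow> K \<in> borel_measurable borel"
  by (auto simp: ckernel_def intro: borel_measurable_continuous_onI)

lemma ckernel_integrable:
  assumes "ckernel s K" shows "integrable lborel K"
proof -
  obtain B where B: "0 \<le> B" "\<And>w. \<bar>K w\<bar> \<le> B" using ckernel_bounded[OF assms] by blast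
  show ?thesis
  proof (rule integrableI_bounded_set[where A="cball 0 s" and B=B])
    show "emeasure lborel (cball (0::'a) s) < \<infinity>"
      using emeasure_lborel_cball_finite[of 0 s] by (simp add: top.not_eq_extremum)
  qed (use assms B ckernel_borel[OF assms] in \<open>auto simp: ckernel_def\<close>)
qed

lemma ckernel_mult: "ckernel s K \<Longrightarrow> continuous_on UNIV L \<Longrightarrow> ckernel s (\<lambda>w. K w * L w)"
  by (auto simp: ckernel_def intro: continuous_intros)

section \<open>Test functions built from the potential\<close>

lemma radial_test_functions:
  assumes "0 < t" "0 \<le> s" "cball y s \<subseteq> \<Omega>" "ckernel s K" "radial_alg (pot d t s) y (\<lambda>z. K (z - y))"
  shows "(\<lambda>z. K (z - y)) \<in> test_functions \<Omega>"
proof (rule test_functionsI[OF _ _ assms(3)])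
  show "smooth (\<lambda>z. K (z - y))"
    by (rule radial_alg_smooth[OF _ assms(5)]) (rule pot_deriv[OF assms(1)])
  show "K (z - y) \<noteq> 0 \<Longrightarrow> z \<in> cball y s" for z
    using assms(4) by (auto simp: ckernel_def dist_norm norm_minus_commute intro: ccontr)
qed

lemma grad_pot_test: "0 < t \<Longrightarrow> 0 \<le> s \<Longrightarrow> cball y s \<subseteq> \<Omega> \<Longrightarrow> (\<lambda>z. grad_pot t s i (z - y)) \<in> test_functions \<Omega>"
  by (rule radial_test_functions[where d="DIM('a)", OF _ _ _ ckernel_grad_pot]) (auto simp: grad_pot_def intro!: radial_alg.intros)

lemma hess_pot_test: "0 < t \<Longrightarrow> 0 \<le> s \<Longrightarrow> cball y s \<subseteq> \<Omega> \<Longrightarrow> (\<lambda>z. hess_pot t s i b (z - y)) \<in> test_functions \<Omega>"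
  by (rule radial_test_functions[where d="DIM('a)", OF _ _ _ ckernel_hess_pot]) (auto simp: hess_pot_def intro!: radial_alg.intros)

lemma grad_eqI:
  assumes "(f has_derivative f') (at x)"
  shows "grad f x = (\<Sum>b\<in>Basis. f' b *\<^sub>R b)"
  using frechet_derivative_at[OF assms] by (simp add: grad_def)

lemma grad_grad_pot:
  assumes "0 < t" shows "grad (\<lambda>z. grad_pot t s i (z - y)) z = (\<Sum>b\<in>Basis. hess_pot t s i b (z - y) *\<^sub>R b)"
proof (rule grad_eqI)
  show "((\<lambda>z. grad_pot t s i (z - y)) has_derivative (\<lambda>b. hess_pot t s i b (z - y))) (at z)"
    by (rule has_derivative_compose[OF _ grad_pot_deriv[OF assms]]) (auto intro!: derivative_eq_intros)
qed

lemma grad_hess_pot: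
  assumes "0 < t" shows "grad (\<lambda>z. hess_pot t s i c (z - y)) z = (\<Sum>b\<in>Basis. third_pot t s i c b (z - y) *\<^sub>R b)"
proof (rule grad_eqI)
  show "((\<lambda>z. hess_pot t s i c (z - y)) has_derivative (\<lambda>b. third_pot t s i c b (z - y))) (at z)"
    by (rule has_derivative_compose[OF _ hess_pot_deriv[OF assms]]) (auto intro!: derivative_eq_intros)
qed

lemma integrable_mult_bounded:
  fixes f g :: "'a::euclidean_space \<Rightarrow> real"
  assumes "integrable lborel f" "g \<in> borel_measurable borel" "\<And>x. \<bar>g x\<bar> \<le> B"
  shows "integrable lborel (\<lambda>x. f x * g x)"
proof (rule Bochner_Integration.integrable_bound[of _ "\<lambda>x. B * \<bar>f x\<bar>"])
  have "\<bar>f x\<bar> * \<bar>g x\<bar> \<le> \<bar>B\<bar> * \<bar>f x\<bar>" for x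
    using mult_right_mono[OF order_trans[OF assms(3)[of x] abs_ge_self[of B]], of "\<bar>f x\<bar>"]
    by (simp add: mult.commute)
  then show "AE x in lborel. norm (f x * g x) \<le> norm (B * \<bar>f x\<bar>)"
    by (simp add: abs_mult)
qed (use assms in auto)

lemma integrable_mult_ckernel:
  assumes "integrable lborel f" "ckernel s K"
  shows "integrable lborel (\<lambda>z. f z * K (z - y))"
proof -
  obtain B where "\<And>w. \<bar>K w\<bar> \<le> B" using ckernel_bounded[OF assms(2)] by blast
  then show ?thesis
    using assms(1) ckernel_borel[OF assms(2)] by (intro integrable_mult_bounded[where B=B]) auto
qed

text \<open>The convolution of \<open>f\<close> with the reflected kernel. Written in this way, it is the pairing of \<open>f\<close> with a
  translate of \<open>K\<close>, which is what a test function produces.\<close>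

definition correlate :: "('a::euclidean_space \<Rightarrow> real) \<Rightarrow> ('a \<Rightarrow> real) \<Rightarrow> 'a \<Rightarrow> real" where
  "correlate f K y = (\<integral>z. f z * K (z - y) \<partial>lborel)"

text \<open>The heart of the matter is that \<open>v\<^sub>i \<Delta>\<psi>\<close> and \<open>v \<bullet> \<nabla>\<partial>\<^sub>i\<psi>\<close> have the same integral: for a gradient \<open>v\<close>,
  both equal minus the integral of \<open>U \<partial>\<^sub>i\<Delta>\<psi>\<close>, by symmetry of the third derivatives. The second
  integral is the one that the equation turns into an integral of \<open>G\<close>.\<close>

lemma mollifier_difference_identity:
  fixes U :: "'a::euclidean_space \<Rightarrow> real" and v G :: "'a \<Rightarrow> 'a"
  assumes grad_U: "\<And>\<phi> b. \<phi> \<in> test_functions B \<Longrightarrow> b \<in> Basis \<Longrightarrow>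
      (\<integral>z. U z * (grad \<phi> z \<bullet> b) \<partial>lborel) = - (\<integral>z. (v z \<bullet> b) * \<phi> z \<partial>lborel)"
    and div_v: "\<And>\<phi>. \<phi> \<in> test_functions B \<Longrightarrow>
      (\<integral>z. v z \<bullet> grad \<phi> z \<partial>lborel) = (\<integral>z. G z \<bullet> grad \<phi> z \<partial>lborel)"
    and v: "integrable lborel v" and G: "integrable lborel G"
    and ts: "0 < t" "t \<le> s" and y: "cball y s \<subseteq> B" and i: "i \<in> Basis"
  shows "correlate (\<lambda>z. v z \<bullet> i) (mollifier s) y - correlate (\<lambda>z. v z \<bullet> i) (mollifier t) y
     = (\<Sum>b\<in>Basis. correlate (\<lambda>z. G z \<bullet> b) (hess_pot t s i b) y)"
proof -
  have s: "0 \<le> s" "0 < s" using ts by auto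
  have int: "integrable lborel (\<lambda>z. (h z \<bullet> j) * K (z - y))" if "integrable lborel h" "ckernel r K"
    for h :: "'a \<Rightarrow> 'a" and j K r
    using that by (intro integrable_mult_ckernel) auto
  have exp_grad: "(\<integral>z. h z \<bullet> grad (\<lambda>z. grad_pot t s i (z - y)) z \<partial>lborel) =
      (\<Sum>b\<in>Basis. correlate (\<lambda>z. h z \<bullet> b) (hess_pot t s i b) y)" if "integrable lborel h" for h
    unfolding correlate_def grad_grad_pot[OF ts(1)]
    by (subst Bochner_Integration.integral_sum[symmetric])
       (auto intro!: int[OF that] ckernel_hess_pot ts s simp: inner_sum_right mult_ac)
  have "correlate (\<lambda>z. v z \<bullet> i) (mollifier s) y - correlate (\<lambda>z. v z \<bullet> i) (mollifier t) y
      = (\<integral>z. (v z \<bullet> i) * (\<Sum>b\<in>Basis. hess_pot t s b b (z - y)) \<partial>lborel)"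
    unfolding correlate_def hess_pot_trace[OF ts]
    by (subst Bochner_Integration.integral_diff[symmetric])
       (auto intro!: int[OF v] ckernel_mollifier ts s simp: algebra_simps)
  also have "\<dots> = (\<Sum>b\<in>Basis. (\<integral>z. (v z \<bullet> i) * hess_pot t s b b (z - y) \<partial>lborel))"
    unfolding sum_distrib_left
    by (intro Bochner_Integration.integral_sum int[OF v, of s] ckernel_hess_pot ts s)
  also have "\<dots> = (\<Sum>b\<in>Basis. (\<integral>z. (v z \<bullet> b) * hess_pot t s i b (z - y) \<partial>lborel))"
  proof (rule sum.cong[OF refl])
    fix b :: 'a assume b: "b \<in> Basis"
    have 1: "grad (\<lambda>z. hess_pot t s b b (z - y)) z \<bullet> i = grad (\<lambda>z. hess_pot t s i b (z - y)) z \<bullet> b" for z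
      using i b by (simp add: grad_hess_pot[OF ts(1)] third_pot_sym(1)[of t s b b i])
    show "(\<integral>z. (v z \<bullet> i) * hess_pot t s b b (z - y) \<partial>lborel) = (\<integral>z. (v z \<bullet> b) * hess_pot t s i b (z - y) \<partial>lborel)"
      using grad_U[OF hess_pot_test[OF ts(1) s(1) y] i, of b b] grad_U[OF hess_pot_test[OF ts(1) s(1) y] b, of i b]
      by (simp add: 1)
  qed
  also have "\<dots> = (\<integral>z. v z \<bullet> grad (\<lambda>z. grad_pot t s i (z - y)) z \<partial>lborel)"
    by (simp add: exp_grad[OF v] correlate_def)
  also have "\<dots> = (\<integral>z. G z \<bullet> grad (\<lambda>z. grad_pot t s i (z - y)) z \<partial>lborel)"
    by (rule div_v[OF grad_pot_test[OF ts(1) s(1) y]])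
  finally show ?thesis by (simp add: exp_grad[OF G])
qed

section \<open>Convolution estimates\<close>

lemma lborel_reflect: "lborel = distr lborel borel (\<lambda>y. z - y :: 'a::euclidean_space)"
proof -
  have "lborel = density (distr lborel borel (\<lambda>y. z + (- 1) *\<^sub>R y :: 'a)) (\<lambda>_. ennreal (\<bar>- 1\<bar> ^ DIM('a)))"
    by (rule lborel_affine) simp
  then show ?thesis by (simp add: density_1)
qed

lemma integral_reflect:
  fixes h :: "'a::euclidean_space \<Rightarrow> real"
  assumes "h \<in> borel_measurable borel"
  shows "(\<integral>y. h (z - y) \<partial>lborel) = (\<integral>y. h y \<partial>lborel)"
  by (subst (2) lborel_reflect[of z]) (use assms in \<open>simp add: integral_distr\<close>)

lemma integrable_reflect:
  fixes h :: "'a::euclidean_space \<Rightarrow> real"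
  assumes "integrable lborel h"
  shows "integrable lborel (\<lambda>y. h (z - y))"
proof -
  have "integrable (distr lborel borel (\<lambda>y. z - y)) h"
    using assms by (simp flip: lborel_reflect)
  moreover have "h \<in> borel_measurable borel" using assms by auto
  ultimately show ?thesis by (simp add: integrable_distr_eq)
qed

text \<open>Correlation with a kernel is adjoint to integration against the same kernel in its other variable.\<close>

lemma Fubini_correlate:
  fixes f K H :: "'a::euclidean_space \<Rightarrow> real"
  assumes f: "integrable lborel f" and K: "ckernel s K"
    and H: "H \<in> borel_measurable borel" "\<And>y. \<bar>H y\<bar> \<le> C"
  shows "integrable lborel (\<lambda>y. correlate f K y * H y)"
    and "(\<integral>y. correlate f K y * H y \<partial>lborel) = (\<integral>z. f z * (\<integral>y. K (z - y) * H y \<partial>lborel) \<partial>lborel)"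
proof -
  have C: "0 \<le> C" using H(2)[of 0] by linarith
  have Ki: "integrable lborel K" by (rule ckernel_integrable[OF K])
  have [measurable]: "f \<in> borel_measurable borel" "K \<in> borel_measurable borel" "H \<in> borel_measurable borel"
    using f ckernel_borel[OF K] H by auto
  have inner: "integrable lborel (\<lambda>y. f z * K (z - y) * H y)" for z
    by (rule integrable_mult_bounded[OF integrable_mult_right[OF integrable_reflect[OF Ki]] H])
  have "integrable (lborel \<Otimes>\<^sub>M lborel) (\<lambda>(z, y). f z * K (z - y) * H y)"
  proof (rule lborel_pair.Fubini_integrable)
    show "(\<lambda>(z, y). f z * K (z - y) * H y) \<in> borel_measurable (lborel \<Otimes>\<^sub>M lborel)"
      by measurable
    have bd: "(\<integral>y. \<bar>f z * K (z - y) * H y\<bar> \<partial>lborel) \<le> \<bar>f z\<bar> * (C * (\<integral>y. \<bar>K y\<bar> \<partial>lborel))" for z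
    proof -
      have "(\<integral>y. \<bar>f z * K (z - y) * H y\<bar> \<partial>lborel) \<le> (\<integral>y. \<bar>f z\<bar> * (C * \<bar>K (z - y)\<bar>) \<partial>lborel)"
      proof (rule integral_mono)
        show "integrable lborel (\<lambda>y. \<bar>f z\<bar> * (C * \<bar>K (z - y)\<bar>))"
          by (rule integrable_mult_right[OF integrable_mult_right[OF integrable_reflect[OF integrable_abs[OF Ki]]]])
        show "\<bar>f z * K (z - y) * H y\<bar> \<le> \<bar>f z\<bar> * (C * \<bar>K (z - y)\<bar>)" for y
          using H(2)[of y] by (simp add: abs_mult mult.assoc mult_left_mono mult_right_mono mult.commute[of "\<bar>K (z - y)\<bar>"])
      qed (use inner in auto)
      also have "\<dots> = \<bar>f z\<bar> * (C * (\<integral>y. \<bar>K (z - y)\<bar> \<partial>lborel))" by simp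
      also have "(\<integral>y. \<bar>K (z - y)\<bar> \<partial>lborel) = (\<integral>y. \<bar>K y\<bar> \<partial>lborel)"
        by (rule integral_reflect) auto
      finally show ?thesis .
    qed
    show "integrable lborel (\<lambda>z. \<integral>y. norm (case (z, y) of (z, y) \<Rightarrow> f z * K (z - y) * H y) \<partial>lborel)"
    proof (rule Bochner_Integration.integrable_bound[of _ "\<lambda>z. \<bar>f z\<bar> * (C * (\<integral>y. \<bar>K y\<bar> \<partial>lborel))"])
      show "AE z in lborel. norm (\<integral>y. norm (case (z, y) of (z, y) \<Rightarrow> f z * K (z - y) * H y) \<partial>lborel)
          \<le> norm (\<bar>f z\<bar> * (C * (\<integral>y. \<bar>K y\<bar> \<partial>lborel)))"
        using bd C by (auto intro!: AE_I2)
    qed (use f in auto)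
    show "AE z in lborel. integrable lborel (\<lambda>y. case (z, y) of (z, y) \<Rightarrow> f z * K (z - y) * H y)"
      using inner by auto
  qed
  then have I: "integrable (lborel \<Otimes>\<^sub>M lborel) (\<lambda>(z, y). f z * K (z - y) * H y)" .
  have eq: "(\<integral>z. f z * K (z - y) * H y \<partial>lborel) = correlate f K y * H y" for y
    by (simp add: correlate_def)
  show "integrable lborel (\<lambda>y. correlate f K y * H y)"
    using lborel_pair.integrable_snd[OF I] by (simp add: correlate_def)
  show "(\<integral>y. correlate f K y * H y \<partial>lborel) = (\<integral>z. f z * (\<integral>y. K (z - y) * H y \<partial>lborel) \<partial>lborel)"
    using lborel_pair.Fubini_integral[OF I] by (simp only: prod.case eq) (simp add: mult.assoc)
qed

lemma correlate_borel [measurable]: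
  assumes "integrable lborel f" "ckernel s K"
  shows "correlate f K \<in> borel_measurable borel"
  using Fubini_correlate(1)[OF assms, of "\<lambda>_. 1" 1] by auto

lemma correlate_integrable:
  assumes "integrable lborel f" "ckernel s K"
  shows "integrable lborel (correlate f K)"
  using Fubini_correlate(1)[OF assms, of "\<lambda>_. 1" 1] by auto

lemma correlate_bounded:
  assumes "integrable lborel f" "ckernel s K"
  obtains C where "\<And>y. \<bar>correlate f K y\<bar> \<le> C"
proof -
  obtain B where B: "\<And>w. \<bar>K w\<bar> \<le> B" using ckernel_bounded[OF assms(2)] by blast
  show ?thesis
  proof (rule that[of "\<integral>z. \<bar>f z\<bar> * B \<partial>lborel"])
    show "\<bar>correlate f K y\<bar> \<le> (\<integral>z. \<bar>f z\<bar> * B \<partial>lborel)" for y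
      unfolding correlate_def
      by (rule integral_abs_bound[THEN order_trans], rule integral_mono)
         (use assms B in \<open>auto simp: abs_mult intro!: mult_left_mono integrable_mult_ckernel[THEN integrable_norm, simplified]\<close>)
  qed
qed

lemma correlate_mult_integrable:
  assumes "integrable lborel f" "ckernel s K" "integrable lborel g" "ckernel r L"
  shows "integrable lborel (\<lambda>y. correlate f K y * correlate g L y)"
proof -
  obtain C where C: "\<And>y. \<bar>correlate g L y\<bar> \<le> C" using correlate_bounded[OF assms(3,4)] by blast
  show ?thesis by (rule Fubini_correlate(1)[OF assms(1,2) _ C]) (use correlate_borel[OF assms(3,4)] in auto)
qed

text \<open>Two applications of Fubini's theorem reduce an inner product of correlations to the overlap integrals of the
  two kernels, so that identities between kernels become identities between operators.\<close>

lemma correlate_inner: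
  assumes "integrable lborel f" "ckernel s K" "integrable lborel g" "ckernel r L"
  shows "(\<integral>y. correlate f K y * correlate g L y \<partial>lborel) =
     (\<integral>z. f z * (\<integral>z'. g z' * (\<integral>y. K (z - y) * L (z' - y) \<partial>lborel) \<partial>lborel) \<partial>lborel)"
proof -
  obtain C where C: "\<And>y. \<bar>correlate g L y\<bar> \<le> C" using correlate_bounded[OF assms(3,4)] by blast
  obtain B where B: "\<And>w. \<bar>K w\<bar> \<le> B" using ckernel_bounded[OF assms(2)] by blast
  have "(\<integral>y. K (z - y) * correlate g L y \<partial>lborel) = (\<integral>z'. g z' * (\<integral>y. K (z - y) * L (z' - y) \<partial>lborel) \<partial>lborel)" for z
    using Fubini_correlate(2)[OF assms(3,4), of "\<lambda>y. K (z - y)" B] B ckernel_borel[OF assms(2)]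
    by (simp add: mult.commute)
  then show ?thesis
    using Fubini_correlate(2)[OF assms(1,2) _ C] correlate_borel[OF assms(3,4)] by simp
qed

text \<open>Cauchy--Schwarz for the weight \<open>K\<close>. It is read off from the nonnegative quadratic polynomial
  \<open>c \<mapsto> \<integral> (f - c)\<^sup>2 K\<close> at its minimum, the weighted mean of \<open>f\<close>.\<close>

lemma correlate_square_le:
  assumes f: "integrable lborel f" "integrable lborel (\<lambda>z. (f z)\<^sup>2)" and K: "ckernel s K" "\<And>w. 0 \<le> K w"
    and M: "(\<integral>w. K w \<partial>lborel) \<le> M"
  shows "(correlate f K y)\<^sup>2 \<le> M * correlate (\<lambda>z. (f z)\<^sup>2) K y"
proof -
  have Ki: "integrable lborel (\<lambda>z. K (z - y))"
  proof -
    have "integrable lborel (\<lambda>z. K (- (y - z)))"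
      by (rule integrable_reflect[where h="\<lambda>w. K (- w)"])
         (use integrable_reflect[OF ckernel_integrable[OF K(1)], of 0] in simp)
    then show ?thesis by simp
  qed
  have Keq: "(\<integral>z. K (z - y) \<partial>lborel) = (\<integral>w. K w \<partial>lborel)"
  proof -
    have "(\<integral>z. K (- (y - z)) \<partial>lborel) = (\<integral>w. K (- w) \<partial>lborel)"
      by (rule integral_reflect[where h="\<lambda>w. K (- w)"]) (use ckernel_borel[OF K(1)] in measurable)
    also have "\<dots> = (\<integral>w. K w \<partial>lborel)"
      using integral_reflect[OF ckernel_borel[OF K(1)], of 0] by simp
    finally show ?thesis by simp
  qed
  \<comment> \<open>\<open>m\<close> may vanish, in which case \<open>K\<close> annihilates \<open>f\<close>; otherwise the quadratic is evaluated at its minimum.\<close>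
  define m where "m = (\<integral>w. K w \<partial>lborel)"
  have m0: "0 \<le> m" unfolding m_def by (intro integral_nonneg_AE) (auto simp: K)
  have q: "0 \<le> correlate (\<lambda>z. (f z)\<^sup>2) K y" unfolding correlate_def by (intro integral_nonneg_AE) (auto simp: K)
  have if1: "integrable lborel (\<lambda>z. f z * K (z - y))" and if2: "integrable lborel (\<lambda>z. (f z)\<^sup>2 * K (z - y))"
    by (rule integrable_mult_ckernel[OF _ K(1)] f)+
  have quad: "0 \<le> correlate (\<lambda>z. (f z)\<^sup>2) K y - 2 * c * correlate f K y + c\<^sup>2 * m" for c
  proof -
    have "0 \<le> (\<integral>z. (f z - c)\<^sup>2 * K (z - y) \<partial>lborel)"
      by (intro integral_nonneg_AE) (auto simp: K)
    also have "\<dots> = (\<integral>z. (f z)\<^sup>2 * K (z - y) - 2 * c * (f z * K (z - y)) + c\<^sup>2 * K (z - y) \<partial>lborel)"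
      by (intro Bochner_Integration.integral_cong) (auto simp: power2_eq_square algebra_simps)
    also have "\<dots> = correlate (\<lambda>z. (f z)\<^sup>2) K y - 2 * c * correlate f K y + c\<^sup>2 * m"
      unfolding correlate_def m_def Keq[symmetric] using if1 if2 Ki by simp
    finally show ?thesis .
  qed
  have "(correlate f K y)\<^sup>2 \<le> m * correlate (\<lambda>z. (f z)\<^sup>2) K y"
  proof (cases "m = 0")
    case True
    have "correlate f K y = 0"
    proof (rule ccontr)
      assume a: "correlate f K y \<noteq> 0"
      show False
        using quad[of "(correlate (\<lambda>z. (f z)\<^sup>2) K y + 1) / (2 * correlate f K y)"] True a q by (simp add: field_simps)
    qed
    then show ?thesis using True by simp
  next
    case False
    then have "0 < m" using m0 by simp
    have "0 \<le> m * (correlate (\<lambda>z. (f z)\<^sup>2) K y - 2 * (correlate f K y / m) * correlate f K y + (correlate f K y / m)\<^sup>2 * m)"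
      using quad[of "correlate f K y / m"] \<open>0 < m\<close> by (intro mult_nonneg_nonneg) auto
    also have "\<dots> = m * correlate (\<lambda>z. (f z)\<^sup>2) K y - (correlate f K y)\<^sup>2"
      using \<open>0 < m\<close> by (simp add: field_simps power2_eq_square)
    finally show ?thesis by simp
  qed
  also have "\<dots> \<le> M * correlate (\<lambda>z. (f z)\<^sup>2) K y"
    using M q by (simp add: m_def mult_right_mono)
  finally show ?thesis .
qed

lemma integral_correlate:
  assumes f: "integrable lborel f" and K: "ckernel s K"
  shows "(\<integral>y. correlate f K y \<partial>lborel) = (\<integral>w. K w \<partial>lborel) * (\<integral>z. f z \<partial>lborel)"
  using Fubini_correlate(2)[OF f K, of "\<lambda>_. 1" 1] integral_reflect[OF ckernel_borel[OF K]] by simp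

text \<open>Young's inequality for the convolution of a square integrable function with an integrable kernel.\<close>

lemma correlate_L2_bound:
  assumes f: "integrable lborel f" "integrable lborel (\<lambda>z. (f z)\<^sup>2)" and K: "ckernel s K" "\<And>w. 0 \<le> K w"
    and M: "(\<integral>w. K w \<partial>lborel) \<le> M"
  shows "(\<integral>y. (correlate f K y)\<^sup>2 \<partial>lborel) \<le> M\<^sup>2 * (\<integral>z. (f z)\<^sup>2 \<partial>lborel)"
proof -
  have M0: "0 \<le> M" using M order_trans[OF integral_nonneg_AE[of K lborel] M] K(2) by simp
  have "(\<integral>y. (correlate f K y)\<^sup>2 \<partial>lborel) \<le> (\<integral>y. M * correlate (\<lambda>z. (f z)\<^sup>2) K y \<partial>lborel)"
    using correlate_square_le[OF f K M] correlate_integrable[OF f(2) K(1)] correlate_mult_integrable[OF f(1) K(1) f(1) K(1)]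
    by (intro integral_mono) (auto simp: power2_eq_square)
  also have "\<dots> = M * ((\<integral>w. K w \<partial>lborel) * (\<integral>z. (f z)\<^sup>2 \<partial>lborel))"
    by (simp add: integral_correlate[OF f(2) K(1)])
  also have "\<dots> \<le> M * (M * (\<integral>z. (f z)\<^sup>2 \<partial>lborel))"
    using M M0 by (intro mult_left_mono mult_right_mono) auto
  finally show ?thesis by (simp add: power2_eq_square)
qed

section \<open>Integration by parts\<close>

text \<open>The integral of \<open>f\<close> is invariant under translations, so the difference quotients of \<open>f\<close> in direction
  \<open>c\<close> integrate to zero; by dominated convergence so does their limit.\<close>

lemma integral_deriv_zero:
  fixes f :: "'a::euclidean_space \<Rightarrow> real"
  assumes f: "ckernel s f" and d: "\<And>x. ((\<lambda>h. f (x + h *\<^sub>R c)) has_real_derivative f' x) (at 0)"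
    and f': "ckernel s f'"
  shows "(\<integral>x. f' x \<partial>lborel) = 0"
proof -
  obtain B where B: "\<And>x. \<bar>f' x\<bar> \<le> B" using ckernel_bounded[OF f'] by blast
  have dd: "((\<lambda>h. f (x + h *\<^sub>R c)) has_real_derivative f' (x + h *\<^sub>R c)) (at h)" for x h
  proof -
    have "((\<lambda>k. f ((x + h *\<^sub>R c) + (k - h) *\<^sub>R c)) has_real_derivative f' (x + h *\<^sub>R c) * 1) (at h)"
      by (rule DERIV_chain2[where f="\<lambda>k. f ((x + h *\<^sub>R c) + k *\<^sub>R c)" and g="\<lambda>k. k - h"])
         (use d[of "x + h *\<^sub>R c"] in \<open>auto intro!: derivative_eq_intros\<close>)
    then show ?thesis by (simp add: algebra_simps)
  qed
  have lip: "\<bar>f (x + h *\<^sub>R c) - f x\<bar> \<le> B * h" if "h > 0" for x h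
  proof -
    have "\<exists>z>0. z < h \<and> f (x + h *\<^sub>R c) - f (x + 0 *\<^sub>R c) = (h - 0) * f' (x + z *\<^sub>R c)"
      by (rule MVT2[OF that]) (rule dd)
    then obtain z where "f (x + h *\<^sub>R c) - f x = h * f' (x + z *\<^sub>R c)" by auto
    then show ?thesis using B[of "x + z *\<^sub>R c"] that by (simp add: abs_mult mult.commute[of B] mult_left_mono)
  qed
  have trans: "(\<integral>x. f (x + v) \<partial>lborel) = (\<integral>x. f x \<partial>lborel)" for v
  proof -
    have "(\<integral>x. f (- (- v - x)) \<partial>lborel) = (\<integral>w. f (- w) \<partial>lborel)"
      by (rule integral_reflect[where h="\<lambda>w. f (- w)"]) (use ckernel_borel[OF f] in measurable)
    also have "\<dots> = (\<integral>w. f w \<partial>lborel)"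
      using integral_reflect[OF ckernel_borel[OF f], of 0] by simp
    finally show ?thesis by (simp add: add.commute)
  qed
  have itrans: "integrable lborel (\<lambda>x. f (x + v))" for v
  proof -
    have "integrable lborel (\<lambda>x. f (- (- v - x)))"
      by (rule integrable_reflect[where h="\<lambda>w. f (- w)"])
         (use integrable_reflect[OF ckernel_integrable[OF f], of 0] in simp)
    then show ?thesis by (simp add: add.commute)
  qed
  define h :: "nat \<Rightarrow> real" where "h n = 1 / (real n + 1)" for n
  have h: "0 < h n" "h n \<le> 1" for n by (auto simp: h_def)
  have h0: "h \<longlonglongrightarrow> 0" unfolding h_def using LIMSEQ_inverse_real_of_nat by (simp add: inverse_eq_divide add.commute)
  define u where "u n x = (f (x + h n *\<^sub>R c) - f x) / h n" for n x
  have "(\<lambda>n. \<integral>x. u n x \<partial>lborel) \<longlonglongrightarrow> (\<integral>x. f' x \<partial>lborel)"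
  proof (rule integral_dominated_convergence[where w="\<lambda>x. B * indicator (cball 0 (s + norm c)) x"])
    show "f' \<in> borel_measurable lborel" using ckernel_borel[OF f'] by simp
    show "u n \<in> borel_measurable lborel" for n
      unfolding u_def using ckernel_borel[OF f] by measurable
    show "integrable lborel (\<lambda>x::'a. B * indicator (cball 0 (s + norm c)) x)"
      using emeasure_lborel_cball_finite[of "0::'a" "s + norm c"]
      by (intro integrable_mult_right) (auto intro!: integrable_real_indicator simp: top.not_eq_extremum)
    show "AE x in lborel. norm (u n x) \<le> B * indicator (cball 0 (s + norm c)) x" for n
    proof (rule AE_I2)
      fix x
      show "norm (u n x) \<le> B * indicator (cball 0 (s + norm c)) x"
      proof (cases "norm x \<le> s + norm c")
        case True
        then show ?thesis using lip[OF h(1)[of n], of x] h(1)[of n] by (simp add: u_def field_simps)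
      next
        case False
        then have "norm x > s" using norm_ge_zero[of c] by linarith
        have "norm (h n *\<^sub>R c) \<le> norm c" using h[of n] by (simp add: mult_left_le_one_le)
        then have "norm (x + h n *\<^sub>R c) \<ge> s"
          using False norm_diff_ineq[of x "h n *\<^sub>R c"] by linarith
        then show ?thesis using False \<open>norm x > s\<close> f by (simp add: u_def ckernel_def)
      qed
    qed
    show "AE x in lborel. (\<lambda>n. u n x) \<longlonglongrightarrow> f' x"
    proof (rule AE_I2)
      fix x
      have "((\<lambda>h. (f (x + h *\<^sub>R c) - f x) / h) \<longlongrightarrow> f' x) (at 0)"
        using d[of x] by (simp add: has_field_derivative_iff)
      then show "(\<lambda>n. u n x) \<longlonglongrightarrow> f' x"
        unfolding u_def
        by (rule filterlim_compose) (use h h0 in \<open>auto simp: filterlim_at intro!: always_eventually less_imp_neq[symmetric]\<close>)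
    qed
  qed
  moreover have "(\<integral>x. u n x \<partial>lborel) = 0" for n
    using itrans[of "h n *\<^sub>R c"] ckernel_integrable[OF f] trans[of "h n *\<^sub>R c"] by (simp add: u_def)
  ultimately show ?thesis by (simp add: LIMSEQ_unique)
qed

section \<open>The energy estimate for the second derivatives of the potential\<close>

text \<open>One integration by parts in direction \<open>c\<close> moves a derivative between the two factors. The third derivative
  on the right is symmetric in all its indices, so this side does not see which of \<open>a\<close>, \<open>b\<close>, \<open>c\<close> was
  moved.\<close>

lemma hess_pot_by_parts:
  fixes z z' :: "'a::euclidean_space"
  assumes "0 < t" "t \<le> s"
  shows "(\<integral>y. hess_pot t s a b (z - y) * hess_pot t s i c (z' - y) \<partial>lborel) =
     - (\<integral>y. third_pot t s a b c (z - y) * grad_pot t s i (z' - y) \<partial>lborel)"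
proof -
  have s: "0 \<le> s" using assms by simp
  \<comment> \<open>In the variable \<open>w = z - y\<close> the two kernels differ by the fixed shift \<open>\<delta>\<close>.\<close>
  define \<delta> where "\<delta> = z' - z"
  have cont: "continuous_on UNIV (\<lambda>w. hess_pot t s i c (w + \<delta>))" "continuous_on UNIV (\<lambda>w. grad_pot t s i (w + \<delta>))"
    using ckernel_hess_pot[OF assms(1) s, of i c] ckernel_grad_pot[OF assms(1) s, of i]
    by (auto simp: ckernel_def intro!: continuous_intros intro: continuous_on_compose2)
  have ck: "ckernel s (\<lambda>w. hess_pot t s a b w * hess_pot t s i c (w + \<delta>))"
      "ckernel s (\<lambda>w. third_pot t s a b c w * grad_pot t s i (w + \<delta>))"
      "ckernel s (\<lambda>w. hess_pot t s a b w * grad_pot t s i (w + \<delta>))"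
    by (intro ckernel_mult ckernel_hess_pot ckernel_third_pot cont assms s)+
  have "(\<integral>w. third_pot t s a b c w * grad_pot t s i (w + \<delta>) + hess_pot t s a b w * hess_pot t s i c (w + \<delta>) \<partial>lborel) = 0"
  proof (rule integral_deriv_zero[OF ck(3)])
    show "ckernel s (\<lambda>w. third_pot t s a b c w * grad_pot t s i (w + \<delta>) + hess_pot t s a b w * hess_pot t s i c (w + \<delta>))"
      using ck by (auto simp: ckernel_def intro!: continuous_intros)
    fix x
    have 1: "((\<lambda>h. hess_pot t s a b (x + h *\<^sub>R c)) has_derivative (\<lambda>k. third_pot t s a b (k *\<^sub>R c) x)) (at 0)"
      by (rule has_derivative_compose[of _ "\<lambda>k. k *\<^sub>R c" _ _ "hess_pot t s a b"])
         (use hess_pot_deriv[OF assms(1), of s a b x] in \<open>auto intro!: derivative_eq_intros\<close>)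
    have 2: "((\<lambda>h. grad_pot t s i (x + h *\<^sub>R c + \<delta>)) has_derivative (\<lambda>k. hess_pot t s i (k *\<^sub>R c) (x + \<delta>))) (at 0)"
      by (rule has_derivative_compose[of _ "\<lambda>k. k *\<^sub>R c" _ _ "grad_pot t s i"])
         (use grad_pot_deriv[OF assms(1), of s i "x + \<delta>"] in \<open>auto intro!: derivative_eq_intros\<close>)
    show "((\<lambda>h. hess_pot t s a b (x + h *\<^sub>R c) * grad_pot t s i (x + h *\<^sub>R c + \<delta>)) has_real_derivative
         third_pot t s a b c x * grad_pot t s i (x + \<delta>) + hess_pot t s a b x * hess_pot t s i c (x + \<delta>)) (at 0)"
      unfolding has_field_derivative_def
      by (rule has_derivative_eq_rhs[OF has_derivative_mult[OF 1 2]])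
         (simp add: fun_eq_iff third_pot_def hess_pot_def algebra_simps)
  qed
  then have "(\<integral>w. hess_pot t s a b w * hess_pot t s i c (w + \<delta>) \<partial>lborel) =
     - (\<integral>w. third_pot t s a b c w * grad_pot t s i (w + \<delta>) \<partial>lborel)"
    using ckernel_integrable[OF ck(1)] ckernel_integrable[OF ck(2)] by simp
  moreover have "(\<integral>y. hess_pot t s a b (z - y) * hess_pot t s i c (z' - y) \<partial>lborel) =
      (\<integral>w. hess_pot t s a b w * hess_pot t s i c (w + \<delta>) \<partial>lborel)"
    using integral_reflect[OF ckernel_borel[OF ck(1)], of z] by (simp add: \<delta>_def)
  moreover have "(\<integral>y. third_pot t s a b c (z - y) * grad_pot t s i (z' - y) \<partial>lborel) =
      (\<integral>w. third_pot t s a b c w * grad_pot t s i (w + \<delta>) \<partial>lborel)"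
    using integral_reflect[OF ckernel_borel[OF ck(2)], of z] by (simp add: \<delta>_def)
  ultimately show ?thesis by simp
qed

text \<open>Exchanging derivatives between the factors collects the repeated index \<open>i\<close> in the second
  one, where the sum over \<open>i\<close> becomes a Laplacian.\<close>

lemma hess_pot_swap:
  assumes "0 < t" "t \<le> s"
  shows "(\<integral>y. hess_pot t s i b (z - y) * hess_pot t s i c (z' - y) \<partial>lborel) =
     (\<integral>y. hess_pot t s b c (z - y) * hess_pot t s i i (z' - y) \<partial>lborel)"
proof -
  have "third_pot t s i b c = third_pot t s b c i" by (rule ext) (metis third_pot_sym)
  then show ?thesis by (simp add: hess_pot_by_parts[OF assms])
qed

lemma mollifier_nonneg: "0 < s \<Longrightarrow> 0 \<le> mollifier s w"
  by (simp add: mollifier_def cutoff0_nonneg)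

lemma mollifier_le: "0 < s \<Longrightarrow> mollifier s (w::'a::euclidean_space) \<le> inverse s ^ DIM('a)"
  using mult_left_mono[OF cutoff0_le_1, of "inverse s ^ DIM('a)"] by (simp add: mollifier_def)

definition mass :: "'a::euclidean_space itself \<Rightarrow> real" where
  "mass _ = (\<integral>w. mollifier 1 (w::'a) \<partial>lborel)"

lemma mollifier_mass:
  assumes "0 < s"
  shows "(\<integral>w. mollifier s (w::'a::euclidean_space) \<partial>lborel) = mass TYPE('a)"
proof -
  have [measurable]: "mollifier s \<in> borel_measurable (borel :: 'a measure)"
    by (rule ckernel_borel[OF ckernel_mollifier[OF assms]])
  have eq: "s ^ DIM('a) * mollifier s (s *\<^sub>R x) = mollifier 1 x" for x :: 'a
    using assms by (simp add: mollifier_def power_inverse power2_eq_square field_simps)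
  have "lborel = density (distr lborel borel (\<lambda>x. 0 + s *\<^sub>R x :: 'a)) (\<lambda>_. ennreal (\<bar>s\<bar> ^ DIM('a)))"
    by (rule lborel_affine) (use assms in simp)
  then have "(\<integral>w. mollifier s (w::'a) \<partial>lborel) =
      (\<integral>w. mollifier s w \<partial>density (distr lborel borel (\<lambda>x. 0 + s *\<^sub>R x :: 'a)) (\<lambda>_. ennreal (\<bar>s\<bar> ^ DIM('a))))"
    by simp
  also have "\<dots> = (\<integral>x. s ^ DIM('a) * mollifier s (s *\<^sub>R x :: 'a) \<partial>lborel)"
    using assms by (simp add: integral_density integral_distr)
  also have "\<dots> = mass TYPE('a)" by (simp only: eq mass_def)
  finally show ?thesis .
qed

lemma mass_pos: "0 < mass TYPE('a::euclidean_space)"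
proof -
  have i: "integrable lborel (mollifier 1 :: 'a \<Rightarrow> real)"
    by (rule ckernel_integrable[OF ckernel_mollifier]) simp
  have "0 \<le> mass TYPE('a)" unfolding mass_def by (intro integral_nonneg_AE) (simp add: mollifier_nonneg)
  moreover have "mass TYPE('a) \<noteq> 0"
  proof
    assume "mass TYPE('a) = 0"
    then have "AE w in lborel. mollifier 1 (w::'a) = 0"
      unfolding mass_def using integral_nonneg_eq_0_iff_AE[OF i] by (simp add: mollifier_nonneg)
    then have "AE w in lborel. w \<notin> ball (0::'a) 1"
    proof eventually_elim
      case (elim w)
      show ?case
      proof
        assume "w \<in> ball 0 1"
        then have "w \<bullet> w < 1" by (simp flip: power2_norm_eq_inner add: abs_square_less_1)
        then show False using elim cutoff0_pos[of "w \<bullet> w"] by (simp add: mollifier_def)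
      qed
    qed
    then have "emeasure lborel (ball (0::'a) 1) = 0"
      by (subst (asm) AE_iff_measurable[of "ball 0 1"]) auto
    then show False
      using negligible_iff_null_sets[of "ball (0::'a) 1"] open_not_negligible[of "ball (0::'a) 1"]
      by (auto simp: null_sets_def)
  qed
  ultimately show ?thesis by simp
qed

text \<open>\<open>W\<close> is the field \<open>D\<^sup>2\<psi> * G\<close> for \<open>G\<close> with components \<open>g\<close>. By \<open>hess_pot_swap\<close> its squared norm is its
  inner product with \<open>H = \<Delta>\<psi> * G = \<eta>\<^sub>s * G - \<eta>\<^sub>t * G\<close>, so \<open>\<parallel>W\<parallel> \<le> \<parallel>H\<parallel>\<close>, and
  Young's inequality bounds \<open>\<parallel>H\<parallel>\<close> by twice the mass of the mollifier times \<open>\<parallel>G\<parallel>\<close>. Estimating the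
  kernel \<open>D\<^sup>2\<psi>\<close> by its mass would not do: in dimension at least two this mass grows like
  \<open>ln (s / t)\<close> as \<open>t\<close> tends to \<open>0\<close>.\<close>

lemma energy_estimate:
  fixes g :: "'a::euclidean_space \<Rightarrow> 'a \<Rightarrow> real"
  assumes g: "\<And>b. integrable lborel (g b)" "\<And>b. integrable lborel (\<lambda>z. (g b z)\<^sup>2)"
    and ts: "0 < t" "t \<le> s"
  defines "W \<equiv> \<lambda>i y. \<Sum>b\<in>Basis. correlate (g b) (hess_pot t s i b) y"
  shows "integrable lborel (\<lambda>y. \<Sum>i\<in>Basis. (W i y)\<^sup>2)"
    and "(\<integral>y. (\<Sum>i\<in>Basis. (W i y)\<^sup>2) \<partial>lborel) \<le> 4 * (mass TYPE('a))\<^sup>2 * (\<Sum>c\<in>Basis. \<integral>z. (g c z)\<^sup>2 \<partial>lborel)"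
proof -
  let ?B = "Basis :: 'a set" and ?m = "mass TYPE('a)"
  have s: "0 \<le> s" "0 < s" using ts by auto
  define H where "H c y = correlate (g c) (mollifier s) y - correlate (g c) (mollifier t) y" for c y
  have km: "ckernel s (hess_pot t s i b)" for i b :: 'a by (rule ckernel_hess_pot[OF ts(1) s(1)])
  have prod: "integrable lborel (\<lambda>y. correlate (g b) (hess_pot t s i c) y * correlate (g b') (hess_pot t s i' c') y)" for b c i b' c' i'
    by (rule correlate_mult_integrable[OF g(1) km g(1) km])
  have intW: "integrable lborel (\<lambda>y. (W i y)\<^sup>2)" for i
    unfolding W_def power2_eq_square sum_product by (intro Bochner_Integration.integrable_sum prod)
  then show intW': "integrable lborel (\<lambda>y. \<Sum>i\<in>?B. (W i y)\<^sup>2)" by auto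
  have H_eq: "H c y = (\<Sum>i\<in>?B. correlate (g c) (hess_pot t s i i) y)" for c y
  proof -
    have "H c y = (\<integral>z. g c z * (\<Sum>i\<in>?B. hess_pot t s i i (z - y)) \<partial>lborel)"
      unfolding H_def correlate_def hess_pot_trace[OF ts]
      by (subst Bochner_Integration.integral_diff[symmetric])
         (auto intro!: integrable_mult_ckernel[OF g(1)] ckernel_mollifier ts s simp: algebra_simps)
    also have "\<dots> = (\<Sum>i\<in>?B. correlate (g c) (hess_pot t s i i) y)"
      unfolding sum_distrib_left correlate_def
      by (intro Bochner_Integration.integral_sum integrable_mult_ckernel[OF g(1) km])
    finally show ?thesis .
  qed
  have swap: "(\<integral>y. correlate (g b) (hess_pot t s i b) y * correlate (g c) (hess_pot t s i c) y \<partial>lborel) =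
     (\<integral>y. correlate (g b) (hess_pot t s c b) y * correlate (g c) (hess_pot t s i i) y \<partial>lborel)" for b c i
    by (simp add: correlate_inner[OF g(1) km g(1) km] hess_pot_swap[OF ts] hess_pot_sym[of t s c b])
  have "(\<integral>y. (\<Sum>i\<in>?B. (W i y)\<^sup>2) \<partial>lborel) =
      (\<Sum>i\<in>?B. \<Sum>b\<in>?B. \<Sum>c\<in>?B. \<integral>y. correlate (g b) (hess_pot t s i b) y * correlate (g c) (hess_pot t s i c) y \<partial>lborel)"
    unfolding W_def power2_eq_square sum_product by (simp add: prod Bochner_Integration.integral_sum)
  also have "\<dots> = (\<Sum>i\<in>?B. \<Sum>b\<in>?B. \<Sum>c\<in>?B. \<integral>y. correlate (g b) (hess_pot t s c b) y * correlate (g c) (hess_pot t s i i) y \<partial>lborel)"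
    by (intro sum.cong refl swap)
  also have "\<dots> = (\<Sum>c\<in>?B. \<Sum>b\<in>?B. \<Sum>i\<in>?B. \<integral>y. correlate (g b) (hess_pot t s c b) y * correlate (g c) (hess_pot t s i i) y \<partial>lborel)"
    by (subst sum.swap, subst (2) sum.swap, subst sum.swap) (rule refl)
  also have "\<dots> = (\<Sum>c\<in>?B. \<integral>y. W c y * H c y \<partial>lborel)"
    unfolding W_def H_eq sum_product by (simp add: prod Bochner_Integration.integral_sum)
  finally have eq: "(\<integral>y. (\<Sum>i\<in>?B. (W i y)\<^sup>2) \<partial>lborel) = (\<Sum>c\<in>?B. \<integral>y. W c y * H c y \<partial>lborel)" .
  have intWH: "integrable lborel (\<lambda>y. W c y * H c y)" for c
    unfolding W_def H_eq sum_product by (intro Bochner_Integration.integrable_sum prod)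
  have intH: "integrable lborel (\<lambda>y. (H c y)\<^sup>2)" for c
    unfolding H_eq power2_eq_square sum_product by (intro Bochner_Integration.integrable_sum prod)
  \<comment> \<open>The elementary inequality \<open>2xy \<le> x\<^sup>2 + y\<^sup>2\<close> lets half of \<open>\<parallel>W\<parallel>\<^sup>2\<close> be absorbed into the left-hand side.\<close>
  have WH: "(\<integral>y. W c y * H c y \<partial>lborel) \<le> (\<integral>y. (W c y)\<^sup>2 \<partial>lborel) / 2 + (\<integral>y. (H c y)\<^sup>2 \<partial>lborel) / 2" for c
  proof -
    have "(\<integral>y. W c y * H c y \<partial>lborel) \<le> (\<integral>y. (W c y)\<^sup>2 / 2 + (H c y)\<^sup>2 / 2 \<partial>lborel)"
    proof (rule integral_mono[OF intWH])
      show "integrable lborel (\<lambda>y. (W c y)\<^sup>2 / 2 + (H c y)\<^sup>2 / 2)" using intW intH by auto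
      show "W c y * H c y \<le> (W c y)\<^sup>2 / 2 + (H c y)\<^sup>2 / 2" for y
        using sum_squares_bound[of "W c y" "H c y"] by simp
    qed
    also have "\<dots> = (\<integral>y. (W c y)\<^sup>2 \<partial>lborel) / 2 + (\<integral>y. (H c y)\<^sup>2 \<partial>lborel) / 2"
      using intW[of c] intH[of c] by simp
    finally show ?thesis .
  qed
  have "(\<integral>y. (\<Sum>i\<in>?B. (W i y)\<^sup>2) \<partial>lborel) \<le>
      (\<Sum>c\<in>?B. (\<integral>y. (W c y)\<^sup>2 \<partial>lborel) / 2 + (\<integral>y. (H c y)\<^sup>2 \<partial>lborel) / 2)"
    unfolding eq by (intro sum_mono WH)
  also have "\<dots> = (\<integral>y. (\<Sum>i\<in>?B. (W i y)\<^sup>2) \<partial>lborel) / 2 + (\<Sum>c\<in>?B. \<integral>y. (H c y)\<^sup>2 \<partial>lborel) / 2"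
    using intW by (simp add: sum.distrib sum_divide_distrib)
  finally have "(\<integral>y. (\<Sum>i\<in>?B. (W i y)\<^sup>2) \<partial>lborel) \<le> (\<Sum>c\<in>?B. \<integral>y. (H c y)\<^sup>2 \<partial>lborel)" by simp
  also have "\<dots> \<le> (\<Sum>c\<in>?B. 4 * ?m\<^sup>2 * (\<integral>z. (g c z)\<^sup>2 \<partial>lborel))"
  proof (rule sum_mono)
    fix c
    have m: "(\<integral>y. (correlate (g c) (mollifier r) y)\<^sup>2 \<partial>lborel) \<le> ?m\<^sup>2 * (\<integral>z. (g c z)\<^sup>2 \<partial>lborel)" 
      "integrable lborel (\<lambda>y. (correlate (g c) (mollifier r) y)\<^sup>2)" if "0 < r" for r
      using correlate_L2_bound[OF g ckernel_mollifier[OF that], of ?m] that mollifier_nonneg mollifier_mass[OF that, where 'a='a]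
        correlate_mult_integrable[OF g(1) ckernel_mollifier[OF that] g(1) ckernel_mollifier[OF that], of c c]
      by (auto simp: power2_eq_square)
    have "(\<integral>y. (H c y)\<^sup>2 \<partial>lborel) \<le>
       (\<integral>y. 2 * (correlate (g c) (mollifier s) y)\<^sup>2 + 2 * (correlate (g c) (mollifier t) y)\<^sup>2 \<partial>lborel)"
    proof (rule integral_mono[OF intH])
      show "(H c y)\<^sup>2 \<le> 2 * (correlate (g c) (mollifier s) y)\<^sup>2 + 2 * (correlate (g c) (mollifier t) y)\<^sup>2" for y
        using zero_le_power2[of "correlate (g c) (mollifier s) y + correlate (g c) (mollifier t) y"]
        unfolding H_def by (simp add: power2_eq_square algebra_simps)
    qed (use m(2)[OF s(2)] m(2)[OF ts(1)] in auto)
    also have "\<dots> \<le> 4 * ?m\<^sup>2 * (\<integral>z. (g c z)\<^sup>2 \<partial>lborel)"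
      using m[OF s(2)] m[OF ts(1)] by simp
    finally show "(\<integral>y. (H c y)\<^sup>2 \<partial>lborel) \<le> 4 * ?m\<^sup>2 * (\<integral>z. (g c z)\<^sup>2 \<partial>lborel)" .
  qed
  finally show "(\<integral>y. (\<Sum>i\<in>?B. (W i y)\<^sup>2) \<partial>lborel) \<le> 4 * ?m\<^sup>2 * (\<Sum>c\<in>?B. \<integral>z. (g c z)\<^sup>2 \<partial>lborel)"
    by (simp add: sum_distrib_left)
qed

section \<open>Convergence of mollifications in the mean\<close>

text \<open>\<open>f\<close> is truncated in value and support to \<open>fk k\<close>. Continuous functions that converge to \<open>fk k\<close> almost
  everywhere, clamped to the same range and cut off, converge in the mean by dominated
  convergence.\<close>

lemma integrable_approx_ckernel:
  fixes f :: "'a::euclidean_space \<Rightarrow> real"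
  assumes f: "integrable lborel f" and e: "0 < e"
  obtains w r where "ckernel r w" "(\<integral>x. \<bar>f x - w x\<bar> \<partial>lborel) < e"
proof -
  have [measurable]: "f \<in> borel_measurable borel" using f by auto
  define fk where "fk k x = (if \<bar>f x\<bar> \<le> real k \<and> norm x \<le> real k then f x else 0)" for k x
  have [measurable]: "fk k \<in> borel_measurable borel" for k unfolding fk_def by measurable
  have "(\<lambda>k. \<integral>x. \<bar>f x - fk k x\<bar> \<partial>lborel) \<longlonglongrightarrow> (\<integral>x. 0 \<partial>(lborel :: 'a measure))"
  proof (rule integral_dominated_convergence[where w="\<lambda>x. \<bar>f x\<bar>"])
    show "AE x in lborel. (\<lambda>k. \<bar>f x - fk k x\<bar>) \<longlonglongrightarrow> 0"
    proof (rule AE_I2)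
      fix x
      obtain k0 :: nat where k0: "\<bar>f x\<bar> + norm x \<le> real k0" using real_arch_simple by blast
      have "\<bar>f x - fk k x\<bar> = 0" if "k \<ge> k0" for k
      proof -
        have "real k0 \<le> real k" using that by simp
        then have "\<bar>f x\<bar> \<le> real k" "norm x \<le> real k" using k0 norm_ge_zero[of x] abs_ge_zero[of "f x"] by linarith+
        then show ?thesis by (simp add: fk_def)
      qed
      then show "(\<lambda>k. \<bar>f x - fk k x\<bar>) \<longlonglongrightarrow> 0"
        by (intro tendsto_eventually) (auto simp: eventually_sequentially)
    qed
  qed (use f in \<open>auto simp: fk_def\<close>)
  then have "eventually (\<lambda>k. (\<integral>x. \<bar>f x - fk k x\<bar> \<partial>lborel) < e / 2) sequentially"
    using e by (intro order_tendstoD(2)) auto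
  then obtain k where k: "(\<integral>x. \<bar>f x - fk k x\<bar> \<partial>lborel) < e / 2"
    by (auto simp: eventually_sequentially)
  have fk: "integrable lborel (fk k)"
    by (rule Bochner_Integration.integrable_bound[OF f]) (auto simp: fk_def)
  have "fk k measurable_on UNIV"
    by (rule lebesgue_measurable_imp_measurable_on) (auto intro: measurable_completion simp: lebesgue_on_UNIV_eq)
  then obtain N h where N: "negligible N" and h: "\<And>n. continuous_on UNIV (h n)"
      "\<And>x. x \<notin> N \<Longrightarrow> (\<lambda>n. h n x) \<longlonglongrightarrow> fk k x"
    by (auto simp: measurable_on_def)
  define cut where "cut x = max 0 (min 1 (real k + 1 - norm x))" for x :: 'a
  define w where "w n x = max (- real k) (min (real k) (h n x)) * cut x" for n x
  have wk: "ckernel (real k + 1) (w n)" for n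
    unfolding ckernel_def w_def cut_def by (auto intro!: continuous_intros h)
  have wlim: "(\<lambda>n. w n x) \<longlonglongrightarrow> fk k x" if "x \<notin> N" for x
  proof -
    have "(\<lambda>n. w n x) \<longlonglongrightarrow> max (- real k) (min (real k) (fk k x)) * cut x"
      unfolding w_def by (intro tendsto_intros h that)
    moreover have "max (- real k) (min (real k) (fk k x)) * cut x = fk k x"
      by (auto simp: fk_def cut_def)
    ultimately show ?thesis by simp
  qed
  have wb: "\<bar>w n x\<bar> \<le> real k * indicator (cball 0 (real k + 1)) x" for n x
  proof (cases "norm x \<le> real k + 1")
    case True
    have "\<bar>w n x\<bar> = \<bar>max (- real k) (min (real k) (h n x))\<bar> * \<bar>cut x\<bar>" by (simp add: w_def abs_mult)
    also have "\<dots> \<le> real k * 1" by (intro mult_mono) (auto simp: cut_def)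
    finally show ?thesis using True by simp
  qed (simp add: w_def cut_def)
  have ball: "integrable lborel (\<lambda>x::'a. real k * indicator (cball 0 (real k + 1)) x)"
    using emeasure_lborel_cball_finite[of "0::'a" "real k + 1"]
    by (intro integrable_mult_right) (auto intro!: integrable_real_indicator simp: top.not_eq_extremum)
  have "(\<lambda>n. \<integral>x. \<bar>fk k x - w n x\<bar> \<partial>lborel) \<longlonglongrightarrow> (\<integral>x. 0 \<partial>(lborel :: 'a measure))"
  proof (rule integral_dominated_convergence[where w="\<lambda>x. \<bar>fk k x\<bar> + real k * indicator (cball 0 (real k + 1)) x"])
    show "integrable lborel (\<lambda>x. \<bar>fk k x\<bar> + real k * indicator (cball 0 (real k + 1)) x)"
      using fk ball by auto
    have "AE x in lebesgue. x \<notin> N"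
      using N AE_not_in negligible_iff_null_sets by blast
    then have "AE x in lborel. x \<notin> N" by (simp add: AE_completion_iff)
    then show "AE x in lborel. (\<lambda>n. \<bar>fk k x - w n x\<bar>) \<longlonglongrightarrow> 0"
    proof eventually_elim
      case (elim x)
      show ?case using tendsto_rabs[OF tendsto_diff[OF tendsto_const[of "fk k x"] wlim[OF elim]]] by simp
    qed
    show "AE x in lborel. norm \<bar>fk k x - w n x\<bar> \<le> \<bar>fk k x\<bar> + real k * indicator (cball 0 (real k + 1)) x" for n
      using wb[of n] by (intro AE_I2) (simp add: order_trans[OF abs_triangle_ineq4])
    show "(\<lambda>x. \<bar>fk k x - w n x\<bar>) \<in> borel_measurable lborel" for n
      using ckernel_borel[OF wk[of n]] by measurable
  qed auto
  then have "eventually (\<lambda>n. (\<integral>x. \<bar>fk k x - w n x\<bar> \<partial>lborel) < e / 2) sequentially"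
    using e by (intro order_tendstoD(2)) auto
  then obtain n where n: "(\<integral>x. \<bar>fk k x - w n x\<bar> \<partial>lborel) < e / 2"
    by (auto simp: eventually_sequentially)
  note wi = ckernel_integrable[OF wk[of n]]
  have "(\<integral>x. \<bar>f x - w n x\<bar> \<partial>lborel) \<le> (\<integral>x. \<bar>f x - fk k x\<bar> + \<bar>fk k x - w n x\<bar> \<partial>lborel)"
    using f fk wi by (intro integral_mono) auto
  also have "\<dots> = (\<integral>x. \<bar>f x - fk k x\<bar> \<partial>lborel) + (\<integral>x. \<bar>fk k x - w n x\<bar> \<partial>lborel)"
    using f fk wi by (intro Bochner_Integration.integral_add) auto
  also have "\<dots> < e" using k n by simp
  finally show ?thesis using that wk by blast
qed

lemma mollifier_reflect: "mollifier s (z - y) = mollifier s (y - z)"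
  by (simp add: mollifier_def flip: power2_norm_eq_inner) (simp add: norm_minus_commute)

lemma mollify_continuous_bound:
  assumes w: "ckernel r w" and s: "0 < s" and e: "\<And>z. norm (z - y) < s \<Longrightarrow> \<bar>w z - w y\<bar> \<le> e" "0 \<le> e"
  shows "\<bar>correlate w (mollifier s) y - mass TYPE('a) * w (y::'a::euclidean_space)\<bar> \<le> e * mass TYPE('a)"
proof -
  have k: "ckernel s (mollifier s :: 'a \<Rightarrow> real)" by (rule ckernel_mollifier[OF s])
  have ki: "integrable lborel (\<lambda>z. mollifier s (z - y))"
    using integrable_reflect[OF ckernel_integrable[OF k], of y] by (simp add: mollifier_reflect[of s _ y])
  have km: "(\<integral>z. mollifier s (z - y) \<partial>lborel) = mass TYPE('a)"
    using integral_reflect[OF ckernel_borel[OF k], of y] mollifier_mass[OF s] by (simp add: mollifier_reflect[of s _ y])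
  have wi: "integrable lborel (\<lambda>z. w z * mollifier s (z - y))"
    by (rule integrable_mult_ckernel[OF ckernel_integrable[OF w] k])
  have "correlate w (mollifier s) y - mass TYPE('a) * w y = (\<integral>z. (w z - w y) * mollifier s (z - y) \<partial>lborel)"
    unfolding correlate_def km[symmetric] using wi ki by (simp add: left_diff_distrib)
  also have "\<bar>\<dots>\<bar> \<le> (\<integral>z. e * mollifier s (z - y) \<partial>lborel)"
  proof (rule integral_abs_bound[THEN order_trans], rule integral_mono)
    show "integrable lborel (\<lambda>z. \<bar>(w z - w y) * mollifier s (z - y)\<bar>)"
      using wi ki by (intro integrable_abs) (simp add: left_diff_distrib)
    show "\<bar>(w z - w y) * mollifier s (z - y)\<bar> \<le> e * mollifier s (z - y)" for z
    proof (cases "norm (z - y) < s")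
      case True
      then show ?thesis using e(1)[OF True] mollifier_nonneg[OF s, of "z - y"]
        by (simp add: abs_mult mult_right_mono)
    next
      case False
      then show ?thesis using k by (simp add: ckernel_def)
    qed
  qed (use ki in auto)
  also have "\<dots> = e * mass TYPE('a)" by (simp add: km)
  finally show ?thesis .
qed

lemma mollify_ckernel_L1:
  fixes w :: "'a::euclidean_space \<Rightarrow> real"
  assumes w: "ckernel r w" and s: "\<And>n. 0 < s n" "\<And>n. s n \<le> 1" "s \<longlonglongrightarrow> 0"
  shows "(\<lambda>n. \<integral>y. \<bar>correlate w (mollifier (s n)) y - mass TYPE('a) * w y\<bar> \<partial>lborel) \<longlonglongrightarrow> 0"
proof -
  let ?m = "mass TYPE('a)"
  obtain B where B: "0 \<le> B" "\<And>x. \<bar>w x\<bar> \<le> B" using ckernel_bounded[OF w] by blast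
  have "(\<lambda>n. \<integral>y. \<bar>correlate w (mollifier (s n)) y - ?m * w y\<bar> \<partial>lborel) \<longlonglongrightarrow> (\<integral>x. 0 \<partial>(lborel :: 'a measure))"
  proof (rule integral_dominated_convergence[where w="\<lambda>x. 2 * B * ?m * indicator (cball 0 (r + 1)) x"])
    show "integrable lborel (\<lambda>x::'a. 2 * B * ?m * indicator (cball 0 (r + 1)) x)"
      using emeasure_lborel_cball_finite[of "0::'a" "r + 1"]
      by (intro integrable_mult_right) (auto intro!: integrable_real_indicator simp: top.not_eq_extremum)
    show "(\<lambda>y. \<bar>correlate w (mollifier (s n)) y - ?m * w y\<bar>) \<in> borel_measurable lborel" for n
      using correlate_borel[OF ckernel_integrable[OF w] ckernel_mollifier[OF s(1)[of n]]] ckernel_borel[OF w] by measurable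
    show "AE y in lborel. (\<lambda>n. \<bar>correlate w (mollifier (s n)) y - ?m * w y\<bar>) \<longlonglongrightarrow> 0"
    proof (rule AE_I2, rule LIMSEQ_I)
      fix y and e :: real assume "0 < e"
      define e' where "e' = e / (2 * ?m)"
      have e': "0 < e'" using \<open>0 < e\<close> mass_pos[where 'a='a] by (simp add: e'_def)
      have "isCont w y" using w by (simp add: ckernel_def continuous_on_eq_continuous_at)
      then obtain d where d: "0 < d" "\<And>z. norm (z - y) < d \<Longrightarrow> \<bar>w z - w y\<bar> < e'"
        using e' unfolding continuous_at_eps_delta dist_norm real_norm_def by metis
      obtain n0 where n0: "\<And>n. n \<ge> n0 \<Longrightarrow> s n < d"
        using order_tendstoD(2)[OF s(3) d(1)] by (auto simp: eventually_sequentially)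
      show "\<exists>n0. \<forall>n\<ge>n0. norm (\<bar>correlate w (mollifier (s n)) y - ?m * w y\<bar> - 0) < e"
      proof (intro exI allI impI)
        fix n assume "n \<ge> n0"
        then have "\<bar>correlate w (mollifier (s n)) y - ?m * w y\<bar> \<le> e' * ?m"
          using n0[of n] d(2) e' by (intro mollify_continuous_bound[OF w s(1)]) (auto intro!: less_imp_le)
        also have "\<dots> < e" using \<open>0 < e\<close> mass_pos[where 'a='a] by (simp add: e'_def)
        finally show "norm (\<bar>correlate w (mollifier (s n)) y - ?m * w y\<bar> - 0) < e" by simp
      qed
    qed
    show "AE y in lborel. norm \<bar>correlate w (mollifier (s n)) y - ?m * w y\<bar> \<le> 2 * B * ?m * indicator (cball 0 (r + 1)) y" for n
    proof (rule AE_I2)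
      fix y :: 'a
      show "norm \<bar>correlate w (mollifier (s n)) y - ?m * w y\<bar> \<le> 2 * B * ?m * indicator (cball 0 (r + 1)) y"
      proof (cases "norm y \<le> r + 1")
        case True
        have "\<bar>correlate w (mollifier (s n)) y - ?m * w y\<bar> \<le> (2 * B) * ?m"
        proof (rule mollify_continuous_bound[OF w s(1)])
          show "\<bar>w z - w y\<bar> \<le> 2 * B" for z
            using B(2)[of z] B(2)[of y] by linarith
        qed (use B in auto)
        then show ?thesis using True by simp
      next
        \<comment> \<open>Far from the support of \<open>w\<close> the mollification at scales below 1 vanishes as well.\<close>
        case False
        have z: "w z = 0" if "norm (z - y) < 1" for z
        proof -
          have "norm y \<le> norm z + norm (z - y)" using norm_triangle_ineq4[of z "z - y"] by simp
          then show ?thesis using w False that by (simp add: ckernel_def)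
        qed
        have "\<bar>correlate w (mollifier (s n)) y - ?m * w y\<bar> \<le> 0 * ?m"
          using z[of y] z s(2)[of n] by (intro mollify_continuous_bound[OF w s(1)]) auto
        then show ?thesis using False by simp
      qed
    qed
  qed auto
  then show ?thesis by simp
qed

text \<open>Density of the kernels among the integrable functions, since mollification is bounded in the mean by the mass.\<close>

lemma mollify_L1:
  fixes f :: "'a::euclidean_space \<Rightarrow> real"
  assumes f: "integrable lborel f" and s: "\<And>n. 0 < s n" "\<And>n. s n \<le> 1" "s \<longlonglongrightarrow> 0"
  shows "(\<lambda>n. \<integral>y. \<bar>correlate f (mollifier (s n)) y - mass TYPE('a) * f y\<bar> \<partial>lborel) \<longlonglongrightarrow> 0"
proof (rule LIMSEQ_I)
  let ?m = "mass TYPE('a)"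
  fix e :: real assume e: "0 < e"
  define e' where "e' = e / (4 * ?m)"
  have e': "0 < e'" using e mass_pos[where 'a='a] by (simp add: e'_def)
  obtain w r where w: "ckernel r w" and fw: "(\<integral>x. \<bar>f x - w x\<bar> \<partial>lborel) < e'"
    using integrable_approx_ckernel[OF f e'] by blast
  note wi = ckernel_integrable[OF w]
  have "eventually (\<lambda>n. (\<integral>y. \<bar>correlate w (mollifier (s n)) y - ?m * w y\<bar> \<partial>lborel) < e / 2) sequentially"
    using order_tendstoD(2)[OF mollify_ckernel_L1[OF w s], OF half_gt_zero[OF e]] .
  then obtain n0 where n0: "\<And>n. n \<ge> n0 \<Longrightarrow> (\<integral>y. \<bar>correlate w (mollifier (s n)) y - ?m * w y\<bar> \<partial>lborel) < e / 2"
    by (auto simp: eventually_sequentially)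
  show "\<exists>n0. \<forall>n\<ge>n0. norm ((\<integral>y. \<bar>correlate f (mollifier (s n)) y - ?m * f y\<bar> \<partial>lborel) - 0) < e"
  proof (intro exI allI impI)
    fix n assume n: "n \<ge> n0"
    let ?K = "mollifier (s n) :: 'a \<Rightarrow> real"
    have K: "ckernel (s n) ?K" by (rule ckernel_mollifier[OF s(1)])
    have afw: "integrable lborel (\<lambda>x. \<bar>f x - w x\<bar>)" using f wi by auto
    have ci: "integrable lborel (correlate f ?K)" "integrable lborel (correlate w ?K)" "integrable lborel (correlate (\<lambda>x. \<bar>f x - w x\<bar>) ?K)"
      by (rule correlate_integrable[OF f K] correlate_integrable[OF wi K] correlate_integrable[OF afw K])+
    have d: "\<bar>correlate f ?K y - correlate w ?K y\<bar> \<le> correlate (\<lambda>x. \<bar>f x - w x\<bar>) ?K y" for y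
    proof -
      have "correlate f ?K y - correlate w ?K y = (\<integral>z. (f z - w z) * ?K (z - y) \<partial>lborel)"
        unfolding correlate_def using integrable_mult_ckernel[OF f K] integrable_mult_ckernel[OF wi K]
        by (simp add: left_diff_distrib)
      also have "\<bar>\<dots>\<bar> \<le> (\<integral>z. \<bar>(f z - w z) * ?K (z - y)\<bar> \<partial>lborel)" by (rule integral_abs_bound)
      also have "\<dots> = correlate (\<lambda>x. \<bar>f x - w x\<bar>) ?K y"
        unfolding correlate_def abs_mult by (simp add: abs_of_nonneg[OF mollifier_nonneg[OF s(1)]])
      finally show ?thesis .
    qed
    have "(\<integral>y. \<bar>correlate f ?K y - ?m * f y\<bar> \<partial>lborel) \<le>
       (\<integral>y. (correlate (\<lambda>x. \<bar>f x - w x\<bar>) ?K y + ?m * \<bar>f y - w y\<bar>) + \<bar>correlate w ?K y - ?m * w y\<bar> \<partial>lborel)"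
    proof (rule integral_mono)
      show "\<bar>correlate f ?K y - ?m * f y\<bar> \<le> (correlate (\<lambda>x. \<bar>f x - w x\<bar>) ?K y + ?m * \<bar>f y - w y\<bar>) + \<bar>correlate w ?K y - ?m * w y\<bar>" for y
      proof -
        have "\<bar>?m * w y - ?m * f y\<bar> = ?m * \<bar>f y - w y\<bar>"
          using mass_pos[where 'a='a] by (simp add: abs_mult flip: right_diff_distrib)
        then show ?thesis using d[of y] by linarith
      qed
    qed (use ci f wi in \<open>auto intro!: Bochner_Integration.integrable_add integrable_abs\<close>)
    also have "\<dots> = (\<integral>y. correlate (\<lambda>x. \<bar>f x - w x\<bar>) ?K y \<partial>lborel) + ?m * (\<integral>y. \<bar>f y - w y\<bar> \<partial>lborel)
        + (\<integral>y. \<bar>correlate w ?K y - ?m * w y\<bar> \<partial>lborel)"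
      using ci f wi by simp
    also have "\<dots> = 2 * ?m * (\<integral>y. \<bar>f y - w y\<bar> \<partial>lborel) + (\<integral>y. \<bar>correlate w ?K y - ?m * w y\<bar> \<partial>lborel)"
      by (simp add: integral_correlate[OF afw K] mollifier_mass[OF s(1)])
    also have "\<dots> < 2 * ?m * e' + e / 2"
      using fw n0[OF n] mass_pos[where 'a='a] by (intro add_strict_mono mult_strict_left_mono) auto
    also have "\<dots> = e" using mass_pos[where 'a='a] by (simp add: e'_def)
    finally show "norm ((\<integral>y. \<bar>correlate f ?K y - ?m * f y\<bar> \<partial>lborel) - 0) < e" by simp
  qed
qed

text \<open>Convergence in the mean gives almost everywhere convergence along a subsequence of scales, simultaneously for
  all components; Fatou's lemma then carries a bound that is uniform in the scale over to the limit.\<close>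

lemma mollify_Fatou:
  fixes v :: "'a::euclidean_space \<Rightarrow> 'a"
  assumes v: "integrable lborel v" and s0: "0 < s0" and A: "A \<in> sets borel"
    and int: "\<And>t. 0 < t \<Longrightarrow> t \<le> s0 \<Longrightarrow>
      (\<integral>\<^sup>+y. ennreal (\<Sum>i\<in>Basis. (correlate (\<lambda>z. v z \<bullet> i) (mollifier t) y)\<^sup>2) * indicator A y \<partial>lborel) \<le> D"
  shows "(\<integral>\<^sup>+y. ennreal ((mass TYPE('a))\<^sup>2 * (v y \<bullet> v y)) * indicator A y \<partial>lborel) \<le> D"
proof -
  let ?m = "mass TYPE('a)" and ?B = "Basis :: 'a set"
  define s where "s n = min s0 1 / (real n + 1)" for n
  have s: "0 < s n" "s n \<le> 1" "s n \<le> s0" for n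
  proof -
    have "min s0 1 * 1 \<le> min s0 1 * (real n + 1)" using s0 by (intro mult_left_mono) auto
    then have "s n \<le> min s0 1" unfolding s_def by (subst divide_le_eq) auto
    then show "s n \<le> 1" "s n \<le> s0" by auto
  qed (use s0 in \<open>simp add: s_def\<close>)
  have s_lim: "s \<longlonglongrightarrow> 0"
    unfolding s_def using tendsto_mult_right_zero[OF LIMSEQ_inverse_real_of_nat, of "min s0 1"]
    by (simp add: divide_inverse add.commute)
  have vi: "integrable lborel (\<lambda>z. v z \<bullet> i)" for i using v by auto
  define err where "err n y = (\<Sum>i\<in>?B. \<bar>correlate (\<lambda>z. v z \<bullet> i) (mollifier (s n)) y - ?m * (v y \<bullet> i)\<bar>)" for n y
  have erri: "integrable lborel (\<lambda>y. \<bar>correlate (\<lambda>z. v z \<bullet> i) (mollifier (s n)) y - ?m * (v y \<bullet> i)\<bar>)" for i n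
    using correlate_integrable[OF vi ckernel_mollifier[OF s(1)]] v by auto
  have "\<exists>r. strict_mono r \<and> (AE y in lborel. (\<lambda>n. err (r n) y) \<longlonglongrightarrow> 0)"
  proof (rule tendsto_L1_AE_subseq)
    show "integrable lborel (err n)" for n unfolding err_def by (intro Bochner_Integration.integrable_sum erri)
    have "(\<lambda>n. \<Sum>i\<in>?B. \<integral>y. \<bar>correlate (\<lambda>z. v z \<bullet> i) (mollifier (s n)) y - ?m * (v y \<bullet> i)\<bar> \<partial>lborel) \<longlonglongrightarrow> (\<Sum>i\<in>?B. 0)"
      by (intro tendsto_sum mollify_L1 vi s s_lim)
    moreover have "norm (err n y) = err n y" for n y by (simp add: err_def sum_nonneg)
    ultimately show "(\<lambda>n. \<integral>y. norm (err n y) \<partial>lborel) \<longlonglongrightarrow> 0"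
      using erri by (simp add: err_def Bochner_Integration.integral_sum)
  qed
  then obtain r where r: "strict_mono r" "AE y in lborel. (\<lambda>n. err (r n) y) \<longlonglongrightarrow> 0" by blast
  define F where "F n y = ennreal (\<Sum>i\<in>?B. (correlate (\<lambda>z. v z \<bullet> i) (mollifier (s (r n))) y)\<^sup>2) * indicator A y" for n y
  have [measurable]: "F n \<in> borel_measurable borel" for n
    using A correlate_borel[OF vi ckernel_mollifier[OF s(1)]] unfolding F_def by measurable
  have "(\<integral>\<^sup>+y. ennreal (?m\<^sup>2 * (v y \<bullet> v y)) * indicator A y \<partial>lborel) = (\<integral>\<^sup>+y. liminf (\<lambda>n. F n y) \<partial>lborel)"
  proof (rule nn_integral_cong_AE)
    show "AE y in lborel. ennreal (?m\<^sup>2 * (v y \<bullet> v y)) * indicator A y = liminf (\<lambda>n. F n y)"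
      using r(2)
    proof eventually_elim
      case (elim y)
      have "(\<lambda>n. correlate (\<lambda>z. v z \<bullet> i) (mollifier (s (r n))) y) \<longlonglongrightarrow> ?m * (v y \<bullet> i)" if "i \<in> ?B" for i
      proof -
        have "(\<lambda>n. \<bar>correlate (\<lambda>z. v z \<bullet> i) (mollifier (s (r n))) y - ?m * (v y \<bullet> i)\<bar>) \<longlonglongrightarrow> 0"
          using that by (intro tendsto_sandwich[OF _ _ tendsto_const elim] always_eventually allI)
            (auto simp: err_def intro!: member_le_sum)
        then show ?thesis by (simp add: LIM_zero_iff tendsto_rabs_zero_iff)
      qed
      then have "(\<lambda>n. \<Sum>i\<in>?B. (correlate (\<lambda>z. v z \<bullet> i) (mollifier (s (r n))) y)\<^sup>2) \<longlonglongrightarrow> (\<Sum>i\<in>?B. (?m * (v y \<bullet> i))\<^sup>2)"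
        by (intro tendsto_intros)
      also have "(\<Sum>i\<in>?B. (?m * (v y \<bullet> i))\<^sup>2) = ?m\<^sup>2 * (v y \<bullet> v y)"
        by (simp add: euclidean_inner[of "v y" "v y"] sum_distrib_left power2_eq_square mult_ac)
      finally have "(\<lambda>n. F n y) \<longlonglongrightarrow> ennreal (?m\<^sup>2 * (v y \<bullet> v y)) * indicator A y"
        unfolding F_def by (cases "y \<in> A") (auto intro: tendsto_ennrealI)
      then show ?case by (simp add: lim_imp_Liminf)
    qed
  qed
  also have "\<dots> \<le> liminf (\<lambda>n. \<integral>\<^sup>+y. F n y \<partial>lborel)"
    by (rule nn_integral_liminf) auto
  also have "\<dots> \<le> D"
  proof -
    have "(\<integral>\<^sup>+y. F n y \<partial>lborel) \<le> D" for n unfolding F_def by (rule int) (rule s)+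
    then have "liminf (\<lambda>n. \<integral>\<^sup>+y. F n y \<partial>lborel) \<le> liminf (\<lambda>n. D)" by (intro Liminf_mono always_eventually) auto
    then show ?thesis by (simp add: Liminf_const)
  qed
  finally show ?thesis .
qed

section \<open>Decay of solutions with constant coefficients\<close>

lemma integrable_inner_square:
  fixes v :: "'a::euclidean_space \<Rightarrow> 'a"
  assumes "integrable lborel v" "integrable lborel (\<lambda>z. v z \<bullet> v z)"
  shows "integrable lborel (\<lambda>z. (v z \<bullet> i)\<^sup>2)"
proof (rule Bochner_Integration.integrable_bound[of _ "\<lambda>z. (i \<bullet> i) * (v z \<bullet> v z)"])
  show "AE z in lborel. norm ((v z \<bullet> i)\<^sup>2) \<le> norm ((i \<bullet> i) * (v z \<bullet> v z))"
    by (auto simp: Cauchy_Schwarz_ineq mult.commute[of "i \<bullet> i"])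
qed (use assms in auto)

lemma sum_integral_inner_square:
  fixes v :: "'a::euclidean_space \<Rightarrow> 'a"
  assumes "integrable lborel v" "integrable lborel (\<lambda>z. v z \<bullet> v z)"
  shows "(\<Sum>i\<in>Basis. \<integral>z. (v z \<bullet> i)\<^sup>2 \<partial>lborel) = (\<integral>z. v z \<bullet> v z \<partial>lborel)"
proof -
  have "(\<Sum>i\<in>Basis. \<integral>z. (v z \<bullet> i)\<^sup>2 \<partial>lborel) = (\<integral>z. (\<Sum>i\<in>Basis. (v z \<bullet> i)\<^sup>2) \<partial>lborel)"
    by (rule Bochner_Integration.integral_sum[symmetric]) (rule integrable_inner_square[OF assms])
  also have "\<dots> = (\<integral>z. v z \<bullet> v z \<partial>lborel)"
    by (intro Bochner_Integration.integral_cong refl) (simp add: euclidean_inner[of "v _" "v _"] power2_eq_square)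
  finally show ?thesis .
qed

definition decay_const :: "'a::euclidean_space itself \<Rightarrow> real" where
  "decay_const _ = 2 * unit_ball_vol DIM('a) * 2 ^ DIM('a) / mass TYPE('a)"

lemma decay_const_nonneg: "0 \<le> decay_const TYPE('a::euclidean_space)"
  using mass_pos[where 'a='a] by (simp add: decay_const_def)

text \<open>On the small ball, \<open>v * \<eta>\<^sub>t = v * \<eta>\<^sub>s - D\<^sup>2\<psi> * G\<close> with \<open>s = R / 2\<close>. The square of the first term is bounded
  pointwise by a multiple of \<open>\<parallel>v\<parallel>\<^sup>2 s powr (- d)\<close> and is integrated over a ball of volume proportional to
  \<open>r ^ d\<close>; the second term obeys the energy estimate. Both bounds are independent of \<open>t\<close>.\<close>

lemma constant_coefficient_decay:
  fixes U :: "'a::euclidean_space \<Rightarrow> real" and v G :: "'a \<Rightarrow> 'a"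
  assumes grad_U: "\<And>\<phi> b. \<phi> \<in> test_functions (ball x0 R) \<Longrightarrow> b \<in> Basis \<Longrightarrow>
      (\<integral>z. U z * (grad \<phi> z \<bullet> b) \<partial>lborel) = - (\<integral>z. (v z \<bullet> b) * \<phi> z \<partial>lborel)"
    and div_v: "\<And>\<phi>. \<phi> \<in> test_functions (ball x0 R) \<Longrightarrow>
      (\<integral>z. v z \<bullet> grad \<phi> z \<partial>lborel) = (\<integral>z. G z \<bullet> grad \<phi> z \<partial>lborel)"
    and v: "integrable lborel v" "integrable lborel (\<lambda>z. v z \<bullet> v z)"
    and G: "integrable lborel G" "integrable lborel (\<lambda>z. G z \<bullet> G z)"
    and r: "0 < r" "r \<le> R / 2"
  shows "(\<integral>y. (v y \<bullet> v y) * indicator (ball x0 r) y \<partial>lborel) \<le>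
     decay_const TYPE('a) * (r / R) ^ DIM('a) * (\<integral>z. v z \<bullet> v z \<partial>lborel) + 8 * (\<integral>z. G z \<bullet> G z \<partial>lborel)"
proof -
  let ?m = "mass TYPE('a)" and ?B = "Basis :: 'a set" and ?d = "DIM('a)"
  define s where "s = R / 2"
  have s: "0 < s" "0 \<le> s" using r by (auto simp: s_def)
  define V where "V = (\<integral>z. v z \<bullet> v z \<partial>lborel)"
  define Gn where "Gn = (\<integral>z. G z \<bullet> G z \<partial>lborel)"
  have V0: "0 \<le> V" and G0: "0 \<le> Gn" by (auto simp: V_def Gn_def intro!: integral_nonneg_AE)
  have m: "0 < ?m" by (rule mass_pos)
  define D where "D = 2 * (?m * inverse s ^ ?d * V) * (unit_ball_vol ?d * r ^ ?d) + 8 * ?m\<^sup>2 * Gn"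
  have vi: "integrable lborel (\<lambda>z. v z \<bullet> i)" "integrable lborel (\<lambda>z. (v z \<bullet> i)\<^sup>2)" for i
    using v integrable_inner_square[OF v] by auto
  have gi: "integrable lborel (\<lambda>z. G z \<bullet> i)" "integrable lborel (\<lambda>z. (G z \<bullet> i)\<^sup>2)" for i
    using G integrable_inner_square[OF G] by auto
  have sup: "(\<Sum>i\<in>?B. (correlate (\<lambda>z. v z \<bullet> i) (mollifier s) y)\<^sup>2) \<le> ?m * inverse s ^ ?d * V" for y
  proof -
    have "(\<Sum>i\<in>?B. (correlate (\<lambda>z. v z \<bullet> i) (mollifier s) y)\<^sup>2) \<le> (\<Sum>i\<in>?B. ?m * inverse s ^ ?d * (\<integral>z. (v z \<bullet> i)\<^sup>2 \<partial>lborel))"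
    proof (rule sum_mono)
      fix i
      have k: "ckernel s (mollifier s :: 'a \<Rightarrow> real)" by (rule ckernel_mollifier[OF s(1)])
      have "(correlate (\<lambda>z. v z \<bullet> i) (mollifier s) y)\<^sup>2 \<le> ?m * correlate (\<lambda>z. (v z \<bullet> i)\<^sup>2) (mollifier s) y"
        by (rule correlate_square_le[OF vi k mollifier_nonneg[OF s(1)]]) (simp add: mollifier_mass[OF s(1)])
      also have "correlate (\<lambda>z. (v z \<bullet> i)\<^sup>2) (mollifier s) y \<le> (\<integral>z. (v z \<bullet> i)\<^sup>2 * inverse s ^ ?d \<partial>lborel)"
        unfolding correlate_def
        by (rule integral_mono[OF integrable_mult_ckernel[OF vi(2) k]])
           (use vi(2) mollifier_le[OF s(1)] in \<open>auto intro!: mult_left_mono\<close>)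
      finally show "(correlate (\<lambda>z. v z \<bullet> i) (mollifier s) y)\<^sup>2 \<le> ?m * inverse s ^ ?d * (\<integral>z. (v z \<bullet> i)\<^sup>2 \<partial>lborel)"
        using m by (simp add: mult_ac mult_left_mono)
    qed
    also have "\<dots> = ?m * inverse s ^ ?d * V"
      by (simp add: V_def sum_integral_inner_square[OF v] flip: sum_distrib_left)
    finally show ?thesis .
  qed
  have D0: "0 \<le> 2 * (?m * inverse s ^ ?d * V)" using m s V0 by simp
  have "(\<integral>\<^sup>+y. ennreal (?m\<^sup>2 * (v y \<bullet> v y)) * indicator (ball x0 r) y \<partial>lborel) \<le> ennreal D"
  proof (rule mollify_Fatou[OF v(1) s(1)])
    fix t assume t: "0 < t" "t \<le> s"
    define W where "W i y = (\<Sum>b\<in>?B. correlate (\<lambda>z. G z \<bullet> b) (hess_pot t s i b) y)" for i y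
    have Wi: "integrable lborel (\<lambda>y. \<Sum>i\<in>?B. (W i y)\<^sup>2)"
      and Wb: "(\<integral>y. (\<Sum>i\<in>?B. (W i y)\<^sup>2) \<partial>lborel) \<le> 4 * ?m\<^sup>2 * Gn"
      using energy_estimate[where g="\<lambda>b z. G z \<bullet> b", OF gi t] sum_integral_inner_square[OF G] unfolding W_def Gn_def by auto
    have pt: "ennreal (\<Sum>i\<in>?B. (correlate (\<lambda>z. v z \<bullet> i) (mollifier t) y)\<^sup>2) * indicator (ball x0 r) y
       \<le> ennreal (2 * (?m * inverse s ^ ?d * V)) * indicator (ball x0 r) y + ennreal (2 * (\<Sum>i\<in>?B. (W i y)\<^sup>2))" for y
    proof (cases "y \<in> ball x0 r")
      case True
      have sub: "cball y s \<subseteq> ball x0 R"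
      proof
        fix z assume "z \<in> cball y s"
        then have "dist x0 z < r + s" using True dist_triangle[of x0 z y] by (simp add: dist_commute)
        then show "z \<in> ball x0 R" using r by (simp add: s_def)
      qed
      have "(\<Sum>i\<in>?B. (correlate (\<lambda>z. v z \<bullet> i) (mollifier t) y)\<^sup>2) \<le>
         (\<Sum>i\<in>?B. 2 * (correlate (\<lambda>z. v z \<bullet> i) (mollifier s) y)\<^sup>2 + 2 * (W i y)\<^sup>2)"
      proof (rule sum_mono)
        fix i :: 'a assume "i \<in> ?B"
        from mollifier_difference_identity[OF grad_U div_v v(1) G(1) t sub this]
        have eq: "correlate (\<lambda>z. v z \<bullet> i) (mollifier t) y = correlate (\<lambda>z. v z \<bullet> i) (mollifier s) y - W i y"
          by (simp add: W_def)
        show "(correlate (\<lambda>z. v z \<bullet> i) (mollifier t) y)\<^sup>2 \<le> 2 * (correlate (\<lambda>z. v z \<bullet> i) (mollifier s) y)\<^sup>2 + 2 * (W i y)\<^sup>2"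
          unfolding eq using zero_le_power2[of "correlate (\<lambda>z. v z \<bullet> i) (mollifier s) y + W i y"] by (simp add: power2_eq_square algebra_simps)
      qed
      also have "\<dots> \<le> 2 * (?m * inverse s ^ ?d * V) + 2 * (\<Sum>i\<in>?B. (W i y)\<^sup>2)"
        using sup[of y] by (simp add: sum.distrib flip: sum_distrib_left)
      finally show ?thesis using True D0
        by (simp add: sum_nonneg flip: ennreal_plus del: ennreal_plus)
    qed simp
    have "(\<integral>\<^sup>+y. ennreal (\<Sum>i\<in>?B. (correlate (\<lambda>z. v z \<bullet> i) (mollifier t) y)\<^sup>2) * indicator (ball x0 r) y \<partial>lborel) \<le>
       (\<integral>\<^sup>+y. ennreal (2 * (?m * inverse s ^ ?d * V)) * indicator (ball x0 r) y + ennreal (2 * (\<Sum>i\<in>?B. (W i y)\<^sup>2)) \<partial>lborel)"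
      by (intro nn_integral_mono pt)
    also have "\<dots> = ennreal (2 * (?m * inverse s ^ ?d * V)) * emeasure lborel (ball x0 r) +
        (\<integral>\<^sup>+y. ennreal (2 * (\<Sum>i\<in>?B. (W i y)\<^sup>2)) \<partial>lborel)"
    proof (subst nn_integral_add)
      show "(\<lambda>y. ennreal (2 * (?m * inverse s ^ ?d * V)) * indicator (ball x0 r) y) \<in> borel_measurable lborel"
        by (intro borel_measurable_times_ennreal borel_measurable_const borel_measurable_indicator) simp
    qed (use Wi in \<open>auto simp: nn_integral_cmult_indicator\<close>)
    also have "(\<integral>\<^sup>+y. ennreal (2 * (\<Sum>i\<in>?B. (W i y)\<^sup>2)) \<partial>lborel) = ennreal (\<integral>y. 2 * (\<Sum>i\<in>?B. (W i y)\<^sup>2) \<partial>lborel)"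
      using Wi by (intro nn_integral_eq_integral) (auto simp: sum_nonneg)
    also have "emeasure lborel (ball x0 r) = ennreal (unit_ball_vol ?d * r ^ ?d)"
      using emeasure_ball[of r x0] r by simp
    also have "ennreal (2 * (?m * inverse s ^ ?d * V)) * ennreal (unit_ball_vol ?d * r ^ ?d) +
        ennreal (\<integral>y. 2 * (\<Sum>i\<in>?B. (W i y)\<^sup>2) \<partial>lborel) =
        ennreal (2 * (?m * inverse s ^ ?d * V) * (unit_ball_vol ?d * r ^ ?d) + (\<integral>y. 2 * (\<Sum>i\<in>?B. (W i y)\<^sup>2) \<partial>lborel))"
      using D0 r by (subst ennreal_plus) (auto simp: ennreal_mult intro!: integral_nonneg_AE sum_nonneg)
    also have "\<dots> \<le> ennreal D"
      unfolding D_def using Wb Wi by (intro ennreal_leI) (simp add: mult_ac)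
    finally show "(\<integral>\<^sup>+y. ennreal (\<Sum>i\<in>?B. (correlate (\<lambda>z. v z \<bullet> i) (mollifier t) y)\<^sup>2) * indicator (ball x0 r) y \<partial>lborel) \<le> ennreal D" .
  qed auto
  moreover have "(\<integral>\<^sup>+y. ennreal (?m\<^sup>2 * (v y \<bullet> v y)) * indicator (ball x0 r) y \<partial>lborel) =
     ennreal (?m\<^sup>2 * (\<integral>y. (v y \<bullet> v y) * indicator (ball x0 r) y \<partial>lborel))"
  proof -
    have vv: "integrable lborel (\<lambda>y. (v y \<bullet> v y) * indicator (ball x0 r) y)"
      using v(2) by (rule integrable_real_mult_indicator[rotated]) auto
    have "(\<integral>\<^sup>+y. ennreal (?m\<^sup>2 * (v y \<bullet> v y)) * indicator (ball x0 r) y \<partial>lborel) =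
       (\<integral>\<^sup>+y. ennreal (?m\<^sup>2 * ((v y \<bullet> v y) * indicator (ball x0 r) y)) \<partial>lborel)"
      by (intro nn_integral_cong) (auto simp: indicator_def)
    also have "\<dots> = ennreal (\<integral>y. ?m\<^sup>2 * ((v y \<bullet> v y) * indicator (ball x0 r) y) \<partial>lborel)"
      using vv by (intro nn_integral_eq_integral) auto
    finally show ?thesis by simp
  qed
  ultimately have "ennreal (?m\<^sup>2 * (\<integral>y. (v y \<bullet> v y) * indicator (ball x0 r) y \<partial>lborel)) \<le> ennreal D" by simp
  moreover have "0 \<le> D" using D0 r G0 by (simp add: D_def)
  ultimately have "?m\<^sup>2 * (\<integral>y. (v y \<bullet> v y) * indicator (ball x0 r) y \<partial>lborel) \<le> D"
    by (simp add: ennreal_le_iff)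
  also have "D = ?m\<^sup>2 * (decay_const TYPE('a) * (r / R) ^ ?d * V + 8 * Gn)"
    using m s by (simp add: D_def decay_const_def s_def field_simps power2_eq_square power_divide)
  finally show ?thesis using m by (simp add: V_def Gn_def)
qed

section \<open>Freezing the coefficient\<close>

text \<open>The convolution estimates are stated for Borel functions on the whole space, while solutions are Lebesgue
  measurable on \<open>\<Omega>\<close>. Passing to a Borel function that agrees almost everywhere with the
  extension by zero links the two settings.\<close>

lemma borel_representative:
  fixes f :: "'a::euclidean_space \<Rightarrow> 'b::euclidean_space"
  assumes "f \<in> borel_measurable (lebesgue_on S)" "S \<in> sets lebesgue"
  obtains f' where "f' \<in> borel_measurable borel" "AE x in lebesgue. f' x = (if x \<in> S then f x else 0)"
proof -
  let ?g = "\<lambda>x. if x \<in> S then f x else 0"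
  have g: "?g \<in> borel_measurable lebesgue" using assms by (simp add: borel_measurable_if)
  have "\<forall>b. \<exists>h. h \<in> borel_measurable borel \<and> (AE x in lborel. ?g x \<bullet> b = h x)"
  proof
    fix b :: 'b
    have "(\<lambda>x. ?g x \<bullet> b) \<in> borel_measurable lebesgue" using g by measurable
    from completion_ex_borel_measurable_real[OF this]
    show "\<exists>h. h \<in> borel_measurable borel \<and> (AE x in lborel. ?g x \<bullet> b = h x)" by auto
  qed
  then obtain h where h: "\<And>b. h b \<in> borel_measurable borel" "\<And>b. AE x in lborel. ?g x \<bullet> b = h b x"
    by metis
  show ?thesis
  proof (rule that[of "\<lambda>x. \<Sum>b\<in>Basis. h b x *\<^sub>R b"])
    show "(\<lambda>x. \<Sum>b\<in>Basis. h b x *\<^sub>R b) \<in> borel_measurable borel" using h(1) by measurable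
    have "AE x in lborel. \<forall>b\<in>Basis. ?g x \<bullet> b = h b x"
      by (intro AE_finite_allI h) auto
    then have "AE x in lborel. (\<Sum>b\<in>Basis. h b x *\<^sub>R b) = ?g x"
    proof eventually_elim
      case (elim x)
      then have "(\<Sum>b\<in>Basis. h b x *\<^sub>R b) = (\<Sum>b\<in>Basis. (?g x \<bullet> b) *\<^sub>R b)"
        by (intro sum.cong) auto
      then show ?case by (simp only: euclidean_representation)
    qed
    then show "AE x in lebesgue. (\<Sum>b\<in>Basis. h b x *\<^sub>R b) = ?g x" by (rule AE_completion)
  qed
qed

lemma lborel_lebesgue_on_transfer:
  fixes P' P :: "'a::euclidean_space \<Rightarrow> 'b::euclidean_space"
  assumes "P' \<in> borel_measurable borel" "AE x in lebesgue. P' x = (if x \<in> S then P x else 0)"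
    and S: "S \<in> sets lebesgue" and P: "P \<in> borel_measurable (lebesgue_on S)"
  shows "(\<integral>x. P' x \<partial>lborel) = (\<integral>x. P x \<partial>lebesgue_on S)"
    and "integrable lborel P' \<longleftrightarrow> integrable (lebesgue_on S) P"
proof -
  have m: "(\<lambda>x. if x \<in> S then P x else 0) \<in> borel_measurable lebesgue"
    using P S by (simp add: borel_measurable_if)
  have m': "P' \<in> borel_measurable lebesgue" using assms(1) by (simp add: measurable_completion)
  have eq: "(\<lambda>x. indicator S x *\<^sub>R P x) = (\<lambda>x. if x \<in> S then P x else 0)" by (auto simp: indicator_def)
  have "(\<integral>x. P' x \<partial>lborel) = (\<integral>x. P' x \<partial>lebesgue)" using assms(1) by (simp add: integral_completion)
  also have "\<dots> = (\<integral>x. (if x \<in> S then P x else 0) \<partial>lebesgue)" by (rule integral_cong_AE[OF m' m assms(2)])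
  also have "\<dots> = (\<integral>x. P x \<partial>lebesgue_on S)" using S by (simp add: integral_restrict_space eq)
  finally show "(\<integral>x. P' x \<partial>lborel) = (\<integral>x. P x \<partial>lebesgue_on S)" .
  have "integrable lborel P' \<longleftrightarrow> integrable lebesgue P'" using assms(1) by (simp add: integrable_completion)
  also have "\<dots> \<longleftrightarrow> integrable lebesgue (\<lambda>x. if x \<in> S then P x else 0)" by (rule integrable_cong_AE[OF m' m assms(2)])
  also have "\<dots> \<longleftrightarrow> integrable (lebesgue_on S) P" using S by (simp add: integrable_restrict_space eq)
  finally show "integrable lborel P' \<longleftrightarrow> integrable (lebesgue_on S) P" .
qed

lemma integral_lebesgue_on_support:
  fixes f :: "'a::euclidean_space \<Rightarrow> real"
  assumes "S \<subseteq> T" "S \<in> sets lebesgue" "T \<in> sets lebesgue" "\<And>x. x \<notin> S \<Longrightarrow> f x = 0"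
  shows "(\<integral>x. f x \<partial>lebesgue_on T) = (\<integral>x. f x \<partial>lebesgue_on S)"
  using assms by (simp add: integral_restrict_space) (intro Bochner_Integration.integral_cong refl, auto simp: indicator_def)

lemma measurable_lebesgue_on_subset:
  "f \<in> borel_measurable (lebesgue_on T) \<Longrightarrow> S \<subseteq> T \<Longrightarrow> f \<in> borel_measurable (lebesgue_on S)"
  by (rule measurable_restrict_mono)

lemma integrable_lebesgue_on_subset:
  fixes f :: "'a::euclidean_space \<Rightarrow> real"
  assumes "integrable (lebesgue_on T) f" "S \<subseteq> T" "S \<in> sets lebesgue" "T \<in> sets lebesgue"
  shows "integrable (lebesgue_on S) f"
proof -
  have "integrable lebesgue (\<lambda>x. indicator S x *\<^sub>R (indicator T x *\<^sub>R f x))"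
    using assms by (rule_tac integrable_mult_indicator) (auto simp: integrable_restrict_space)
  moreover have "(\<lambda>x. indicator S x *\<^sub>R (indicator T x *\<^sub>R f x)) = (\<lambda>x. indicator S x *\<^sub>R f x)"
    using assms(2) by (auto simp: indicator_def fun_eq_iff)
  ultimately show ?thesis using assms(3) by (simp add: integrable_restrict_space)
qed

lemma epowr_2: "ennreal x epowr 2 = ennreal (x\<^sup>2)" if "0 \<le> x"
  using that by (simp add: epowr_def powr_numeral)

lemma Lp_2D:
  assumes "v \<in> Lp \<Omega> 2"
  shows "v \<in> borel_measurable (lebesgue_on \<Omega>)" "integrable (lebesgue_on \<Omega>) (\<lambda>x. (norm (v x))\<^sup>2)"
proof -
  show m: "v \<in> borel_measurable (lebesgue_on \<Omega>)" using assms by (simp add: Lp_def)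
  have "(\<integral>\<^sup>+x. ennreal (norm (v x)) epowr 2 \<partial>lebesgue_on \<Omega>) \<noteq> \<infinity>"
    using assms by (auto simp: Lp_def Lp_norm_def eLp_norm_def epowr_def split: if_splits)
  then have "(\<integral>\<^sup>+x. ennreal ((norm (v x))\<^sup>2) \<partial>lebesgue_on \<Omega>) < \<infinity>"
    by (simp add: epowr_2 top.not_eq_extremum)
  then show "integrable (lebesgue_on \<Omega>) (\<lambda>x. (norm (v x))\<^sup>2)"
    using m by (intro integrableI_bounded) auto
qed

lemma Lp_2_integrable_on:
  fixes v :: "'a::euclidean_space \<Rightarrow> 'b::euclidean_space"
  assumes "v \<in> Lp \<Omega> 2" "S \<subseteq> \<Omega>" "S \<in> lmeasurable" "\<Omega> \<in> sets lebesgue"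
  shows "integrable (lebesgue_on S) v"
proof -
  interpret finite_measure "lebesgue_on S" by (rule finite_measure_lebesgue_on[OF assms(3)])
  have i: "integrable (lebesgue_on S) (\<lambda>x. (norm (v x))\<^sup>2)"
    using assms by (intro integrable_lebesgue_on_subset[OF Lp_2D(2)]) (auto simp: fmeasurableD)
  show ?thesis
  proof (rule Bochner_Integration.integrable_bound[of _ "\<lambda>x. 1 + (norm (v x))\<^sup>2"])
    show "integrable (lebesgue_on S) (\<lambda>x. 1 + (norm (v x))\<^sup>2)" using i by auto
    show "v \<in> borel_measurable (lebesgue_on S)"
      using measurable_lebesgue_on_subset[OF Lp_2D(1)] assms by blast
    have "n \<le> 1 + n\<^sup>2" for n :: real
      using zero_le_power2[of "n - 1 / 2"] by (simp add: power2_eq_square algebra_simps)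
    then show "AE x in lebesgue_on S. norm (v x) \<le> norm (1 + (norm (v x))\<^sup>2)" by (simp add: abs_of_nonneg add_nonneg_nonneg)
  qed
qed

lemma test_functionsD:
  assumes "\<phi> \<in> test_functions B"
  shows "continuous_on UNIV \<phi>" "continuous_on UNIV (grad \<phi>)" "\<And>x. x \<notin> B \<Longrightarrow> \<phi> x = 0" "\<And>x. x \<notin> B \<Longrightarrow> grad \<phi> x = 0"
    "\<exists>C. \<forall>x. norm (grad \<phi> x) \<le> C"
proof -
  let ?K = "closure {x. \<phi> x \<noteq> 0}"
  have sm: "smooth \<phi>" and K: "compact ?K" "?K \<subseteq> B" using assms by (auto simp: test_functions_def)
  show "continuous_on UNIV \<phi>"
    using sm[unfolded smooth_def, rule_format, of "[]"] by (simp add: differentiable_imp_continuous_on)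
  show g: "continuous_on UNIV (grad \<phi>)"
    unfolding grad_def[abs_def]
  proof (intro continuous_on_sum continuous_on_scaleR continuous_on_const)
    fix b :: 'a assume "b \<in> Basis"
    then show "continuous_on UNIV (\<lambda>x. frechet_derivative \<phi> (at x) b)"
      using sm[unfolded smooth_def, rule_format, of "[b]"] by (simp add: differentiable_imp_continuous_on)
  qed
  show "\<And>x. x \<notin> B \<Longrightarrow> \<phi> x = 0" using K closure_subset[of "{x. \<phi> x \<noteq> 0}"] by auto
  have z: "grad \<phi> x = 0" if "x \<notin> ?K" for x
  proof -
    have "(\<phi> has_derivative (\<lambda>h. 0)) (at x)"
    proof (rule has_derivative_transform_within_open)
      show "((\<lambda>_. 0) has_derivative (\<lambda>h. 0)) (at x)" by simp
      show "open (- ?K)" by (intro open_Compl closed_closure)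
      show "x \<in> - ?K" using that by simp
      show "y \<in> - ?K \<Longrightarrow> 0 = \<phi> y" for y using closure_subset[of "{x. \<phi> x \<noteq> 0}"] by auto
    qed
    then show ?thesis using grad_eqI by fastforce
  qed
  show "\<And>x. x \<notin> B \<Longrightarrow> grad \<phi> x = 0" using z K by blast
  have "compact (grad \<phi> ` ?K)"
    using g K by (intro compact_continuous_image) (auto intro: continuous_on_subset)
  then obtain C where C: "\<And>x. x \<in> ?K \<Longrightarrow> norm (grad \<phi> x) \<le> C"
    by (force dest!: compact_imp_bounded simp: bounded_iff)
  then have "norm (grad \<phi> x) \<le> max 0 C" for x by (cases "x \<in> ?K") (auto simp: z le_max_iff_disj)
  then show "\<exists>C. \<forall>x. norm (grad \<phi> x) \<le> C" by blast
qed

lemma test_functions_mono: "B \<subseteq> \<Omega> \<Longrightarrow> test_functions B \<subseteq> test_functions \<Omega>"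
  by (auto simp: test_functions_def)

definition energy :: "('a::euclidean_space \<Rightarrow> 'b::real_normed_vector) \<Rightarrow> 'a set \<Rightarrow> real" where
  "energy v A = (\<integral>x. (norm (v x))\<^sup>2 \<partial>lebesgue_on A)"

text \<open>On the ball the equation reads \<open>a0 div Du = div (- F + (a0 - a) Du)\<close>, so the constant
  coefficient estimate applies with \<open>G = (- F + (a0 - a) Du) / a0\<close>.\<close>

lemma frozen_decay:
  fixes \<Omega> :: "'a::euclidean_space set"
  assumes \<Omega>: "open \<Omega>" and sol: "weak_solution \<Omega> a F u Du" and a: "a \<in> borel_measurable (lebesgue_on \<Omega>)"
    and B: "ball x0 R \<subseteq> \<Omega>" and a0: "0 < a0" and M: "AE y in lebesgue_on (ball x0 R). \<bar>a y - a0\<bar> \<le> M" "0 \<le> M"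
    and r: "0 < r" "r \<le> R / 2"
  shows "energy Du (ball x0 r) \<le> decay_const TYPE('a) * (r / R) ^ DIM('a) * energy Du (ball x0 R)
     + 16 / a0\<^sup>2 * (energy F (ball x0 R) + M\<^sup>2 * energy Du (ball x0 R))"
proof -
  let ?B = "ball x0 R" and ?L = "lebesgue_on (ball x0 R)"
  define G where "G x = (1 / a0) *\<^sub>R (- F x + (a0 - a x) *\<^sub>R Du x)" for x
  have sets: "?B \<in> sets lebesgue" "?B \<in> lmeasurable" "\<Omega> \<in> sets lebesgue" using \<Omega> by auto
  have u2: "u \<in> Lp \<Omega> 2" and D2: "Du \<in> Lp \<Omega> 2" and F2: "F \<in> Lp \<Omega> 2" and wg: "weak_gradient \<Omega> u Du"
    and eq: "\<And>\<phi>. \<phi> \<in> test_functions \<Omega> \<Longrightarrow> (\<integral>x. a x * (Du x \<bullet> grad \<phi> x) \<partial>lebesgue_on \<Omega>) =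
        - (\<integral>x. F x \<bullet> grad \<phi> x \<partial>lebesgue_on \<Omega>)"
    using sol by (auto simp: weak_solution_def H1_gradient_def)
  have [measurable]: "u \<in> borel_measurable ?L" "Du \<in> borel_measurable ?L" "F \<in> borel_measurable ?L" "a \<in> borel_measurable ?L"
    using measurable_lebesgue_on_subset[OF _ B] Lp_2D(1)[OF u2] Lp_2D(1)[OF D2] Lp_2D(1)[OF F2] a by blast+
  have Di: "integrable ?L Du" and Fi: "integrable ?L F"
    by (intro Lp_2_integrable_on[OF _ B sets(2,3)] D2 F2)+
  have D2i: "integrable ?L (\<lambda>x. (norm (Du x))\<^sup>2)" and F2i: "integrable ?L (\<lambda>x. (norm (F x))\<^sup>2)"
    by (intro integrable_lebesgue_on_subset[OF Lp_2D(2) B sets(1,3)] D2 F2)+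
  have G[measurable]: "G \<in> borel_measurable ?L" unfolding G_def by measurable
  have G_le: "AE x in ?L. (norm (G x))\<^sup>2 \<le> 2 / a0\<^sup>2 * ((norm (F x))\<^sup>2 + M\<^sup>2 * (norm (Du x))\<^sup>2)"
    using M(1)
  proof eventually_elim
    case (elim x)
    have "norm (- F x + (a0 - a x) *\<^sub>R Du x) \<le> norm (F x) + \<bar>a0 - a x\<bar> * norm (Du x)"
      using norm_triangle_ineq[of "- F x" "(a0 - a x) *\<^sub>R Du x"] by simp
    also have "\<dots> \<le> norm (F x) + M * norm (Du x)" using elim by (simp add: mult_right_mono abs_minus_commute)
    finally have "(norm (- F x + (a0 - a x) *\<^sub>R Du x))\<^sup>2 \<le> (norm (F x) + M * norm (Du x))\<^sup>2"
      by (intro power_mono) auto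
    also have "\<dots> \<le> 2 * (norm (F x))\<^sup>2 + 2 * (M * norm (Du x))\<^sup>2"
      using zero_le_power2[of "norm (F x) - M * norm (Du x)"] by (simp add: power2_eq_square algebra_simps)
    also have "\<dots> = 2 * ((norm (F x))\<^sup>2 + M\<^sup>2 * (norm (Du x))\<^sup>2)" by (simp add: power_mult_distrib)
    finally have "(norm (- F x + (a0 - a x) *\<^sub>R Du x))\<^sup>2 / a0\<^sup>2 \<le> 2 * ((norm (F x))\<^sup>2 + M\<^sup>2 * (norm (Du x))\<^sup>2) / a0\<^sup>2"
      by (rule divide_right_mono) simp
    then show ?case by (simp add: G_def power_divide)
  qed
  have bi: "integrable ?L (\<lambda>x. 2 / a0\<^sup>2 * ((norm (F x))\<^sup>2 + M\<^sup>2 * (norm (Du x))\<^sup>2))"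
    using D2i F2i by auto
  have G2i: "integrable ?L (\<lambda>x. (norm (G x))\<^sup>2)"
    by (rule Bochner_Integration.integrable_bound[OF bi]) (use G_le in \<open>auto elim!: eventually_mono\<close>)
  have GE: "(\<integral>x. (norm (G x))\<^sup>2 \<partial>?L) \<le> 2 / a0\<^sup>2 * (energy F ?B + M\<^sup>2 * energy Du ?B)"
  proof -
    have "(\<integral>x. (norm (G x))\<^sup>2 \<partial>?L) \<le> (\<integral>x. 2 / a0\<^sup>2 * ((norm (F x))\<^sup>2 + M\<^sup>2 * (norm (Du x))\<^sup>2) \<partial>?L)"
      by (rule integral_mono_AE[OF G2i bi G_le])
    then show ?thesis using D2i F2i by (simp add: energy_def)
  qed
  have aDi: "integrable ?L (\<lambda>x. a x *\<^sub>R Du x)"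
  proof (rule Bochner_Integration.integrable_bound[of _ "\<lambda>x. (a0 + M) *\<^sub>R Du x"])
    show "AE x in ?L. norm (a x *\<^sub>R Du x) \<le> norm ((a0 + M) *\<^sub>R Du x)"
      using M(1)
    proof eventually_elim
      case (elim x)
      then have "\<bar>a x\<bar> \<le> \<bar>a0 + M\<bar>" using a0 M(2) by linarith
      then show ?case by (simp add: mult_right_mono)
    qed
  qed (use Di in auto)
  have Gi: "integrable ?L G"
  proof -
    have "G = (\<lambda>x. (1 / a0) *\<^sub>R (- F x + (a0 *\<^sub>R Du x - a x *\<^sub>R Du x)))" by (simp add: G_def fun_eq_iff scaleR_diff_left)
    then show ?thesis using Fi Di aDi by simp
  qed
  obtain u' where u': "u' \<in> borel_measurable borel" "AE x in lebesgue. u' x = (if x \<in> ?B then u x else 0)"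
    using borel_representative[OF _ sets(1), of u] by auto
  obtain v where v: "v \<in> borel_measurable borel" "AE x in lebesgue. v x = (if x \<in> ?B then Du x else 0)"
    using borel_representative[OF _ sets(1), of Du] by auto
  obtain G' where G': "G' \<in> borel_measurable borel" "AE x in lebesgue. G' x = (if x \<in> ?B then G x else 0)"
    using borel_representative[OF _ sets(1), of G] by auto
  have sq: "(\<integral>z. w z \<bullet> w z \<partial>lborel) = (\<integral>x. (norm (h x))\<^sup>2 \<partial>?L)"
      "integrable lborel (\<lambda>z. w z \<bullet> w z) = integrable ?L (\<lambda>x. (norm (h x))\<^sup>2)" "integrable lborel w = integrable ?L h"
    if w: "w \<in> borel_measurable borel" "AE x in lebesgue. w x = (if x \<in> ?B then h x else 0)"
      and h[measurable]: "h \<in> borel_measurable ?L" for w h :: "'a \<Rightarrow> 'a"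
  proof -
    have "AE x in lebesgue. w x \<bullet> w x = (if x \<in> ?B then (norm (h x))\<^sup>2 else 0)"
      using w(2) by eventually_elim (simp add: power2_norm_eq_inner)
    then show "(\<integral>z. w z \<bullet> w z \<partial>lborel) = (\<integral>x. (norm (h x))\<^sup>2 \<partial>?L)"
      "integrable lborel (\<lambda>z. w z \<bullet> w z) = integrable ?L (\<lambda>x. (norm (h x))\<^sup>2)"
      using w(1) sets(1) by (intro lborel_lebesgue_on_transfer; simp)+
    show "integrable lborel w = integrable ?L h"
      by (rule lborel_lebesgue_on_transfer(2)[OF w sets(1) h])
  qed
  have main: "(\<integral>y. (v y \<bullet> v y) * indicator (ball x0 r) y \<partial>lborel) \<le>
     decay_const TYPE('a) * (r / R) ^ DIM('a) * (\<integral>z. v z \<bullet> v z \<partial>lborel) + 8 * (\<integral>z. G' z \<bullet> G' z \<partial>lborel)"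
  proof (rule constant_coefficient_decay[where U=u'])
    fix \<phi> and b :: 'a assume \<phi>: "\<phi> \<in> test_functions ?B" and b: "b \<in> Basis"
    note td = test_functionsD[OF \<phi>]
    have \<phi>\<Omega>: "\<phi> \<in> test_functions \<Omega>" using \<phi> test_functions_mono[OF B] by blast
    have [measurable]: "\<phi> \<in> borel_measurable borel" "grad \<phi> \<in> borel_measurable borel"
      using td(1,2) by (auto intro: borel_measurable_continuous_onI)
    have [measurable]: "\<phi> \<in> borel_measurable ?L" "grad \<phi> \<in> borel_measurable ?L"
      by (auto intro!: measurable_restrict_space1 measurable_completion)
    have "(\<integral>z. u' z * (grad \<phi> z \<bullet> b) \<partial>lborel) = (\<integral>z. u z * (grad \<phi> z \<bullet> b) \<partial>?L)"
      using u' sets(1) by (intro lborel_lebesgue_on_transfer) (auto elim!: eventually_mono)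
    also have "\<dots> = (\<integral>z. u z * (grad \<phi> z \<bullet> b) \<partial>lebesgue_on \<Omega>)"
      using td(4) by (intro integral_lebesgue_on_support[symmetric] B sets) auto
    also have "\<dots> = - (\<integral>z. (Du z \<bullet> b) * \<phi> z \<partial>lebesgue_on \<Omega>)"
      using wg \<phi>\<Omega> b by (simp add: weak_gradient_def)
    also have "(\<integral>z. (Du z \<bullet> b) * \<phi> z \<partial>lebesgue_on \<Omega>) = (\<integral>z. (Du z \<bullet> b) * \<phi> z \<partial>?L)"
      using td(3) by (intro integral_lebesgue_on_support B sets) auto
    also have "\<dots> = (\<integral>z. (v z \<bullet> b) * \<phi> z \<partial>lborel)"
      using v sets(1) by (intro lborel_lebesgue_on_transfer[symmetric]) (auto elim!: eventually_mono)
    finally show "(\<integral>z. u' z * (grad \<phi> z \<bullet> b) \<partial>lborel) = - (\<integral>z. (v z \<bullet> b) * \<phi> z \<partial>lborel)" .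
  next
    fix \<phi> assume \<phi>: "\<phi> \<in> test_functions ?B"
    note td = test_functionsD[OF \<phi>]
    have \<phi>\<Omega>: "\<phi> \<in> test_functions \<Omega>" using \<phi> test_functions_mono[OF B] by blast
    have [measurable]: "\<phi> \<in> borel_measurable borel" "grad \<phi> \<in> borel_measurable borel"
      using td(1,2) by (auto intro: borel_measurable_continuous_onI)
    have [measurable]: "\<phi> \<in> borel_measurable ?L" "grad \<phi> \<in> borel_measurable ?L"
      by (auto intro!: measurable_restrict_space1 measurable_completion)
    obtain C where C: "\<And>x. norm (grad \<phi> x) \<le> C" using td(5) by blast
    have ig: "integrable ?L (\<lambda>x. h x \<bullet> grad \<phi> x)" if h: "integrable ?L h" for h
    proof (rule Bochner_Integration.integrable_bound[of _ "\<lambda>x. C *\<^sub>R h x"])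
      show "integrable ?L (\<lambda>x. C *\<^sub>R h x)" using h by simp
      have [measurable]: "h \<in> borel_measurable ?L" using h by simp
      show "(\<lambda>x. h x \<bullet> grad \<phi> x) \<in> borel_measurable ?L" by measurable
      have "\<bar>h x \<bullet> grad \<phi> x\<bar> \<le> \<bar>C\<bar> * norm (h x)" for x
      proof -
        have "\<bar>h x \<bullet> grad \<phi> x\<bar> \<le> norm (h x) * norm (grad \<phi> x)" by (rule Cauchy_Schwarz_ineq2)
        also have "\<dots> \<le> norm (h x) * \<bar>C\<bar>" using C[of x] by (intro mult_left_mono) auto
        finally show ?thesis by (simp add: mult.commute)
      qed
      then show "AE x in ?L. norm (h x \<bullet> grad \<phi> x) \<le> norm (C *\<^sub>R h x)" by simp
    qed
    have e1: "(\<integral>x. a x * (Du x \<bullet> grad \<phi> x) \<partial>?L) = - (\<integral>x. F x \<bullet> grad \<phi> x \<partial>?L)"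
    proof -
      have "(\<integral>x. a x * (Du x \<bullet> grad \<phi> x) \<partial>lebesgue_on \<Omega>) = (\<integral>x. a x * (Du x \<bullet> grad \<phi> x) \<partial>?L)"
        "(\<integral>x. F x \<bullet> grad \<phi> x \<partial>lebesgue_on \<Omega>) = (\<integral>x. F x \<bullet> grad \<phi> x \<partial>?L)"
        using td(4) by (intro integral_lebesgue_on_support B sets; simp)+
      then show ?thesis using eq[OF \<phi>\<Omega>] by simp
    qed
    have "(\<integral>z. G' z \<bullet> grad \<phi> z \<partial>lborel) = (\<integral>z. G z \<bullet> grad \<phi> z \<partial>?L)"
      using G' sets(1) by (intro lborel_lebesgue_on_transfer) (auto elim!: eventually_mono)
    also have "\<dots> = (\<integral>z. (1 / a0) * (- (F z \<bullet> grad \<phi> z) + (a0 * (Du z \<bullet> grad \<phi> z) - a z * (Du z \<bullet> grad \<phi> z))) \<partial>?L)"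
      by (simp add: G_def inner_add_left inner_diff_left algebra_simps)
    also have "\<dots> = (1 / a0) * (- (\<integral>z. F z \<bullet> grad \<phi> z \<partial>?L) + (a0 * (\<integral>z. Du z \<bullet> grad \<phi> z \<partial>?L) -
        (\<integral>z. a z * (Du z \<bullet> grad \<phi> z) \<partial>?L)))"
      using ig[OF Fi] ig[OF Di] ig[OF aDi] by simp
    also have "\<dots> = (\<integral>z. Du z \<bullet> grad \<phi> z \<partial>?L)" using a0 by (simp add: e1)
    also have "\<dots> = (\<integral>z. v z \<bullet> grad \<phi> z \<partial>lborel)"
      using v sets(1) by (intro lborel_lebesgue_on_transfer[symmetric]) (auto elim!: eventually_mono)
    finally show "(\<integral>z. v z \<bullet> grad \<phi> z \<partial>lborel) = (\<integral>z. G' z \<bullet> grad \<phi> z \<partial>lborel)" ..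
  qed (use r sq[OF v] sq[OF G'] Di D2i Gi G2i in auto)
  have "(\<integral>y. (v y \<bullet> v y) * indicator (ball x0 r) y \<partial>lborel) = energy Du (ball x0 r)"
    unfolding energy_def
  proof (rule lborel_lebesgue_on_transfer)
    have sub: "ball x0 r \<subseteq> ?B" using r by auto
    show "AE y in lebesgue. (v y \<bullet> v y) * indicator (ball x0 r) y = (if y \<in> ball x0 r then (norm (Du y))\<^sup>2 else 0)"
      using v(2) by eventually_elim (use sub in \<open>auto simp: power2_norm_eq_inner\<close>)
    show "(\<lambda>x. (norm (Du x))\<^sup>2) \<in> borel_measurable (lebesgue_on (ball x0 r))"
      by (rule measurable_lebesgue_on_subset[OF _ sub]) measurable
    show "(\<lambda>y. (v y \<bullet> v y) * indicator (ball x0 r) y) \<in> borel_measurable borel"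
      using v(1) by (intro borel_measurable_times borel_measurable_inner borel_measurable_indicator) auto
  qed auto
  then have "energy Du (ball x0 r) \<le> decay_const TYPE('a) * (r / R) ^ DIM('a) * energy Du ?B + 8 * (\<integral>x. (norm (G x))\<^sup>2 \<partial>?L)"
    using main sq(1)[OF v] sq(1)[OF G' G] by (simp add: energy_def)
  also have "\<dots> \<le> decay_const TYPE('a) * (r / R) ^ DIM('a) * energy Du ?B + 8 * (2 / a0\<^sup>2 * (energy F ?B + M\<^sup>2 * energy Du ?B))"
    using GE by (intro add_left_mono mult_left_mono) auto
  finally show ?thesis by simp
qed

section \<open>Iteration over shrinking balls\<close>

text \<open>If \<open>\<phi> R \<le> A R powr lam\<close>, the step gives \<open>\<phi> (\<theta> R) \<le> (A / 2 + \<theta> powr (- lam) K) (\<theta> R) powr lam\<close>. The factor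
  \<open>1 / 2\<close> keeps the constant from growing once \<open>A \<ge> 2 \<theta> powr (- lam) K\<close>. Monotonicity fills in the radii
  between consecutive powers of \<open>\<theta>\<close>.\<close>

lemma geometric_iteration:
  fixes \<phi> :: "real \<Rightarrow> real"
  assumes \<theta>: "0 < \<theta>" "\<theta> < 1" and lam: "0 < lam" and R0: "0 < R0" and K: "0 \<le> K"
    and mono: "\<And>r R. 0 < r \<Longrightarrow> r \<le> R \<Longrightarrow> R \<le> R0 \<Longrightarrow> \<phi> r \<le> \<phi> R"
    and nonneg: "0 \<le> \<phi> R0"
    and step: "\<And>R. 0 < R \<Longrightarrow> R \<le> R0 \<Longrightarrow> \<phi> (\<theta> * R) \<le> \<theta> powr lam / 2 * \<phi> R + K * R powr lam"
    and r: "0 < r" "r \<le> R0"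
  shows "\<phi> r \<le> \<theta> powr (- lam) * (R0 powr (- lam) * \<phi> R0 + 2 * \<theta> powr (- lam) * K) * r powr lam"
proof -
  define A where "A = R0 powr (- lam) * \<phi> R0 + 2 * \<theta> powr (- lam) * K"
  have A0: "0 \<le> A" unfolding A_def using nonneg K by simp
  have A1: "K \<le> A * \<theta> powr lam / 2"
  proof -
    have "2 * \<theta> powr (- lam) * K \<le> A" using nonneg by (simp add: A_def)
    then have "2 * \<theta> powr (- lam) * K * \<theta> powr lam \<le> A * \<theta> powr lam" by (rule mult_right_mono) simp
    then show ?thesis using \<theta> by (simp add: powr_minus field_simps)
  qed
  have *: "\<phi> (\<theta> ^ k * R0) \<le> A * (\<theta> ^ k * R0) powr lam" for k
  proof (induction k)
    case 0
    have "\<phi> R0 = (R0 powr (- lam) * \<phi> R0) * R0 powr lam" using R0 by (simp add: powr_minus field_simps)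
    also have "\<dots> \<le> A * R0 powr lam" unfolding A_def using K by (intro mult_right_mono) auto
    finally show ?case by simp
  next
    case (Suc k)
    let ?x = "\<theta> ^ k * R0"
    have x: "0 < ?x" "?x \<le> R0" using \<theta> R0 by (auto simp: mult_le_cancel_right1 power_le_one)
    have "\<phi> (\<theta> * ?x) \<le> \<theta> powr lam / 2 * \<phi> ?x + K * ?x powr lam" by (rule step[OF x])
    also have "\<dots> \<le> \<theta> powr lam / 2 * (A * ?x powr lam) + A * \<theta> powr lam / 2 * ?x powr lam"
      using Suc A1 by (intro add_mono mult_left_mono mult_right_mono) auto
    also have "\<dots> = A * (\<theta> * ?x) powr lam"
      using \<theta> x by (simp add: powr_mult)
    finally show ?case by (simp add: mult.assoc)
  qed
  have "(\<lambda>k. \<theta> ^ k * R0) \<longlonglongrightarrow> 0 * R0"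
    using \<theta> by (intro tendsto_mult tendsto_const LIMSEQ_power_zero) auto
  then have "eventually (\<lambda>k. \<theta> ^ k * R0 < r) sequentially"
    using r by (intro order_tendstoD(2)) auto
  then obtain k where "\<theta> ^ k * R0 < r" by (auto simp: eventually_sequentially)
  then obtain n where n: "\<theta> ^ Suc n * R0 < r" "r \<le> \<theta> ^ n * R0"
  proof (induction k)
    case 0
    then show ?case using r by simp
  next
    case (Suc k)
    then show ?case by (cases "\<theta> ^ k * R0 < r") auto
  qed
  have x: "0 < \<theta> ^ n * R0" "\<theta> ^ n * R0 \<le> R0" using \<theta> R0 by (auto simp: mult_le_cancel_right1 power_le_one)
  have "\<phi> r \<le> \<phi> (\<theta> ^ n * R0)" by (rule mono[OF r(1) n(2) x(2)])
  also have "\<dots> \<le> A * (\<theta> ^ n * R0) powr lam" by (rule *)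
  also have "\<dots> \<le> A * (r / \<theta>) powr lam"
    using n x \<theta> lam A0 by (intro mult_left_mono powr_mono2) (auto simp: field_simps)
  also have "\<dots> = \<theta> powr (- lam) * A * r powr lam" 
    using \<theta> r powr_divide[of r \<theta> lam] by (simp add: powr_minus field_simps)
  finally show ?thesis by (simp add: A_def)
qed

lemma energy_mono:
  assumes "integrable (lebesgue_on T) (\<lambda>x. (norm (v x))\<^sup>2)" "S \<subseteq> T" "S \<in> sets lebesgue" "T \<in> sets lebesgue"
  shows "energy v S \<le> energy v T"
proof -
  have "(\<integral>x. indicator S x *\<^sub>R (norm (v x))\<^sup>2 \<partial>lebesgue) \<le> (\<integral>x. indicator T x *\<^sub>R (norm (v x))\<^sup>2 \<partial>lebesgue)"
  proof (rule integral_mono)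
    show "integrable lebesgue (\<lambda>x. indicator S x *\<^sub>R (norm (v x))\<^sup>2)" 
      using integrable_lebesgue_on_subset[OF assms] assms by (simp add: integrable_restrict_space)
    show "integrable lebesgue (\<lambda>x. indicator T x *\<^sub>R (norm (v x))\<^sup>2)"
      using assms by (simp add: integrable_restrict_space)
  qed (use assms(2) in \<open>auto simp: indicator_def\<close>)
  then show ?thesis using assms by (simp add: energy_def integral_restrict_space)
qed

lemma energy_nonneg: "0 \<le> energy v S"
  unfolding energy_def by (intro integral_nonneg_AE) auto

text \<open>Here \<open>\<gamma>\<close> stands for \<open>|g(x0)|\<close> and \<open>N\<close> for the concentration of \<open>F\<close> at \<open>x0\<close>. The ratio \<open>\<theta>\<close> of
  successive radii is chosen such that \<open>K \<theta> ^ d \<le> \<theta> powr lam / 4\<close> with a bound \<open>K\<close> for the decay constant, which is possible as \<open>lam < d\<close>.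
  The starting radius \<open>R0\<close> is chosen such that the oscillation of the coefficient contributes at most
  another \<open>\<theta> powr lam / 4\<close>. The constant does not depend on the solution or the coefficient.\<close>

lemma pointwise_morrey_bound:
  fixes a_low \<alpha> lam \<delta> :: real
  assumes par: "0 < a_low" "0 < \<alpha>" "0 < lam" "lam < DIM('a::euclidean_space)" "0 < \<delta>"
  obtains C where "0 < C"
    "\<And>\<Omega> a F u Du (x0::'a) \<gamma> N r. open \<Omega> \<Longrightarrow> weak_solution \<Omega> a F u Du \<Longrightarrow>
       a \<in> borel_measurable (lebesgue_on \<Omega>) \<Longrightarrow> ball x0 \<delta> \<subseteq> \<Omega> \<Longrightarrow> a_low \<le> a x0 \<Longrightarrow> 0 \<le> \<gamma> \<Longrightarrow> 0 \<le> N \<Longrightarrow>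
       AE y in lebesgue_on \<Omega>. \<bar>a x0 - a y\<bar> \<le> \<gamma> * norm (x0 - y) powr \<alpha> \<Longrightarrow>
       (\<And>\<rho>. 0 < \<rho> \<Longrightarrow> \<rho> \<le> \<delta> \<Longrightarrow> energy F (ball x0 \<rho>) \<le> N\<^sup>2 * \<rho> powr lam) \<Longrightarrow> 0 < r \<Longrightarrow>
       energy Du (ball x0 r \<inter> \<Omega>) \<le>
         (C * ((1 + \<gamma> powr (lam / (2 * \<alpha>))) * sqrt (energy Du \<Omega>) + N))\<^sup>2 * r powr lam"
proof -
  let ?d = "DIM('a)"
  define K where "K = decay_const TYPE('a) + 1"
  have K: "0 < K" "decay_const TYPE('a) \<le> K" using decay_const_nonneg[where 'a='a] by (auto simp: K_def)
  define \<theta> where "\<theta> = min (1 / 2) ((1 / (4 * K)) powr (1 / (?d - lam)))"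
  have \<theta>: "0 < \<theta>" "\<theta> \<le> 1 / 2" "\<theta> < 1" using K by (auto simp: \<theta>_def)
  have \<theta>K: "K * \<theta> ^ ?d \<le> \<theta> powr lam / 4"
  proof -
    have "\<theta> powr (?d - lam) \<le> ((1 / (4 * K)) powr (1 / (?d - lam))) powr (?d - lam)"
      using \<theta> par by (intro powr_mono2) (auto simp: \<theta>_def)
    also have "\<dots> = 1 / (4 * K)" using par K by (simp add: powr_powr)
    finally have "K * (\<theta> powr (?d - lam) * \<theta> powr lam) \<le> K * (1 / (4 * K) * \<theta> powr lam)"
      using K by (intro mult_left_mono mult_right_mono) auto
    then show ?thesis using \<theta> K by (simp flip: powr_add add: powr_realpow)
  qed
  \<comment> \<open>With this threshold, \<open>\<gamma> R powr \<alpha> \<le> \<kappa>\<close> makes the perturbation term at most \<open>\<theta> powr lam / 4\<close>.\<close>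
  define \<kappa> where "\<kappa> = a_low * \<theta> powr (lam / 2) / 8"
  have \<kappa>: "0 < \<kappa>" using par \<theta> by (simp add: \<kappa>_def)
  have \<kappa>2: "16 / a_low\<^sup>2 * \<kappa>\<^sup>2 = \<theta> powr lam / 4"
  proof -
    have "(\<theta> powr (lam / 2))\<^sup>2 = \<theta> powr lam" by (simp add: power2_eq_square flip: powr_add)
    then show ?thesis using par by (simp add: \<kappa>_def power_mult_distrib power_divide)
  qed
  define C1 where "C1 = \<theta> powr (- lam) * (\<delta> powr (- lam) + (1 / \<kappa>) powr (lam / \<alpha>))"
  define C2 where "C2 = \<theta> powr (- lam) * (2 * \<theta> powr (- lam) * (16 / a_low\<^sup>2))"
  have C12: "0 \<le> C1" "0 \<le> C2" using \<theta> by (auto simp: C1_def C2_def)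
  define C where "C = sqrt (C1 + C2 + 1)"
  have C: "0 < C" "C\<^sup>2 = C1 + C2 + 1" using C12 by (auto simp: C_def)
  show ?thesis
  proof (rule that[OF C(1)])
    fix \<Omega> a F u Du and x0 :: 'a and \<gamma> N r :: real
    assume \<Omega>: "open \<Omega>" and sol: "weak_solution \<Omega> a F u Du" and am: "a \<in> borel_measurable (lebesgue_on \<Omega>)"
      and B: "ball x0 \<delta> \<subseteq> \<Omega>" and al: "a_low \<le> a x0" and \<gamma>: "0 \<le> \<gamma>" and N: "0 \<le> N"
      and osc: "AE y in lebesgue_on \<Omega>. \<bar>a x0 - a y\<bar> \<le> \<gamma> * norm (x0 - y) powr \<alpha>"
      and FN: "\<And>\<rho>. 0 < \<rho> \<Longrightarrow> \<rho> \<le> \<delta> \<Longrightarrow> energy F (ball x0 \<rho>) \<le> N\<^sup>2 * \<rho> powr lam" and r: "0 < r"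
    have D2: "integrable (lebesgue_on \<Omega>) (\<lambda>x. (norm (Du x))\<^sup>2)"
      using sol Lp_2D(2) by (auto simp: weak_solution_def H1_gradient_def)
    define E where "E = energy Du \<Omega>"
    have E0: "0 \<le> E" by (simp add: E_def energy_nonneg)
    have subE: "energy Du S \<le> E" if "S \<subseteq> \<Omega>" "open S" for S
      unfolding E_def using that \<Omega> by (intro energy_mono D2) auto
    define R0 where "R0 = (if \<gamma> = 0 then \<delta> else min \<delta> ((\<kappa> / \<gamma>) powr (1 / \<alpha>)))"
    have R0: "0 < R0" "R0 \<le> \<delta>" using par \<kappa> \<gamma> by (auto simp: R0_def)
    have R0\<gamma>: "\<gamma> * R powr \<alpha> \<le> \<kappa>" if "0 < R" "R \<le> R0" for R
    proof (cases "\<gamma> = 0")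
      case False
      have "R powr \<alpha> \<le> ((\<kappa> / \<gamma>) powr (1 / \<alpha>)) powr \<alpha>"
        using that False par by (intro powr_mono2) (auto simp: R0_def)
      then have "R powr \<alpha> \<le> \<kappa> / \<gamma>" using par \<kappa> \<gamma> by (simp add: powr_powr)
      then show ?thesis using False \<gamma> by (simp add: field_simps)
    qed (use \<kappa> in simp)
    have R0inv: "R0 powr (- lam) \<le> \<delta> powr (- lam) + (\<gamma> / \<kappa>) powr (lam / \<alpha>)"
    proof (cases "R0 = \<delta>")
      case False
      then have g0: "\<gamma> > 0" and e: "R0 = (\<kappa> / \<gamma>) powr (1 / \<alpha>)" using \<gamma> by (auto simp: R0_def min_def split: if_splits)
      have "R0 powr (- lam) = (\<kappa> / \<gamma>) powr (- (lam / \<alpha>))" by (simp add: e powr_powr)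
      also have "\<dots> = (\<gamma> / \<kappa>) powr (lam / \<alpha>)" using \<kappa> g0 by (simp add: powr_minus powr_divide)
      finally show ?thesis by simp
    qed simp
    have step: "energy Du (ball x0 (\<theta> * R)) \<le> \<theta> powr lam / 2 * energy Du (ball x0 R) + (16 / a_low\<^sup>2 * N\<^sup>2) * R powr lam"
      if R: "0 < R" "R \<le> R0" for R
    proof -
      have sub: "ball x0 R \<subseteq> \<Omega>" using B R R0 by (meson order_trans subset_ball)
      have "AE y in lebesgue_on (ball x0 R). \<bar>a y - a x0\<bar> \<le> \<gamma> * R powr \<alpha>"
      proof -
        have "AE y in lebesgue. y \<in> \<Omega> \<longrightarrow> \<bar>a x0 - a y\<bar> \<le> \<gamma> * norm (x0 - y) powr \<alpha>"
          using osc \<Omega> by (simp add: AE_restrict_space_iff)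
        then have "AE y in lebesgue. y \<in> ball x0 R \<longrightarrow> \<bar>a y - a x0\<bar> \<le> \<gamma> * R powr \<alpha>"
        proof eventually_elim
          case (elim y)
          show ?case
          proof
            assume y: "y \<in> ball x0 R"
            then have "\<bar>a x0 - a y\<bar> \<le> \<gamma> * norm (x0 - y) powr \<alpha>" using elim sub by blast
            also have "\<dots> \<le> \<gamma> * R powr \<alpha>"
              using y \<gamma> par by (intro mult_left_mono powr_mono2) (auto simp: dist_norm)
            finally show "\<bar>a y - a x0\<bar> \<le> \<gamma> * R powr \<alpha>" by (simp add: abs_minus_commute)
          qed
        qed
        then show ?thesis by (simp add: AE_restrict_space_iff)
      qed
      from frozen_decay[OF \<Omega> sol am sub _ this, of "\<theta> * R"]
      have "energy Du (ball x0 (\<theta> * R)) \<le> decay_const TYPE('a) * \<theta> ^ ?d * energy Du (ball x0 R)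
         + 16 / (a x0)\<^sup>2 * (energy F (ball x0 R) + (\<gamma> * R powr \<alpha>)\<^sup>2 * energy Du (ball x0 R))"
        using par al \<gamma> R \<theta> by simp
      also have "\<dots> \<le> K * \<theta> ^ ?d * energy Du (ball x0 R)
         + 16 / a_low\<^sup>2 * (N\<^sup>2 * R powr lam + \<kappa>\<^sup>2 * energy Du (ball x0 R))"
        using K par al \<theta> FN R R0 R0\<gamma>[OF R] \<gamma>
        by (intro add_mono mult_mono mult_right_mono divide_left_mono power_mono mult_pos_pos zero_less_power)
           (auto simp: energy_nonneg)
      also have "\<dots> = (K * \<theta> ^ ?d + 16 / a_low\<^sup>2 * \<kappa>\<^sup>2) * energy Du (ball x0 R) + (16 / a_low\<^sup>2 * N\<^sup>2) * R powr lam"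
        by (simp add: algebra_simps)
      also have "\<dots> \<le> \<theta> powr lam / 2 * energy Du (ball x0 R) + (16 / a_low\<^sup>2 * N\<^sup>2) * R powr lam"
        using \<theta>K \<kappa>2 by (intro add_right_mono mult_right_mono) (auto simp: energy_nonneg)
      finally show ?thesis .
    qed
    have B0: "ball x0 R0 \<subseteq> \<Omega>" using B R0 by (meson order_trans subset_ball)
    define X where "X = \<theta> powr (- lam) * (R0 powr (- lam) * E + 2 * \<theta> powr (- lam) * (16 / a_low\<^sup>2 * N\<^sup>2))"
    have "energy Du (ball x0 r \<inter> \<Omega>) \<le> X * r powr lam"
    proof (cases "r \<le> R0")
      case True
      then have "energy Du (ball x0 r \<inter> \<Omega>) = energy Du (ball x0 r)"
        using B0 by (intro arg_cong[where f="energy Du"]) auto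
      also have "\<dots> \<le> \<theta> powr (- lam) * (R0 powr (- lam) * energy Du (ball x0 R0) + 2 * \<theta> powr (- lam) * (16 / a_low\<^sup>2 * N\<^sup>2)) * r powr lam"
      proof (rule geometric_iteration[OF \<theta>(1,3) par(3) R0(1) _ _ energy_nonneg step r True])
        fix r R :: real assume "r \<le> R" "R \<le> R0"
        moreover from this have "ball x0 R \<subseteq> \<Omega>" using B0 by (meson order_trans subset_ball)
        ultimately show "energy Du (ball x0 r) \<le> energy Du (ball x0 R)"
          using \<Omega> by (intro energy_mono integrable_lebesgue_on_subset[OF D2]) (auto intro: subset_ball)
      qed auto
      also have "\<dots> \<le> X * r powr lam"
        unfolding X_def using subE[OF B0] by (intro mult_right_mono mult_left_mono add_right_mono) auto
      finally show ?thesis .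
    next
      case False
      have "energy Du (ball x0 r \<inter> \<Omega>) \<le> E" using \<Omega> by (intro subE) auto
      also have "\<dots> = (R0 powr (- lam) * E) * R0 powr lam" using R0 by (simp add: powr_minus field_simps)
      also have "\<dots> \<le> (R0 powr (- lam) * E) * r powr lam"
        using False R0 par E0 by (intro mult_left_mono powr_mono2) auto
      also have "\<dots> \<le> X * r powr lam"
      proof (rule mult_right_mono)
        have "1 \<le> \<theta> powr (- lam)" using \<theta> par powr_mono'[of "- lam" 0 \<theta>] by simp
        then have "1 * (R0 powr (- lam) * E) \<le> \<theta> powr (- lam) * (R0 powr (- lam) * E + 2 * \<theta> powr (- lam) * (16 / a_low\<^sup>2 * N\<^sup>2))"
          using E0 by (intro mult_mono) auto
        then show "R0 powr (- lam) * E \<le> X" by (simp add: X_def)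
      qed simp
      finally show ?thesis .
    qed
    also have "\<dots> \<le> (C * ((1 + \<gamma> powr (lam / (2 * \<alpha>))) * sqrt E + N))\<^sup>2 * r powr lam"
    proof (rule mult_right_mono)
      let ?g = "\<gamma> powr (lam / (2 * \<alpha>))"
      have g2: "\<gamma> powr (lam / \<alpha>) = ?g\<^sup>2" by (simp add: power2_eq_square flip: powr_add)
      have "X \<le> \<theta> powr (- lam) * ((\<delta> powr (- lam) + (\<gamma> / \<kappa>) powr (lam / \<alpha>)) * E + 2 * \<theta> powr (- lam) * (16 / a_low\<^sup>2 * N\<^sup>2))"
        unfolding X_def using R0inv E0 by (intro mult_left_mono add_right_mono mult_right_mono) auto
      also have "\<dots> = \<theta> powr (- lam) * (\<delta> powr (- lam) + (\<gamma> / \<kappa>) powr (lam / \<alpha>)) * E + C2 * N\<^sup>2"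
        by (simp add: C2_def algebra_simps)
      also have "\<dots> \<le> C1 * (1 + ?g)\<^sup>2 * E + C2 * N\<^sup>2"
      proof (intro add_right_mono mult_right_mono E0)
        have "(\<gamma> / \<kappa>) powr (lam / \<alpha>) = (1 / \<kappa>) powr (lam / \<alpha>) * ?g\<^sup>2"
          using \<gamma> \<kappa> by (simp add: powr_divide g2)
        moreover have "?g\<^sup>2 \<le> (1 + ?g)\<^sup>2" "1 \<le> (1 + ?g)\<^sup>2" by (auto intro!: power_mono one_le_power)
        ultimately have "\<delta> powr (- lam) + (\<gamma> / \<kappa>) powr (lam / \<alpha>) \<le>
            \<delta> powr (- lam) * (1 + ?g)\<^sup>2 + (1 / \<kappa>) powr (lam / \<alpha>) * (1 + ?g)\<^sup>2"
          using mult_left_mono[of 1 "(1 + ?g)\<^sup>2" "\<delta> powr (- lam)"]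
            mult_left_mono[of "?g\<^sup>2" "(1 + ?g)\<^sup>2" "(1 / \<kappa>) powr (lam / \<alpha>)"] by simp
        then show "\<theta> powr (- lam) * (\<delta> powr (- lam) + (\<gamma> / \<kappa>) powr (lam / \<alpha>)) \<le> C1 * (1 + ?g)\<^sup>2"
          unfolding C1_def by (simp add: mult.assoc mult_left_mono distrib_right)
      qed
      also have "\<dots> \<le> C\<^sup>2 * ((1 + ?g)\<^sup>2 * E) + C\<^sup>2 * N\<^sup>2"
        using C12 E0 unfolding C(2) by (intro add_mono) (auto simp: mult.assoc intro!: mult_right_mono)
      also have "\<dots> = C\<^sup>2 * (((1 + ?g) * sqrt E)\<^sup>2 + N\<^sup>2)"
        using E0 by (simp only: power_mult_distrib distrib_left real_sqrt_pow2)
      also have "\<dots> \<le> C\<^sup>2 * ((1 + ?g) * sqrt E + N)\<^sup>2"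
      proof (rule mult_left_mono)
        have "0 \<le> ((1 + ?g) * sqrt E) * N" using N E0 by (intro mult_nonneg_nonneg) auto
        then show "((1 + ?g) * sqrt E)\<^sup>2 + N\<^sup>2 \<le> ((1 + ?g) * sqrt E + N)\<^sup>2" unfolding power2_sum by linarith
      qed simp
      finally show "X \<le> (C * ((1 + ?g) * sqrt E + N))\<^sup>2" by (simp add: power_mult_distrib)
    qed simp
    finally show "energy Du (ball x0 r \<inter> \<Omega>) \<le> (C * ((1 + \<gamma> powr (lam / (2 * \<alpha>))) * sqrt (energy Du \<Omega>) + N))\<^sup>2 * r powr lam"
      by (simp add: E_def)
  qed
qed

section \<open>Powers and Lebesgue norms\<close>

lemma epowr_real: "0 \<le> x \<Longrightarrow> ennreal x epowr t = ennreal (x powr t)"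
  by (simp add: epowr_def)

lemma epowr_mono: "x \<le> y \<Longrightarrow> 0 \<le> t \<Longrightarrow> x epowr t \<le> y epowr t"
  by (cases x; cases y) (auto simp: epowr_def top_unique intro!: ennreal_leI powr_mono2)

lemma epowr_top: "top epowr t = top"
  by (simp add: epowr_def)

lemma epowr_eq_0_iff: "x epowr t = 0 \<longleftrightarrow> x = 0"
  by (cases x) (auto simp: epowr_def)

text \<open>In the mixed cases this rests on \<open>0 * \<infinity> = 0\<close>, which both sides respect.\<close>

lemma epowr_mult: "(x * y) epowr t = (x epowr t) * (y epowr t)"
proof -
  have top: "(top * y) epowr t = (top epowr t) * (y epowr t)" for y
    using epowr_eq_0_iff[of 0 t] epowr_eq_0_iff[of y t]
    by (cases "y = 0") (auto simp: epowr_top ennreal_top_mult)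
  show ?thesis
  proof (cases x)
    case x: (real r)
    show ?thesis
    proof (cases y)
      case (real r')
      then show ?thesis using x by (simp add: epowr_real powr_mult flip: ennreal_mult)
    next
      case y: top
      show ?thesis using top[of x] unfolding y by (simp only: mult.commute)
    qed
  next
    case xt: top
    show ?thesis unfolding xt by (rule top)
  qed
qed

lemma epowr_epowr_inverse: "0 < p \<Longrightarrow> (x epowr p) epowr (1 / p) = x"
  by (cases x) (auto simp: epowr_def powr_powr)

text \<open>A crude substitute for convexity that holds for all positive exponents; it replaces Minkowski's inequality
  at the price of a constant.\<close>

lemma epowr_add_le:
  assumes "0 < t"
  shows "(x + y) epowr t \<le> ennreal (2 powr t) * (x epowr t + y epowr t)"
proof -
  have "x + y \<le> 2 * max x y"
    by (simp add: mult_2 add_mono)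
  then have "(x + y) epowr t \<le> (2 * max x y) epowr t" using assms by (intro epowr_mono) auto
  also have "\<dots> = ennreal (2 powr t) * (max x y epowr t)"
    using assms epowr_real[of 2 t] by (simp add: epowr_mult)
  also have "max x y epowr t \<le> x epowr t + y epowr t"
    by (auto simp: max_def)
  finally show ?thesis by (simp add: mult_left_mono)
qed

lemma epowr_measurable [measurable]:
  assumes [measurable]: "f \<in> borel_measurable M"
  shows "(\<lambda>x. f x epowr t) \<in> borel_measurable M"
  unfolding epowr_def by measurable

lemma AE_lebesgue_on_subset:
  assumes "AE x in lebesgue_on T. P x" "S \<subseteq> T" "S \<in> sets lebesgue" "T \<in> sets lebesgue"
  shows "AE x in lebesgue_on S. P x"
  using assms by (auto simp: AE_restrict_space_iff elim!: eventually_mono)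

lemma nn_integral_lebesgue_on_mono:
  assumes "S \<subseteq> T" "S \<in> sets lebesgue" "T \<in> sets lebesgue"
  shows "(\<integral>\<^sup>+x. f x \<partial>lebesgue_on S) \<le> (\<integral>\<^sup>+x. f x \<partial>lebesgue_on T)"
  using assms by (auto simp: nn_integral_restrict_space indicator_def intro!: nn_integral_mono)

lemma eLp_norm_sum_bound:
  fixes f h k :: "'a::euclidean_space \<Rightarrow> ennreal"
  assumes S: "S \<subseteq> T" "S \<in> sets lebesgue" "T \<in> sets lebesgue" and s: "1 \<le> s"
    and f: "f \<in> borel_measurable (lebesgue_on S)"
    and h[measurable]: "h \<in> borel_measurable (lebesgue_on T)" and k[measurable]: "k \<in> borel_measurable (lebesgue_on T)"
    and C: "0 < C" and le: "AE x in lebesgue_on S. f x \<le> ennreal C * (h x * e + k x)"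
  shows "eLp_norm S s f \<le> ennreal (4 * C) * (eLp_norm T s h * e + eLp_norm T s k)"
proof (cases "s = \<infinity>")
  case True
  have "AE x in lebesgue_on S. h x \<le> esssup (lebesgue_on T) h" "AE x in lebesgue_on S. k x \<le> esssup (lebesgue_on T) k"
    by (rule AE_lebesgue_on_subset[OF esssup_AE S])+
  then have "AE x in lebesgue_on S. f x \<le> ennreal (4 * C) * (esssup (lebesgue_on T) h * e + esssup (lebesgue_on T) k)"
    using le
  proof eventually_elim
    case (elim x)
    have "f x \<le> ennreal C * (h x * e + k x)" by (rule elim)
    also have "\<dots> \<le> ennreal (4 * C) * (esssup (lebesgue_on T) h * e + esssup (lebesgue_on T) k)"
      using C elim by (intro mult_mono add_mono ennreal_leI) auto
    finally show ?case .
  qed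
  then show ?thesis using True f by (auto simp: eLp_norm_def intro!: esssup_I)
next
  case False
  define p where "p = enn2real s"
  have p: "1 \<le> p" using s False by (cases s) (auto simp: p_def)
  let ?X = "\<integral>\<^sup>+x. h x epowr p \<partial>lebesgue_on T" and ?Y = "\<integral>\<^sup>+x. k x epowr p \<partial>lebesgue_on T"
  have "(\<integral>\<^sup>+x. f x epowr p \<partial>lebesgue_on S) \<le>
     (\<integral>\<^sup>+x. ennreal ((2 * C) powr p) * ((h x epowr p) * (e epowr p) + k x epowr p) \<partial>lebesgue_on S)"
  proof (rule nn_integral_mono_AE, use le in eventually_elim)
    case (elim x)
    have "f x epowr p \<le> (ennreal C * (h x * e + k x)) epowr p" using elim p by (intro epowr_mono) auto
    also have "\<dots> = ennreal (C powr p) * ((h x * e + k x) epowr p)"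
      using C p by (simp add: epowr_mult epowr_real)
    also have "\<dots> \<le> ennreal (C powr p) * (ennreal (2 powr p) * ((h x * e) epowr p + k x epowr p))"
      using p by (intro mult_left_mono epowr_add_le) auto
    also have "\<dots> = ennreal ((2 * C) powr p) * ((h x epowr p) * (e epowr p) + k x epowr p)"
      using C p by (simp add: epowr_mult powr_mult ennreal_mult mult_ac)
    finally show ?case .
  qed
  also have "\<dots> \<le> (\<integral>\<^sup>+x. ennreal ((2 * C) powr p) * ((h x epowr p) * (e epowr p) + k x epowr p) \<partial>lebesgue_on T)"
    by (rule nn_integral_lebesgue_on_mono[OF S])
  also have "\<dots> = ennreal ((2 * C) powr p) * (?X * (e epowr p) + ?Y)"
    by (simp add: nn_integral_cmult nn_integral_add nn_integral_multc)
  finally have 1: "(\<integral>\<^sup>+x. f x epowr p \<partial>lebesgue_on S) \<le> ennreal ((2 * C) powr p) * (?X * (e epowr p) + ?Y)" .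
  have "eLp_norm S s f \<le> (ennreal ((2 * C) powr p) * (?X * (e epowr p) + ?Y)) epowr (1 / p)"
    using False p by (simp add: eLp_norm_def flip: p_def) (intro epowr_mono 1, simp)
  also have "\<dots> = ennreal (2 * C) * ((?X * (e epowr p) + ?Y) epowr (1 / p))"
    using p C by (simp add: epowr_mult epowr_real powr_powr)
  also have "\<dots> \<le> ennreal (2 * C) * (ennreal (2 powr (1 / p)) * ((?X * (e epowr p)) epowr (1 / p) + ?Y epowr (1 / p)))"
    using p by (intro mult_left_mono epowr_add_le) auto
  also have "\<dots> = ennreal (2 * C) * (ennreal (2 powr (1 / p)) * (eLp_norm T s h * e + eLp_norm T s k))"
    using False p by (simp add: eLp_norm_def epowr_mult epowr_epowr_inverse flip: p_def)
  also have "\<dots> \<le> ennreal (2 * C) * (ennreal 2 * (eLp_norm T s h * e + eLp_norm T s k))"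
    using p powr_mono[of "1 / p" 1 2] by (intro mult_left_mono mult_right_mono ennreal_leI) auto
  also have "\<dots> = ennreal (4 * C) * (eLp_norm T s h * e + eLp_norm T s k)"
  proof -
    have "ennreal (2 * C) * ennreal 2 = ennreal (4 * C)"
      using C by (subst ennreal_mult[symmetric]) auto
    then show ?thesis by (simp only: mult.assoc[symmetric])
  qed
  finally show ?thesis .
qed

text \<open>For finite \<open>q\<close>, put \<open>T = 1 + \<parallel>g\<parallel>\<close> with the norm of exponent \<open>Q\<close> and let \<open>p\<close> be the outer exponent. Since \<open>p \<beta> \<le> Q\<close>,
  \<open>(|g| / T) powr (p \<beta>) \<le> 1 + (|g| / T) powr Q\<close>, and the last term has integral at most \<open>1\<close>. This gives the
  bound with the right homogeneity in \<open>T\<close> without Hoelder's inequality.\<close>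

lemma weight_norm_bound:
  fixes \<Omega> :: "'a::euclidean_space set"
  assumes \<Omega>: "\<Omega> \<in> lmeasurable" and par: "0 < \<beta>" "1 \<le> q" "1 \<le> s"
    and fin: "q \<noteq> \<infinity> \<Longrightarrow> s \<noteq> \<infinity> \<and> enn2real s * \<beta> \<le> enn2real q"
  shows "\<exists>C>0. \<forall>g::'a \<Rightarrow> real. g \<in> Lp \<Omega> q \<longrightarrow>
     eLp_norm \<Omega> s (\<lambda>x. 1 + ennreal (\<bar>g x\<bar> powr \<beta>)) \<le> ennreal C * (1 + Lp_norm \<Omega> q g epowr \<beta>)"
proof -
  have fm: "emeasure (lebesgue_on \<Omega>) \<Omega> = ennreal (measure lebesgue \<Omega>)"
    using \<Omega> by (simp add: emeasure_restrict_space emeasure_eq_measure2 fmeasurableD)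
  define m\<Omega> where "m\<Omega> = measure lebesgue \<Omega>"
  have m\<Omega>: "0 \<le> m\<Omega>" by (simp add: m\<Omega>_def)
  have meas: "(\<lambda>x. 1 + ennreal (\<bar>g x\<bar> powr \<beta>)) \<in> borel_measurable (lebesgue_on \<Omega>)" if "g \<in> Lp \<Omega> q" for g :: "'a \<Rightarrow> real"
  proof -
    have [measurable]: "g \<in> borel_measurable (lebesgue_on \<Omega>)" using that by (simp add: Lp_def)
    show ?thesis by measurable
  qed
  show ?thesis
  proof (cases "q = \<infinity>")
    case True
    have bound: "AE x in lebesgue_on \<Omega>. 1 + ennreal (\<bar>g x\<bar> powr \<beta>) \<le> 1 + Lp_norm \<Omega> q g epowr \<beta>" if "g \<in> Lp \<Omega> q" for g :: "'a \<Rightarrow> real"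
    proof -
      have "AE x in lebesgue_on \<Omega>. ennreal \<bar>g x\<bar> \<le> Lp_norm \<Omega> q g"
        unfolding Lp_norm_def eLp_norm_def using True esssup_AE[of "\<lambda>x. ennreal \<bar>g x\<bar>" "lebesgue_on \<Omega>"] by simp
      then show ?thesis
      proof eventually_elim
        case (elim x)
        have "ennreal (\<bar>g x\<bar> powr \<beta>) \<le> Lp_norm \<Omega> q g epowr \<beta>"
          using epowr_mono[OF elim, of \<beta>] par by (simp add: epowr_real)
        then show ?case by (intro add_left_mono)
      qed
    qed
    show ?thesis
    proof (cases "s = \<infinity>")
      case s: True
      show ?thesis
        by (intro exI[of _ 1]) (auto simp: eLp_norm_def s intro!: esssup_I meas bound)
    next
      case False
      define p where "p = enn2real s"
      have p: "1 \<le> p" using par False by (cases s) (auto simp: p_def)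
      show ?thesis
      proof (intro exI[of _ "(m\<Omega> + 1) powr (1 / p)"] conjI allI impI)
        fix g :: "'a \<Rightarrow> real" assume g: "g \<in> Lp \<Omega> q"
        let ?A = "1 + Lp_norm \<Omega> q g epowr \<beta>"
        have "(\<integral>\<^sup>+x. (1 + ennreal (\<bar>g x\<bar> powr \<beta>)) epowr p \<partial>lebesgue_on \<Omega>) \<le> (\<integral>\<^sup>+x. ?A epowr p \<partial>lebesgue_on \<Omega>)"
          using bound[OF g] p by (intro nn_integral_mono_AE) (auto elim!: eventually_mono intro!: epowr_mono)
        also have "\<dots> = (?A epowr p) * ennreal m\<Omega>" by (simp add: fm m\<Omega>_def)
        also have "\<dots> \<le> (?A epowr p) * ennreal (m\<Omega> + 1)" by (intro mult_left_mono ennreal_leI) auto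
        finally have 1: "(\<integral>\<^sup>+x. (1 + ennreal (\<bar>g x\<bar> powr \<beta>)) epowr p \<partial>lebesgue_on \<Omega>) \<le> (?A epowr p) * ennreal (m\<Omega> + 1)" .
        have "eLp_norm \<Omega> s (\<lambda>x. 1 + ennreal (\<bar>g x\<bar> powr \<beta>)) \<le> ((?A epowr p) * ennreal (m\<Omega> + 1)) epowr (1 / p)"
          using False p by (simp add: eLp_norm_def flip: p_def) (intro epowr_mono 1, simp)
        also have "\<dots> = ennreal ((m\<Omega> + 1) powr (1 / p)) * ?A"
          using p m\<Omega> by (simp add: epowr_mult epowr_epowr_inverse epowr_real mult.commute del: ennreal_plus)
        finally show "eLp_norm \<Omega> s (\<lambda>x. 1 + ennreal (\<bar>g x\<bar> powr \<beta>)) \<le> ennreal ((m\<Omega> + 1) powr (1 / p)) * ?A" .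
      qed (use m\<Omega> in auto)
    qed
  next
    case False
    define p where "p = enn2real s"
    define Q where "Q = enn2real q"
    have sfin: "s \<noteq> \<infinity>" and pQ: "p * \<beta> \<le> Q" using fin[OF False] by (auto simp: p_def Q_def)
    have p: "1 \<le> p" using par sfin by (cases s) (auto simp: p_def)
    have Q: "1 \<le> Q" using par False by (cases q) (auto simp: Q_def)
    define C where "C = 2 * (2 * m\<Omega> + 1) powr (1 / p) * 2 powr \<beta>"
    show ?thesis
    proof (intro exI[of _ C] conjI allI impI)
      show "0 < C" using m\<Omega> by (simp add: C_def)
      fix g :: "'a \<Rightarrow> real" assume g: "g \<in> Lp \<Omega> q"
      have [measurable]: "g \<in> borel_measurable (lebesgue_on \<Omega>)" using g by (simp add: Lp_def)
      obtain m where m: "Lp_norm \<Omega> q g = ennreal m" "0 \<le> m"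
        using g by (cases "Lp_norm \<Omega> q g") (auto simp: Lp_def)
      define T where "T = 1 + m"
      have T: "1 \<le> T" "m \<le> T" using m by (auto simp: T_def)
      have I: "(\<integral>\<^sup>+x. ennreal (\<bar>g x\<bar> powr Q) \<partial>lebesgue_on \<Omega>) = ennreal (m powr Q)"
      proof -
        let ?I = "\<integral>\<^sup>+x. ennreal (\<bar>g x\<bar> powr Q) \<partial>lebesgue_on \<Omega>"
        have "?I epowr (1 / Q) = ennreal m"
          using m False by (simp add: Lp_norm_def eLp_norm_def epowr_real flip: Q_def)
        then have "(?I epowr (1 / Q)) epowr Q = ennreal (m powr Q)" using m by (simp add: epowr_real)
        then show ?thesis using epowr_epowr_inverse[of "1 / Q" ?I] Q by simp
      qed
      have pt: "(1 + ennreal (\<bar>g x\<bar> powr \<beta>)) epowr p \<le>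
          ennreal (2 powr p * 2 * T powr (\<beta> * p)) + ennreal (2 powr p * T powr (\<beta> * p) / T powr Q) * ennreal (\<bar>g x\<bar> powr Q)" for x
      proof -
        define y where "y = \<bar>g x\<bar> / T"
        have y: "0 \<le> y" using T by (simp add: y_def)
        have "y powr (\<beta> * p) \<le> 1 + y powr Q"
        proof (cases "y \<le> 1")
          case True
          then have "y powr (\<beta> * p) \<le> 1" using y par p by (intro powr_le1) auto
          then show ?thesis by (simp add: add_increasing2)
        next
          case False
          then have "y powr (\<beta> * p) \<le> y powr Q" using pQ by (intro powr_mono) (auto simp: mult.commute)
          then show ?thesis by simp
        qed
        then have "T powr (\<beta> * p) * y powr (\<beta> * p) \<le> T powr (\<beta> * p) * (1 + y powr Q)" by (rule mult_left_mono) simp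
        then have 1: "\<bar>g x\<bar> powr (\<beta> * p) \<le> T powr (\<beta> * p) * (1 + \<bar>g x\<bar> powr Q / T powr Q)"
          using T by (simp add: y_def powr_divide)
        have "1 \<le> T powr (\<beta> * p)" using T par p by (intro ge_one_powr_ge_zero) auto
        then have 2: "1 + \<bar>g x\<bar> powr (\<beta> * p) \<le> 2 * T powr (\<beta> * p) + T powr (\<beta> * p) / T powr Q * \<bar>g x\<bar> powr Q"
          using 1 by (simp add: algebra_simps)
        have "(1 + ennreal (\<bar>g x\<bar> powr \<beta>)) epowr p \<le> ennreal (2 powr p) * (1 epowr p + ennreal (\<bar>g x\<bar> powr \<beta>) epowr p)"
          using p by (intro epowr_add_le) auto
        also have "\<dots> = ennreal (2 powr p * (1 + \<bar>g x\<bar> powr (\<beta> * p)))"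
          using epowr_real[of 1 p] by (simp add: epowr_real powr_powr ennreal_mult)
        also have "\<dots> \<le> ennreal (2 powr p * (2 * T powr (\<beta> * p) + T powr (\<beta> * p) / T powr Q * \<bar>g x\<bar> powr Q))"
          using 2 by (intro ennreal_leI mult_left_mono) auto
        also have "\<dots> = ennreal (2 powr p * 2 * T powr (\<beta> * p)) + ennreal (2 powr p * T powr (\<beta> * p) / T powr Q) * ennreal (\<bar>g x\<bar> powr Q)"
          by (simp add: algebra_simps flip: ennreal_plus ennreal_mult del: ennreal_plus)
        finally show ?thesis .
      qed
      have "(\<integral>\<^sup>+x. (1 + ennreal (\<bar>g x\<bar> powr \<beta>)) epowr p \<partial>lebesgue_on \<Omega>) \<le>
        (\<integral>\<^sup>+x. ennreal (2 powr p * 2 * T powr (\<beta> * p)) + ennreal (2 powr p * T powr (\<beta> * p) / T powr Q) * ennreal (\<bar>g x\<bar> powr Q) \<partial>lebesgue_on \<Omega>)"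
        by (intro nn_integral_mono pt)
      also have "\<dots> = ennreal (2 powr p * 2 * T powr (\<beta> * p)) * ennreal m\<Omega> +
          ennreal (2 powr p * T powr (\<beta> * p) / T powr Q) * ennreal (m powr Q)"
        by (subst nn_integral_add) (auto simp: nn_integral_cmult I fm m\<Omega>_def)
      also have "\<dots> = ennreal (2 powr p * 2 * T powr (\<beta> * p) * m\<Omega> + 2 powr p * T powr (\<beta> * p) / T powr Q * m powr Q)"
        using m\<Omega> by (simp flip: ennreal_plus ennreal_mult del: ennreal_plus)
      also have "\<dots> \<le> ennreal (2 powr p * T powr (\<beta> * p) * (2 * m\<Omega> + 1))"
      proof (rule ennreal_leI)
        have "m powr Q / T powr Q \<le> 1" using m T Q by (simp add: divide_le_eq powr_mono2)
        then have "2 powr p * T powr (\<beta> * p) * (m powr Q / T powr Q) \<le> 2 powr p * T powr (\<beta> * p) * 1"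
          by (intro mult_left_mono) auto
        then show "2 powr p * 2 * T powr (\<beta> * p) * m\<Omega> + 2 powr p * T powr (\<beta> * p) / T powr Q * m powr Q
          \<le> 2 powr p * T powr (\<beta> * p) * (2 * m\<Omega> + 1)" by (simp add: algebra_simps)
      qed
      finally have 1: "(\<integral>\<^sup>+x. (1 + ennreal (\<bar>g x\<bar> powr \<beta>)) epowr p \<partial>lebesgue_on \<Omega>) \<le>
        ennreal (2 powr p * T powr (\<beta> * p) * (2 * m\<Omega> + 1))" .
      have "eLp_norm \<Omega> s (\<lambda>x. 1 + ennreal (\<bar>g x\<bar> powr \<beta>)) \<le> (ennreal (2 powr p * T powr (\<beta> * p) * (2 * m\<Omega> + 1))) epowr (1 / p)"
        using sfin p by (simp add: eLp_norm_def flip: p_def) (intro epowr_mono 1, simp)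
      also have "\<dots> = ennreal (2 * T powr \<beta> * (2 * m\<Omega> + 1) powr (1 / p))"
        using m\<Omega> T p by (simp add: epowr_real powr_mult powr_powr)
      also have "\<dots> \<le> ennreal (C * (1 + m powr \<beta>))"
      proof (rule ennreal_leI)
        have "T powr \<beta> \<le> (2 * max 1 m) powr \<beta>" using m par by (intro powr_mono2) (auto simp: T_def)
        also have "\<dots> = 2 powr \<beta> * max 1 m powr \<beta>" by (simp add: powr_mult)
        also have "\<dots> \<le> 2 powr \<beta> * (1 + m powr \<beta>)" by (intro mult_left_mono) (auto simp: max_def)
        finally have "(2 * (2 * m\<Omega> + 1) powr (1 / p)) * T powr \<beta> \<le> (2 * (2 * m\<Omega> + 1) powr (1 / p)) * (2 powr \<beta> * (1 + m powr \<beta>))"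
          by (rule mult_left_mono) simp
        then show "2 * T powr \<beta> * (2 * m\<Omega> + 1) powr (1 / p) \<le> C * (1 + m powr \<beta>)" by (simp add: C_def mult_ac)
      qed
      also have "\<dots> = ennreal C * (1 + Lp_norm \<Omega> q g epowr \<beta>)"
        using \<open>0 < C\<close> m by (simp add: epowr_real ennreal_mult)
      finally show "eLp_norm \<Omega> s (\<lambda>x. 1 + ennreal (\<bar>g x\<bar> powr \<beta>)) \<le> ennreal C * (1 + Lp_norm \<Omega> q g epowr \<beta>)" .
    qed
  qed
qed

section \<open>Concentration functions\<close>

lemma Lp_norm_energy:
  assumes "integrable (lebesgue_on S) (\<lambda>x. (norm (v x))\<^sup>2)"
  shows "Lp_norm S 2 v = ennreal (sqrt (energy v S))"
proof -
  have "(\<integral>\<^sup>+x. ennreal (norm (v x)) epowr 2 \<partial>lebesgue_on S) = ennreal (energy v S)"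
    using assms unfolding energy_def by (simp add: epowr_2 nn_integral_eq_integral)
  then show ?thesis
    by (simp add: Lp_norm_def eLp_norm_def epowr_real energy_nonneg powr_half_sqrt)
qed

lemma Lp_norm_ball_energy:
  assumes v: "v \<in> Lp D 2" and D: "open D"
  shows "Lp_norm (ball x r \<inter> D) 2 v = ennreal (sqrt (energy v (ball x r \<inter> D)))"
  using D by (intro Lp_norm_energy integrable_lebesgue_on_subset[OF Lp_2D(2)[OF v]]) auto

lemma concentration_eq:
  assumes v: "v \<in> Lp D 2" and D: "open D"
  shows "concentration D 2 l v x = (SUP r\<in>{0<..}. ennreal (r powr (- l / 2) * sqrt (energy v (ball x r \<inter> D))))"
  using Lp_norm_ball_energy[OF v D]
  by (simp add: concentration_def ennreal_mult energy_nonneg)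

text \<open>A slightly larger ball about any nearby centre contains the original ball, so the concentration function is
  lower semicontinuous.\<close>

lemma concentration_measurable:
  fixes v :: "'a::euclidean_space \<Rightarrow> 'b::real_normed_vector"
  assumes v: "v \<in> Lp D 2" and D: "open D"
  shows "concentration D 2 l v \<in> borel_measurable (lebesgue_on D)"
proof -
  have "open {x. c < concentration D 2 l v x}" for c
  proof (subst open_contains_ball, intro ballI)
    fix x assume "x \<in> {x. c < concentration D 2 l v x}"
    then obtain r where r: "0 < r" and c: "c < ennreal (r powr (- l / 2) * sqrt (energy v (ball x r \<inter> D)))"
      by (auto simp: concentration_eq[OF v D] less_SUP_iff)
    let ?e = "sqrt (energy v (ball x r \<inter> D))"
    obtain c' where c': "c = ennreal c'" "0 \<le> c'" "c' < r powr (- l / 2) * ?e"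
      using c by (cases c) (auto simp: ennreal_less_iff)
    have "((\<lambda>r. r powr (- l / 2) * ?e) \<longlongrightarrow> r powr (- l / 2) * ?e) (at_right r)"
      using r by (intro tendsto_intros) auto
    then have "eventually (\<lambda>r. c' < r powr (- l / 2) * ?e) (at_right r)"
      using c'(3) by (rule order_tendstoD)
    then obtain b where b: "r < b" "\<And>y. r < y \<Longrightarrow> y < b \<Longrightarrow> c' < y powr (- l / 2) * ?e"
      by (auto simp: eventually_at_right_field)
    \<comment> \<open>Any radius between \<open>r\<close> and \<open>b\<close> still beats \<open>c\<close>, and leaves room \<open>r' - r\<close> to move the centre.\<close>
    define r' where "r' = (r + b) / 2"
    have r': "r < r'" "0 < r'" and c2: "c' < r' powr (- l / 2) * ?e" using b r by (auto simp: r'_def)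
    have "ball x (r' - r) \<subseteq> {x. c < concentration D 2 l v x}"
    proof
      fix y assume y: "y \<in> ball x (r' - r)"
      have sub: "ball x r \<subseteq> ball y r'"
      proof
        fix z assume "z \<in> ball x r"
        then show "z \<in> ball y r'" using y dist_triangle[of y z x] by (simp add: dist_commute)
      qed
      have "?e \<le> sqrt (energy v (ball y r' \<inter> D))"
        using D sub by (intro real_sqrt_le_mono energy_mono integrable_lebesgue_on_subset[OF Lp_2D(2)[OF v]]) auto
      then have "r' powr (- l / 2) * ?e \<le> r' powr (- l / 2) * sqrt (energy v (ball y r' \<inter> D))"
        by (rule mult_left_mono) simp
      then have "c < ennreal (r' powr (- l / 2) * sqrt (energy v (ball y r' \<inter> D)))"
        using c2 c' by (simp add: ennreal_less_iff)
      also have "\<dots> \<le> concentration D 2 l v y"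
        unfolding concentration_eq[OF v D] using r' by (intro SUP_upper) auto
      finally show "y \<in> {x. c < concentration D 2 l v x}" by simp
    qed
    then show "\<exists>e>0. ball x e \<subseteq> {x. c < concentration D 2 l v x}" using r' by (intro exI[of _ "r' - r"]) auto
  qed
  then have "concentration D 2 l v \<in> borel_measurable borel"
    by (intro borel_measurableI_greater) auto
  then show ?thesis by (intro measurable_restrict_space1 measurable_completion) simp
qed

lemma energy_le_concentration:
  assumes v: "v \<in> Lp D 2" and D: "open D" and N: "concentration D 2 l v x = ennreal N" "0 \<le> N"
    and r: "0 < r" "ball x r \<subseteq> D"
  shows "energy v (ball x r) \<le> N\<^sup>2 * r powr l"
proof -
  have "ennreal (r powr (- l / 2) * sqrt (energy v (ball x r \<inter> D))) \<le> ennreal N"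
    using r(1) unfolding N(1)[symmetric] concentration_eq[OF v D] by (intro SUP_upper) auto
  then have "r powr (- l / 2) * sqrt (energy v (ball x r \<inter> D)) \<le> N"
    using N by (simp add: ennreal_le_iff)
  moreover have "ball x r \<inter> D = ball x r" using r by auto
  ultimately have "(r powr (- l / 2) * sqrt (energy v (ball x r))) \<^sup>2 \<le> N\<^sup>2"
    using energy_nonneg by (intro power_mono) (auto simp: energy_nonneg)
  then have "r powr (- l) * energy v (ball x r) \<le> N\<^sup>2"
    by (simp add: power_mult_distrib energy_nonneg) (simp add: power2_eq_square flip: powr_add)
  then have "r powr l * (r powr (- l) * energy v (ball x r)) \<le> r powr l * N\<^sup>2" by (rule mult_left_mono) simp
  then show ?thesis using r by (simp add: powr_minus field_simps)
qed

lemma concentration_le: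
  assumes v: "v \<in> Lp \<Omega> 2" and sub: "D \<subseteq> \<Omega>" "open D" "open \<Omega>" and N: "0 \<le> N"
    and le: "\<And>r. 0 < r \<Longrightarrow> energy v (ball x r \<inter> \<Omega>) \<le> N\<^sup>2 * r powr l"
    and vD: "v \<in> Lp D 2"
  shows "concentration D 2 l v x \<le> ennreal N"
  unfolding concentration_eq[OF vD sub(2)]
proof (intro SUP_least ennreal_leI)
  fix r :: real assume "r \<in> {0<..}"
  then have r: "0 < r" by simp
  have "energy v (ball x r \<inter> D) \<le> energy v (ball x r \<inter> \<Omega>)"
    using sub by (intro energy_mono integrable_lebesgue_on_subset[OF Lp_2D(2)[OF v]]) auto
  also have "\<dots> \<le> N\<^sup>2 * r powr l" by (rule le[OF r])
  also have "\<dots> = (N * r powr (l / 2))\<^sup>2" by (simp add: power_mult_distrib) (simp add: power2_eq_square flip: powr_add)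
  finally have "sqrt (energy v (ball x r \<inter> D)) \<le> N * r powr (l / 2)"
    using N by (intro real_le_lsqrt) (auto simp: energy_nonneg)
  then have "r powr (- l / 2) * sqrt (energy v (ball x r \<inter> D)) \<le> r powr (- l / 2) * (N * r powr (l / 2))"
    by (rule mult_left_mono) simp
  also have "\<dots> = N" using r by (simp add: powr_minus field_simps)
  finally show "r powr (- l / 2) * sqrt (energy v (ball x r \<inter> D)) \<le> N" .
qed

lemma Lp_2_subset:
  assumes "v \<in> Lp T 2" "S \<subseteq> T" "S \<in> sets lebesgue" "T \<in> sets lebesgue"
  shows "v \<in> Lp S 2"
proof -
  have "integrable (lebesgue_on S) (\<lambda>x. (norm (v x))\<^sup>2)"
    by (rule integrable_lebesgue_on_subset[OF Lp_2D(2)[OF assms(1)] assms(2-)])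
  from Lp_norm_energy[OF this] show ?thesis
    using measurable_lebesgue_on_subset[OF Lp_2D(1)[OF assms(1)] assms(2)] by (simp add: Lp_def)
qed

section \<open>From the pointwise bound to the norm estimate\<close>

lemma AE_product_sections:
  fixes \<Omega> :: "'a::euclidean_space set"
  assumes "open \<Omega>" "AE (x, y) in lebesgue_on (\<Omega> \<times> \<Omega>). P x y"
  shows "AE x in lebesgue_on \<Omega>. AE y in lebesgue_on \<Omega>. P x y"
proof -
  have "AE z in lebesgue. z \<in> \<Omega> \<times> \<Omega> \<longrightarrow> (case z of (x, y) \<Rightarrow> P x y)"
    using assms by (subst (asm) AE_restrict_space_iff) (auto intro!: lmeasurable_open borel_open open_Times simp: sets_completionI_sets)
  then have "AE z in lborel \<Otimes>\<^sub>M lborel. z \<in> \<Omega> \<times> \<Omega> \<longrightarrow> (case z of (x, y) \<Rightarrow> P x y)"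
    unfolding lborel_prod by (simp only: AE_completion_iff)
  then have "AE x in lborel. AE y in lborel. (x, y) \<in> \<Omega> \<times> \<Omega> \<longrightarrow> P x y"
    by (drule_tac lborel_pair.AE_pair) simp
  then have "AE x in lebesgue. x \<in> \<Omega> \<longrightarrow> (AE y in lebesgue_on \<Omega>. P x y)"
    using assms(1) by (auto simp: AE_completion_iff AE_restrict_space_iff elim!: eventually_mono)
  then show ?thesis using assms(1) by (simp add: AE_restrict_space_iff)
qed

text \<open>A ball meets \<open>T\<close> in its centre; being connected, it would meet the frontier of \<open>T\<close> if it left \<open>T\<close>.\<close>

lemma ball_subset_of_setdist:
  fixes S T :: "'a::real_normed_vector set"
  assumes "S \<subseteq> T" "open T" "0 < setdist S (frontier T)" "x \<in> S"
  shows "ball x (setdist S (frontier T)) \<subseteq> T"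
proof (rule ccontr)
  let ?B = "ball x (setdist S (frontier T))"
  assume "\<not> ?B \<subseteq> T"
  moreover have "x \<in> ?B" "x \<in> T" using assms by auto
  ultimately have "?B \<inter> frontier T \<noteq> {}"
    by (intro connected_Int_frontier convex_connected convex_ball) blast+
  then obtain y where "y \<in> ?B" "y \<in> frontier T" by blast
  then show False using setdist_le_dist[OF assms(4), of y "frontier T"] by simp
qed

theorem theorem4p4:
  fixes \<Omega> \<Omega>' :: "'a::euclidean_space set"
    and a_low \<alpha> lam :: real
    and q q' :: ennreal
  assumes "open \<Omega>" and "bounded \<Omega>" and "\<Omega>' \<Subset> \<Omega>"
    and "a_low > 0"
    and "1 \<le> q" and "0 < \<alpha>" and "\<alpha> \<le> 1"
    and "0 < lam" and "lam < real DIM('a)"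
    and "ennreal lam \<le> ennreal (2 * \<alpha>) * q"
    and "1 \<le> q'" and "q' \<le> ennreal (2 * \<alpha>) * q / ennreal lam"
  shows "\<exists>C::real. C > 0 \<and>
    (\<forall>(a :: 'a \<Rightarrow> real) (g :: 'a \<Rightarrow> real) (F :: 'a \<Rightarrow> 'a) (u :: 'a \<Rightarrow> real) (Du :: 'a \<Rightarrow> 'a).
       a \<in> Lp \<Omega> \<infinity> \<longrightarrow>
       (AE x in lebesgue_on \<Omega>. a_low \<le> a x) \<longrightarrow>
       g \<in> Lp \<Omega> q \<longrightarrow>
       (AE (x, y) in lebesgue_on (\<Omega> \<times> \<Omega>). \<bar>a x - a y\<bar> \<le> g x * norm (x - y) powr \<alpha>) \<longrightarrow>
       weak_solution \<Omega> a F u Du \<longrightarrow>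
       F \<in> Morrey \<Omega> 2 lam q' \<longrightarrow>
         Du \<in> Morrey \<Omega>' 2 lam q' \<and>
         Morrey_norm \<Omega>' 2 lam q' Du
           \<le> ennreal C * ((1 + Lp_norm \<Omega> q g epowr (lam / (2 * \<alpha>))) * Lp_norm \<Omega> 2 Du
                           + Morrey_norm \<Omega> 2 lam q' F))"
proof -
  define \<beta> where "\<beta> = lam / (2 * \<alpha>)"
  have \<beta>: "0 < \<beta>" using assms by (simp add: \<beta>_def)
  define \<delta> where "\<delta> = setdist \<Omega>' (frontier \<Omega>)"
  have sub: "\<Omega>' \<subseteq> \<Omega>" "open \<Omega>'" "0 < \<delta>" using assms(3) by (auto simp: compactly_inside_def \<delta>_def)
  have sets: "\<Omega>' \<in> sets lebesgue" "\<Omega> \<in> sets lebesgue" using assms(1) sub by auto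
  have ball: "ball x \<delta> \<subseteq> \<Omega>" if "x \<in> \<Omega>'" for x
    unfolding \<delta>_def using assms(1) sub that by (intro ball_subset_of_setdist) (auto simp: \<delta>_def)
  have lm: "\<Omega> \<in> lmeasurable" using assms by (intro lmeasurable_open) auto
  have exps: "q' \<noteq> \<infinity> \<and> enn2real q' * \<beta> \<le> enn2real q" if q: "q \<noteq> \<infinity>"
  proof -
    obtain Q where Q: "q = ennreal Q" "0 \<le> Q" using q by (cases q) auto
    have e: "ennreal (2 * \<alpha>) * q / ennreal lam = ennreal (2 * \<alpha> * Q / lam)"
      using Q assms by (simp add: divide_ennreal flip: ennreal_mult)
    have "q' \<le> ennreal (2 * \<alpha> * Q / lam)" using assms(12) by (simp add: e)
    then obtain p where p: "q' = ennreal p" "0 \<le> p" "p \<le> 2 * \<alpha> * Q / lam"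
      using Q assms by (cases q') (auto simp: top_unique)
    then have "p * \<beta> \<le> Q" using assms by (simp add: \<beta>_def field_simps)
    then show ?thesis using p Q by simp
  qed
  have "\<exists>C>0. \<forall>g::'a \<Rightarrow> real. g \<in> Lp \<Omega> q \<longrightarrow>
     eLp_norm \<Omega> q' (\<lambda>x. 1 + ennreal (\<bar>g x\<bar> powr \<beta>)) \<le> ennreal C * (1 + Lp_norm \<Omega> q g epowr \<beta>)"
    by (rule weight_norm_bound[OF lm \<beta> assms(5,11)]) (rule exps)
  then obtain Cw where Cw: "0 < Cw" "\<And>g::'a \<Rightarrow> real. g \<in> Lp \<Omega> q \<Longrightarrow>
     eLp_norm \<Omega> q' (\<lambda>x. 1 + ennreal (\<bar>g x\<bar> powr \<beta>)) \<le> ennreal Cw * (1 + Lp_norm \<Omega> q g epowr \<beta>)"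
    by blast
  show ?thesis
  proof (rule pointwise_morrey_bound[OF assms(4,6,8,9) sub(3)], goal_cases)
    case (1 C)
    note C = 1(1) and pointwise = 1(2)[folded \<beta>_def]
    define K where "K = 4 * C * (Cw + 1)"
    have K: "0 < K" using C Cw by (simp add: K_def)
    show ?case
    proof (intro exI[of _ K] conjI K allI impI)
      fix a g :: "'a \<Rightarrow> real" and F :: "'a \<Rightarrow> 'a" and u and Du :: "'a \<Rightarrow> 'a"
      assume a: "a \<in> Lp \<Omega> \<infinity>" and al: "AE x in lebesgue_on \<Omega>. a_low \<le> a x" and g: "g \<in> Lp \<Omega> q"
        and osc: "AE (x, y) in lebesgue_on (\<Omega> \<times> \<Omega>). \<bar>a x - a y\<bar> \<le> g x * norm (x - y) powr \<alpha>"
        and sol: "weak_solution \<Omega> a F u Du" and F: "F \<in> Morrey \<Omega> 2 lam q'"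
      have D2: "Du \<in> Lp \<Omega> 2" and F2: "F \<in> Lp \<Omega> 2"
        using sol by (auto simp: weak_solution_def H1_gradient_def)
      have D2': "Du \<in> Lp \<Omega>' 2" by (rule Lp_2_subset[OF D2 sub(1) sets])
      have am: "a \<in> borel_measurable (lebesgue_on \<Omega>)" using a by (simp add: Lp_def)
      have gm [measurable]: "g \<in> borel_measurable (lebesgue_on \<Omega>)" using g by (simp add: Lp_def)
      have E: "Lp_norm \<Omega> 2 Du = ennreal (sqrt (energy Du \<Omega>))" by (rule Lp_norm_energy[OF Lp_2D(2)[OF D2]])
      have cm: "concentration \<Omega>' 2 lam Du \<in> borel_measurable (lebesgue_on \<Omega>')"
        by (rule concentration_measurable[OF D2' sub(2)])
      have cF: "concentration \<Omega> 2 lam F \<in> borel_measurable (lebesgue_on \<Omega>)" and FM: "Morrey_norm \<Omega> 2 lam q' F < \<infinity>"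
        using F by (auto simp: Morrey_def)
      have pt: "AE x in lebesgue_on \<Omega>'. concentration \<Omega>' 2 lam Du x \<le>
          ennreal C * ((1 + ennreal (\<bar>g x\<bar> powr \<beta>)) * Lp_norm \<Omega> 2 Du + concentration \<Omega> 2 lam F x)"
        using AE_lebesgue_on_subset[OF AE_product_sections[OF assms(1) osc] sub(1) sets]
          AE_lebesgue_on_subset[OF al sub(1) sets] AE_space
      proof eventually_elim
        case (elim x)
        then have x: "x \<in> \<Omega>'" by simp
        show ?case
        proof (cases "concentration \<Omega> 2 lam F x")
          case top
          then show ?thesis using C by (simp add: ennreal_mult_top)
        next
          case (real N)
          have osc': "AE y in lebesgue_on \<Omega>. \<bar>a x - a y\<bar> \<le> \<bar>g x\<bar> * norm (x - y) powr \<alpha>"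
            using elim(1) by eventually_elim (meson abs_ge_self mult_right_mono order_trans powr_ge_zero)
          have FN: "energy F (ball x r) \<le> N\<^sup>2 * r powr lam" if "0 < r" "r \<le> \<delta>" for r
            using ball[OF x] real that by (intro energy_le_concentration[OF F2 assms(1)]) auto
          have nn: "0 \<le> (1 + \<bar>g x\<bar> powr \<beta>) * sqrt (energy Du \<Omega>)"
            by (intro mult_nonneg_nonneg add_nonneg_nonneg) (auto simp: energy_nonneg)
          have "concentration \<Omega>' 2 lam Du x \<le> ennreal (C * ((1 + \<bar>g x\<bar> powr \<beta>) * sqrt (energy Du \<Omega>) + N))"
          proof (rule concentration_le[OF D2 sub(1,2) assms(1) _ _ D2'])
            show "0 \<le> C * ((1 + \<bar>g x\<bar> powr \<beta>) * sqrt (energy Du \<Omega>) + N)" using C nn real(1) by simp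
            show "energy Du (ball x r \<inter> \<Omega>) \<le> (C * ((1 + \<bar>g x\<bar> powr \<beta>) * sqrt (energy Du \<Omega>) + N))\<^sup>2 * r powr lam"
              if "0 < r" for r
              by (rule pointwise[OF assms(1) sol am ball[OF x] elim(2) abs_ge_zero real(1) osc' FN that])
          qed
          also have "\<dots> = ennreal C * ((1 + ennreal (\<bar>g x\<bar> powr \<beta>)) * Lp_norm \<Omega> 2 Du + concentration \<Omega> 2 lam F x)"
            using C real nn by (simp add: E ennreal_mult energy_nonneg)
          finally show ?thesis .
        qed
      qed
      have "Morrey_norm \<Omega>' 2 lam q' Du \<le> ennreal (4 * C) *
          (eLp_norm \<Omega> q' (\<lambda>x. 1 + ennreal (\<bar>g x\<bar> powr \<beta>)) * Lp_norm \<Omega> 2 Du + eLp_norm \<Omega> q' (concentration \<Omega> 2 lam F))"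
        unfolding Morrey_norm_def
        by (rule eLp_norm_sum_bound[OF sub(1) sets assms(11) cm _ cF C pt]) measurable
      also have "\<dots> \<le> ennreal (4 * C) *
          (ennreal (Cw + 1) * (1 + Lp_norm \<Omega> q g epowr \<beta>) * Lp_norm \<Omega> 2 Du + ennreal (Cw + 1) * Morrey_norm \<Omega> 2 lam q' F)"
      proof (intro mult_left_mono add_mono mult_right_mono)
        have "ennreal Cw * (1 + Lp_norm \<Omega> q g epowr \<beta>) \<le> ennreal (Cw + 1) * (1 + Lp_norm \<Omega> q g epowr \<beta>)"
          by (intro mult_right_mono ennreal_leI) auto
        then show "eLp_norm \<Omega> q' (\<lambda>x. 1 + ennreal (\<bar>g x\<bar> powr \<beta>)) \<le> ennreal (Cw + 1) * (1 + Lp_norm \<Omega> q g epowr \<beta>)"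
          using Cw(2)[OF g] by (rule order_trans[rotated])
        have "1 * Morrey_norm \<Omega> 2 lam q' F \<le> ennreal (Cw + 1) * Morrey_norm \<Omega> 2 lam q' F"
          using Cw(1) by (intro mult_right_mono) (auto simp flip: ennreal_1 intro!: ennreal_leI simp del: ennreal_1)
        then show "eLp_norm \<Omega> q' (concentration \<Omega> 2 lam F) \<le> ennreal (Cw + 1) * Morrey_norm \<Omega> 2 lam q' F"
          by (simp add: Morrey_norm_def)
      qed auto
      also have "\<dots> = ennreal K * ((1 + Lp_norm \<Omega> q g epowr \<beta>) * Lp_norm \<Omega> 2 Du + Morrey_norm \<Omega> 2 lam q' F)"
      proof -
        have "ennreal K = ennreal (4 * C) * ennreal (Cw + 1)"
          unfolding K_def using C Cw by (intro ennreal_mult) auto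
        moreover have "k * (c * X * Y + c * Z) = k * c * (X * Y + Z)" for k c X Y Z :: ennreal
          by (simp add: distrib_left mult.assoc)
        ultimately show ?thesis by simp
      qed
      finally have main: "Morrey_norm \<Omega>' 2 lam q' Du \<le>
        ennreal K * ((1 + Lp_norm \<Omega> q g epowr \<beta>) * Lp_norm \<Omega> 2 Du + Morrey_norm \<Omega> 2 lam q' F)" .
      then show "Morrey_norm \<Omega>' 2 lam q' Du
             \<le> ennreal K * ((1 + Lp_norm \<Omega> q g epowr (lam / (2 * \<alpha>))) * Lp_norm \<Omega> 2 Du + Morrey_norm \<Omega> 2 lam q' F)"
        by (simp add: \<beta>_def)
      have "Lp_norm \<Omega> q g epowr \<beta> < \<infinity>"
        using g by (cases "Lp_norm \<Omega> q g") (auto simp: Lp_def epowr_def)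
      then have "ennreal K * ((1 + Lp_norm \<Omega> q g epowr \<beta>) * Lp_norm \<Omega> 2 Du + Morrey_norm \<Omega> 2 lam q' F) < \<infinity>"
        using FM by (simp add: E ennreal_mult_less_top)
      then have "Morrey_norm \<Omega>' 2 lam q' Du < \<infinity>" using main by (rule le_less_trans[rotated])
      then show "Du \<in> Morrey \<Omega>' 2 lam q'"
        using D2' cm by (simp add: Morrey_def)
    qed
  qed
qed

end
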